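(* Every essentially $4$-edge-connected graph $G$ satisfies $f(G)\leq 3$.
   Context: Graphs are finite and undirected; parallel edges are allowed. For a graph $G=(V,E)$ and $X\subseteq V$, $\delta_G(X)$ is the set of edges with exactly one endvertex in $X$, and $G$ is $k$-edge-connected if $|\delta_G(X)|\ge k$ for every nonempty proper subset $X$ of $V$. $G$ is essentially $4$-edge-connected if it is $3$-edge-connected and for every $X$ with $|\delta_G(X)|=3$ one has $|X|=1$ or $|V-X|=1$. An orientation of $G$ replaces each edge $uv$ by exactly one of the arcs $uv$ or $vu$; for $e\in E$, $\vec e$ denotes the corresponding arc. A digraph is strongly connected if for every nonempty proper vertex subset $X$ some arc leaves $X$. For a $3$-edge-connected graph $G$, the Frank number $f(G)$ is the minimum integer $k$ such that there exist $k$ orientations $D_1,\dots,D_k$ of $G$ with the property that for every edge $e$ of $G$ there is an $i$ with $D_i-\vec e$ strongly connected. *)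

theory Defs
  imports "HOL-Library.Extended_Nat" "Graph_Theory.Digraph_Component"
begin

text \<open>
  Undirected multigraphs: edges are abstract objects, so parallel edges are distinct
  elements of \<open>edges G\<close> with the same set of ends. A loop is an edge whose set of
  ends is a singleton; loops are not excluded, but they lie in no cut.
\<close>

record ('v, 'e) mgraph =
  nodes :: "'v set"
  edges :: "'e set"
  ends :: "'e \<Rightarrow> 'v set"

locale fin_mgraph =
  fixes G :: "('v, 'e) mgraph"
  assumes finite_nodes: "finite (nodes G)"
    and finite_edges: "finite (edges G)"
    and ends_in_nodes: "e \<in> edges G \<Longrightarrow> \<exists>u\<in>nodes G. \<exists>v\<in>nodes G. ends G e = {u, v}"

definition cut :: "('v, 'e) mgraph \<Rightarrow> 'v set \<Rightarrow> 'e set" where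
  "cut G X = {e \<in> edges G. (\<exists>u v. ends G e = {u, v} \<and> u \<in> X \<and> v \<notin> X)}"

definition k_edge_connected :: "nat \<Rightarrow> ('v, 'e) mgraph \<Rightarrow> bool" where
  "k_edge_connected k G \<longleftrightarrow> (\<forall>X. X \<noteq> {} \<and> X \<subset> nodes G \<longrightarrow> k \<le> card (cut G X))"

definition essentially_4_edge_connected :: "('v, 'e) mgraph \<Rightarrow> bool" where
  "essentially_4_edge_connected G \<longleftrightarrow>
     k_edge_connected 3 G \<and>
     (\<forall>X \<subseteq> nodes G. card (cut G X) = 3 \<longrightarrow> card X = 1 \<or> card (nodes G - X) = 1)"

text \<open>The arc that replaces an edge \<open>e\<close> is again named \<open>e\<close>.\<close>

definition orientation :: "('v, 'e) mgraph \<Rightarrow> ('v, 'e) pre_digraph \<Rightarrow> bool" where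
  "orientation G D \<longleftrightarrow>
     verts D = nodes G \<and> arcs D = edges G \<and>
     (\<forall>e\<in>edges G. {tail D e, head D e} = ends G e)"

text \<open>
  Strong connectivity in terms of vertex sets. By the lemma below it is the notion
  \<^const>\<open>strongly_connected\<close> of the library, except that it also holds for the null digraph.
\<close>

definition strong :: "('v, 'e) pre_digraph \<Rightarrow> bool" where
  "strong D \<longleftrightarrow>
     (\<forall>X. X \<noteq> {} \<and> X \<subset> verts D \<longrightarrow> (\<exists>a\<in>arcs D. tail D a \<in> X \<and> head D a \<in> verts D - X))"

lemma (in wf_digraph) strongly_connected_iff_strong:
  "strongly_connected G \<longleftrightarrow> verts G \<noteq> {} \<and> strong G"
proof
  assume sc: "strongly_connected G"
  have "\<exists>a\<in>arcs G. tail G a \<in> X \<and> head G a \<in> verts G - X" if X: "X \<noteq> {}" "X \<subset> verts G" for X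
  proof (rule ccontr)
    assume no: "\<not> ?thesis"
    obtain u v where u: "u \<in> X" and v: "v \<in> verts G" "v \<notin> X" using X by blast
    have "u \<rightarrow>\<^sup>*\<^bsub>G\<^esub> v" using sc u v X unfolding strongly_connected_def by blast
    then have "v \<in> X"
    proof (induct rule: reachable_induct)
      case base
      show ?case by (rule u)
    next
      case (step x y)
      then show ?case using no head_in_verts by (auto simp: arcs_ends_conv)
    qed
    with v show False by blast
  qed
  with sc show "verts G \<noteq> {} \<and> strong G"
    by (auto simp: strongly_connected_def strong_def)
next
  assume s: "verts G \<noteq> {} \<and> strong G"
  have "u \<rightarrow>\<^sup>*\<^bsub>G\<^esub> v" if u: "u \<in> verts G" and v: "v \<in> verts G" for u v
  proof (rule ccontr)
    assume n: "\<not> u \<rightarrow>\<^sup>*\<^bsub>G\<^esub> v"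
    define X where "X = {x. u \<rightarrow>\<^sup>*\<^bsub>G\<^esub> x}"
    have "u \<in> X" "v \<notin> X" "X \<subseteq> verts G"
      using u n by (auto simp: X_def dest: reachable_in_verts)
    then obtain a where a: "a \<in> arcs G" "tail G a \<in> X" "head G a \<notin> X"
      using s v unfolding strong_def by blast
    have "tail G a \<rightarrow>\<^bsub>G\<^esub> head G a" using a(1) by (auto simp: arcs_ends_conv)
    with a(2,3) show False by (auto simp: X_def intro: reachable_adj_trans)
  qed
  with s show "strongly_connected G" by blast
qed

definition frank_cover :: "('v, 'e) mgraph \<Rightarrow> nat \<Rightarrow> bool" where
  "frank_cover G k \<longleftrightarrow>
     (\<exists>D :: nat \<Rightarrow> ('v, 'e) pre_digraph.
        (\<forall>i<k. orientation G (D i)) \<and>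
        (\<forall>e\<in>edges G. \<exists>i<k. strong (pre_digraph.del_arc (D i) e)))"

text \<open>
  The minimum is taken in \<^typ>\<open>enat\<close>, so that it would be \<open>\<infinity>\<close> if no such \<open>k\<close> existed.
\<close>

definition frank_number :: "('v, 'e) mgraph \<Rightarrow> enat" where
  "frank_number G = (INF k\<in>{k. frank_cover G k}. enat k)"

end

theory Submission
  imports Defs "HOL-Library.Multiset"
begin

text \<open>
  Call a vertex of degree 3 cubic. The key fact is that an edge set \<open>A\<close> with at most one edge at each
  cubic vertex has an orientation that stays strong when any one edge of \<open>A\<close> is deleted. To see
  this, contract vertex sets on which the edges outside \<open>A\<close> can be oriented strongly, and otherwise
  orient the sum of the graph and a suitable pairing of its odd vertices in an Eulerian way, as in Nash-Williams'
  theorem; the pairing respects only cuts that separate vertices of degree at least 4.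

  By Tutte's theorem there is a set \<open>M\<close> with exactly one edge at each cubic vertex. An
  orientation for \<open>M\<close> orients every circuit \<open>B\<close> of cubic vertices outside \<open>M\<close> cyclically, and after reversing
  \<open>B\<close> if necessary some edge of \<open>B\<close> becomes deletable as well. The remaining edges contain no
  such circuit, so they split into two sets with at most one edge at each cubic vertex, and
  these two sets have orientations of their own.
\<close>

subsection \<open>Eulerian orientations\<close>

text \<open>Three sets with at most one edge at each cubic vertex would settle everything if they
  could cover all edges. The Petersen graph shows that they need not exist: what a perfect matching
  leaves of a cubic graph may contain odd circuits. The extra deletable edge gained on each circuit
  is what breaks these open.

  In the key fact, losing an arc is harmless for a cut that two arcs leave. The Nash-Williams method
  gives two leaving arcs only where the cut has at least 4 edges, which fails at cubic vertices.
  Essential 4-edge-connectivity guarantees 4 edges in every cut that separates two vertices of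
  degree at least 4. In any other cut one side consists of cubic vertices only; each of them is made
  to have an entering and a leaving arc outside \<open>A\<close>. This produces an arc outside
  \<open>A\<close> across the cut unless some set of at least two vertices is strong in such arcs,
  and these are the sets to be contracted.\<close>

lemma eulerian_orientation:
  fixes p q :: "'i \<Rightarrow> 'n"
  assumes "finite I"
    and "\<And>n. even (card {i \<in> I. p i = n} + card {i \<in> I. q i = n})"
  shows "\<exists>t h. (\<forall>i\<in>I. t i = p i \<and> h i = q i \<or> t i = q i \<and> h i = p i) \<and>
     (\<forall>n. card {i \<in> I. t i = n} = card {i \<in> I. h i = n})"
  using assms
proof (induction "card I" arbitrary: I p q rule: less_induct)
  case less
  note fin = less.prems(1) and ev = less.prems(2)
  show ?case
  proof (cases "\<exists>i\<in>I. p i = q i")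
    case True
    then obtain i where i: "i \<in> I" "p i = q i" by blast
    let ?J = "I - {i}"
    have ins: "I = insert i ?J" using i by blast
    have cnt: "card {k \<in> I. f k = n} = card {k \<in> ?J. f k = n} + (if f i = n then 1 else 0)"
      for f :: "'i \<Rightarrow> 'n" and n
    proof -
      have "{k \<in> I. f k = n} = (if f i = n then insert i {k \<in> ?J. f k = n} else {k \<in> ?J. f k = n})"
        using i by auto
      then show ?thesis using fin by simp
    qed
    have "even (card {k \<in> ?J. p k = n} + card {k \<in> ?J. q k = n})" for n
      using ev[of n] cnt[of p n] cnt[of q n] i(2) by (auto split: if_splits)
    moreover have "card ?J < card I" using i(1) fin by (rule card_Diff1_less[rotated])
    ultimately obtain t h where th: "\<forall>k\<in>?J. t k = p k \<and> h k = q k \<or> t k = q k \<and> h k = p k"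
      "\<forall>n. card {k \<in> ?J. t k = n} = card {k \<in> ?J. h k = n}"
      using less.hyps[of ?J p q] fin by blast
    let ?t = "t(i := p i)" and ?h = "h(i := q i)"
    have "card {k \<in> I. ?t k = n} = card {k \<in> I. ?h k = n}" for n
    proof -
      have "{k \<in> ?J. ?t k = n} = {k \<in> ?J. t k = n}" "{k \<in> ?J. ?h k = n} = {k \<in> ?J. h k = n}" by auto
      then show ?thesis using cnt[of ?t n] cnt[of ?h n] th(2) i(2) by simp
    qed
    moreover have "\<forall>k\<in>I. ?t k = p k \<and> ?h k = q k \<or> ?t k = q k \<and> ?h k = p k" using th(1) by auto
    ultimately show ?thesis by blast
  next
    case noloop: False
    show ?thesis
    proof (cases "I = {}")
      case True then show ?thesis by auto
    next
      case False
      then obtain i where i: "i \<in> I" by blast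
      have npq: "p i \<noteq> q i" using noloop i by blast
      let ?b = "q i"
      have "\<exists>j\<in>I. j \<noteq> i \<and> (p j = ?b \<or> q j = ?b)"
      proof (rule ccontr)
        assume "\<not> ?thesis"
        then have "{k \<in> I. p k = ?b} = {}" "{k \<in> I. q k = ?b} = {i}" using npq i by auto
        then have "card {k \<in> I. p k = ?b} = 0" "card {k \<in> I. q k = ?b} = 1" by (metis card.empty, simp)
        then show False using ev[of ?b] by presburger
      qed
      then obtain j where j: "j \<in> I" "j \<noteq> i" "p j = ?b \<or> q j = ?b" by blast
      \<comment> \<open>The edges \<open>i\<close> and \<open>j\<close> with the common end
        \<open>q i\<close> are replaced by a single edge from \<open>p i\<close> to
        \<open>c\<close>, which keeps the index \<open>i\<close>. Parity survives because two ends
        at \<open>q i\<close> disappear. The new edge may be a loop.\<close>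
      define c where "c = (if p j = ?b then q j else p j)"
      have pqj: "p j = ?b \<and> q j = c \<or> p j = c \<and> q j = ?b" using j(3) unfolding c_def by auto
      let ?J = "I - {j}"
      let ?q = "q(i := c)"
      have iJ: "i \<in> ?J" using i j by blast
      have cnt: "card {k \<in> I. f k = n} = card {k \<in> ?J - {i}. f k = n} + (if f i = n then 1 else 0) + (if f j = n then 1 else 0)"
        for f :: "'i \<Rightarrow> 'n" and n
      proof -
        have "{k \<in> I. f k = n} = {k \<in> ?J - {i}. f k = n} \<union> ((if f i = n then {i} else {}) \<union> (if f j = n then {j} else {}))"
          using i j by auto
        also have "card \<dots> = card {k \<in> ?J - {i}. f k = n} + card ((if f i = n then {i} else {}) \<union> (if f j = n then {j} else {}))"
          by (rule card_Un_disjoint) (use fin in auto)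
        also have "card ((if f i = n then {i} else {}) \<union> (if f j = n then {j} else {})) = (if f i = n then 1 else 0) + (if f j = n then 1 else 0)"
          using j(2) by (subst card_Un_disjoint) auto
        finally show ?thesis by simp
      qed
      have cnt': "card {k \<in> ?J. f k = n} = card {k \<in> ?J - {i}. f k = n} + (if f i = n then 1 else 0)"
        for f :: "'i \<Rightarrow> 'n" and n
      proof -
        have "{k \<in> ?J. f k = n} = (if f i = n then insert i {k \<in> ?J - {i}. f k = n} else {k \<in> ?J - {i}. f k = n})"
          using iJ by auto
        then show ?thesis using fin by simp
      qed
      have qq: "{k \<in> ?J - {i}. ?q k = n} = {k \<in> ?J - {i}. q k = n}" for n by auto
      have "even (card {k \<in> ?J. p k = n} + card {k \<in> ?J. ?q k = n})" for n
        using ev[of n] cnt[of p n] cnt[of q n] cnt'[of p n] cnt'[of ?q n] qq[of n] pqj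
        by (auto split: if_splits)
      moreover have "card ?J < card I" using j(1) fin by (rule card_Diff1_less[rotated])
      ultimately obtain t h where th: "\<forall>k\<in>?J. t k = p k \<and> h k = ?q k \<or> t k = ?q k \<and> h k = p k"
        "\<forall>n. card {k \<in> ?J. t k = n} = card {k \<in> ?J. h k = n}"
        using less.hyps[of ?J p ?q] fin by blast
      have thi: "t i = p i \<and> h i = c \<or> t i = c \<and> h i = p i" using th(1) iJ by force
      \<comment> \<open>If the new edge is a loop, both alternatives of \<open>thi\<close> hold, so
        \<open>fw\<close> fixes one of them before the path through \<open>q i\<close> is directed
        accordingly.\<close>
      define fw where "fw \<longleftrightarrow> t i = p i \<and> h i = c"
      have fw1: "fw \<Longrightarrow> t i = p i \<and> h i = c" and fw2: "\<not> fw \<Longrightarrow> t i = c \<and> h i = p i"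
        using thi unfolding fw_def by auto
      let ?t = "if fw then t(j := ?b) else t(i := ?b, j := c)"
      let ?h = "if fw then h(i := ?b, j := c) else h(j := ?b)"
      have bal: "card {k \<in> I. ?t k = n} = card {k \<in> I. ?h k = n}" for n
      proof -
        have e: "{k \<in> ?J - {i}. ?t k = n} = {k \<in> ?J - {i}. t k = n}"
          "{k \<in> ?J - {i}. ?h k = n} = {k \<in> ?J - {i}. h k = n}" by auto
        have "card {k \<in> ?J - {i}. t k = n} + (if t i = n then 1 else 0)
            = card {k \<in> ?J - {i}. h k = n} + (if h i = n then 1 else 0)"
          using th(2) cnt'[of t n] cnt'[of h n] by metis
        moreover have "(if ?t i = n then 1 else 0) + (if ?t j = n then 1 else 0) + (if h i = n then 1 else 0)
            = (if ?h i = n then 1 else 0) + (if ?h j = n then 1 else 0) + (if t i = n then 1 else (0::nat))"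
          using fw1 fw2 j(2) by (cases fw) simp_all
        ultimately show ?thesis unfolding cnt[of ?t n] cnt[of ?h n] e by linarith
      qed
      have "?t k = p k \<and> ?h k = q k \<or> ?t k = q k \<and> ?h k = p k" if "k \<in> I" for k
      proof (cases "k = i \<or> k = j")
        case True
        then show ?thesis using fw1 fw2 pqj j(2) by (cases fw) auto
      next
        case False
        then have "k \<in> ?J" using that by blast
        from th(1)[rule_format, OF this] False show ?thesis by simp
      qed
      with bal show ?thesis by blast
    qed
  qed
qed

subsection \<open>Splitting off at a vertex of degree 4\<close>

definition crosses :: "'a set \<Rightarrow> 'a \<times> 'a \<Rightarrow> bool" where
  "crosses X e \<longleftrightarrow> (fst e \<in> X) \<noteq> (snd e \<in> X)"

definition cut_size :: "('a \<times> 'a) multiset \<Rightarrow> 'a set \<Rightarrow> nat" where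
  "cut_size M X = size (filter_mset (crosses X) M)"

definition separates :: "'a set \<Rightarrow> 'a set \<Rightarrow> bool" where
  "separates K X \<longleftrightarrow> K \<inter> X \<noteq> {} \<and> K - X \<noteq> {}"

lemma cut_size_empty[simp]: "cut_size {#} X = 0"
  and cut_size_add: "cut_size (add_mset e M) X = cut_size M X + of_bool (crosses X e)"
  and cut_size_union: "cut_size (M + N) X = cut_size M X + cut_size N X"
  by (auto simp: cut_size_def)

lemma cut_size_Compl[simp]: "cut_size M (- X) = cut_size M X"
  unfolding cut_size_def by (rule arg_cong[where f=size], rule filter_mset_cong) (auto simp: crosses_def)

lemma separates_Compl[simp]: "separates K (- X) \<longleftrightarrow> separates K X"
  by (auto simp: separates_def)

lemma cut_size_submod: "cut_size M (X \<inter> Y) + cut_size M (X \<union> Y) \<le> cut_size M X + cut_size M Y"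
  by (induction M) (auto simp: cut_size_add crosses_def of_bool_def)

lemma cut_size_posimod: "cut_size M (X - Y) + cut_size M (Y - X) \<le> cut_size M X + cut_size M Y"
  by (induction M) (auto simp: cut_size_add crosses_def of_bool_def)

lemma cut_size_mono: "M \<subseteq># N \<Longrightarrow> cut_size M X \<le> cut_size N X"
  unfolding cut_size_def by (intro size_mset_mono multiset_filter_mono)

lemma cut_size_image: "cut_size (image_mset (map_prod f f) M) X = cut_size M (f -` X)"
  by (induction M) (auto simp: cut_size_add crosses_def)

lemma cut_size_cong: "(\<And>e. e \<in># M \<Longrightarrow> crosses X e = crosses Y e) \<Longrightarrow> cut_size M X = cut_size M Y"
  unfolding cut_size_def by (metis filter_mset_cong)

lemma cut_size_filter_irrelevant:
  "(\<And>e. e \<in># M \<Longrightarrow> crosses X e \<Longrightarrow> Q e) \<Longrightarrow> cut_size (filter_mset Q M) X = cut_size M X"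
  unfolding cut_size_def filter_filter_mset by (metis (mono_tags, lifting) filter_mset_cong)

lemma cut_size_0_iff: "cut_size M X = 0 \<longleftrightarrow> (\<forall>e\<in>#M. \<not> crosses X e)"
  by (induction M) (auto simp: cut_size_add)

definition between :: "('a \<times> 'a) multiset \<Rightarrow> 'a set \<Rightarrow> 'a set \<Rightarrow> nat" where
  "between M X Y = size (filter_mset (\<lambda>e. fst e \<in> X \<and> snd e \<in> Y \<or> fst e \<in> Y \<and> snd e \<in> X) M)"

lemma between_add: "between (add_mset e M) X Y = between M X Y + of_bool (fst e \<in> X \<and> snd e \<in> Y \<or> fst e \<in> Y \<and> snd e \<in> X)"
  and between_empty[simp]: "between {#} X Y = 0"
  by (auto simp: between_def)

lemma between_0_iff: "between M X Y = 0 \<longleftrightarrow> (\<forall>e\<in>#M. \<not> (fst e \<in> X \<and> snd e \<in> Y \<or> fst e \<in> Y \<and> snd e \<in> X))"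
  by (induction M) (auto simp: between_add)

lemma cut_size_disjoint: "X \<inter> Y = {} \<Longrightarrow> cut_size M X + cut_size M Y = cut_size M (X \<union> Y) + 2 * between M X Y"
  by (induction M) (auto simp: cut_size_add between_add crosses_def of_bool_def)

lemma cut_size_submod_eq: "cut_size M (X \<inter> Y) + cut_size M (X \<union> Y) + 2 * between M (X - Y) (Y - X) = cut_size M X + cut_size M Y"
  by (induction M) (auto simp: cut_size_add between_add crosses_def of_bool_def)

lemma cut_size_posimod_eq: "cut_size M (X - Y) + cut_size M (Y - X) + 2 * between M (X \<inter> Y) (- (X \<union> Y)) = cut_size M X + cut_size M Y"
  by (induction M) (auto simp: cut_size_add between_add crosses_def of_bool_def)

text \<open>This serves contraction of \<open>X\<close>: \<open>f\<close> moves vertices only within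
  \<open>X\<close>, so a set \<open>Z\<close> that contains or avoids \<open>X\<close> does not
  distinguish \<open>v\<close> from \<open>f v\<close>, and the dropped edges do not cross
  \<open>Z\<close>.\<close>

lemma image_filter_dd:
  assumes "X \<subseteq> Z \<or> X \<inter> Z = {}"
    and f: "\<And>v. v \<notin> X \<Longrightarrow> f v = v" "\<And>v. v \<in> X \<Longrightarrow> f v \<in> X"
  shows "cut_size (image_mset (map_prod f f) (filter_mset (\<lambda>e. \<not> (fst e \<in> X \<and> snd e \<in> X)) M)) Z = cut_size M Z"
proof -
  have 1: "f v \<in> Z \<longleftrightarrow> v \<in> Z" for v using assms by (cases "v \<in> X") auto
  have "cut_size (filter_mset (\<lambda>e. \<not> (fst e \<in> X \<and> snd e \<in> X)) M) (f -` Z) = cut_size (filter_mset (\<lambda>e. \<not> (fst e \<in> X \<and> snd e \<in> X)) M) Z"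
    by (rule cut_size_cong) (auto simp: crosses_def 1)
  also have "\<dots> = cut_size M Z"
    by (rule cut_size_filter_irrelevant) (use assms(1) in \<open>auto simp: crosses_def\<close>)
  finally show ?thesis by (simp add: cut_size_image)
qed

text \<open>
  \<open>s\<close> has degree 4 in \<open>M\<close> with neighbours \<open>a, b, c, d\<close> (repetitions allowed), and \<open>M0\<close> is \<open>M\<close>
  without its edges at \<open>s\<close>.
\<close>

definition is_star :: "('a \<times> 'a) multiset \<Rightarrow> ('a \<times> 'a) multiset \<Rightarrow> 'a \<Rightarrow> 'a \<Rightarrow> 'a \<Rightarrow> 'a \<Rightarrow> 'a \<Rightarrow> bool" where
  "is_star M M0 s a b c d \<longleftrightarrow>
    (\<forall>Z. cut_size M Z = cut_size M0 Z + of_bool ((s \<in> Z) \<noteq> (a \<in> Z)) + of_bool ((s \<in> Z) \<noteq> (b \<in> Z))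
      + of_bool ((s \<in> Z) \<noteq> (c \<in> Z)) + of_bool ((s \<in> Z) \<noteq> (d \<in> Z))) \<and>
    (\<forall>x\<in>{a, b, c, d}. x \<noteq> s \<and> (\<exists>e\<in>#M. {fst e, snd e} = {s, x}))"

text \<open>This says that \<open>A\<close> is the single vertex \<open>x\<close> of
  \<open>K\<close> up to vertices that meet no edge. Vertex sets range over the whole type, so
  equality with \<open>{x}\<close> cannot be expected.\<close>

definition only_end :: "'a set \<Rightarrow> ('a \<times> 'a) multiset \<Rightarrow> 'a set \<Rightarrow> 'a \<Rightarrow> bool" where
  "only_end K M A x \<longleftrightarrow> x \<in> K \<and> (\<forall>e\<in>#M. (fst e \<in> A \<longrightarrow> fst e = x) \<and> (snd e \<in> A \<longrightarrow> snd e = x))"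

text \<open>A cut that forbids replacing the four edges at \<open>s\<close> by \<open>ab\<close> and \<open>cd\<close>.\<close>

definition bad_cut :: "'a set \<Rightarrow> ('a \<times> 'a) multiset \<Rightarrow> 'a \<Rightarrow> 'a \<Rightarrow> 'a \<Rightarrow> 'a \<Rightarrow> 'a \<Rightarrow> 'a set \<Rightarrow> bool" where
  "bad_cut K M0 s a b c d S \<longleftrightarrow>
    s \<notin> S \<and> cut_size M0 S \<le> 3 \<and> separates (K - {s}) S \<and> a \<in> S \<and> b \<in> S \<and> c \<notin> S \<and> d \<notin> S"

section \<open>The three ways of splitting off at a vertex of degree 4\<close>

context
  fixes K :: "'a set" and M M0 :: "('a \<times> 'a) multiset" and s :: 'a
  assumes cut4: "\<And>X. separates K X \<Longrightarrow> 4 \<le> cut_size M X"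
    and tight: "\<And>X e e'. separates K X \<Longrightarrow> cut_size M X = 4 \<Longrightarrow> e \<in># M \<Longrightarrow> fst e \<in> X \<Longrightarrow> snd e \<in> X \<Longrightarrow>
       e' \<in># M \<Longrightarrow> fst e' \<notin> X \<Longrightarrow> snd e' \<notin> X \<Longrightarrow> False"
    and sK: "s \<in> K"
    and M0s: "\<And>e. e \<in># M0 \<Longrightarrow> fst e \<noteq> s \<and> snd e \<noteq> s"
    and M0M: "M0 \<subseteq># M"
begin

abbreviation (input) "star \<equiv> is_star M M0 s"
abbreviation (input) "full \<equiv> only_end K M"
abbreviation (input) "bad \<equiv> bad_cut K M0 s"

text \<open>Together with the next two lemmas this provides the transpositions that generate all
  orderings of the four neighbours.\<close>

lemma star12: assumes "star a b c d" shows "star b a c d"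
proof -
  note st = assms[unfolded is_star_def]
  show ?thesis unfolding is_star_def
    using st[THEN conjunct1] by (intro conjI allI) (simp_all only: add_ac, use st[THEN conjunct2] in blast)
qed

lemma star23: assumes "star a b c d" shows "star a c b d"
proof -
  note st = assms[unfolded is_star_def]
  show ?thesis unfolding is_star_def
    using st[THEN conjunct1] by (intro conjI allI) (simp_all only: add_ac, use st[THEN conjunct2] in blast)
qed

lemma star34: assumes "star a b c d" shows "star a b d c"
proof -
  note st = assms[unfolded is_star_def]
  show ?thesis unfolding is_star_def
    using st[THEN conjunct1] by (intro conjI allI) (simp_all only: add_ac, use st[THEN conjunct2] in blast)
qed

lemma cut_size_M0_s: "cut_size M0 (- X - {s}) = cut_size M0 X"
proof -
  have "cut_size M0 (- X - {s}) = cut_size M0 (- X)" by (rule cut_size_cong) (auto simp: crosses_def dest: M0s)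
  then show ?thesis by simp
qed

lemma bad_compl: assumes "star a b c d" "bad a b c d S" shows "bad c d a b (- S - {s})"
proof -
  have "separates (K - {s}) (- S - {s})" using assms(2) by (auto simp: bad_cut_def separates_def)
  then show ?thesis using assms cut_size_M0_s[of S] by (auto simp: bad_cut_def is_star_def)
qed

text \<open>
  The four corners that two bad sets form with the complement of \<open>s\<close> contain one neighbour of \<open>s\<close>
  each. A corner that meets \<open>K\<close> has cut size at least 3 in \<open>M0\<close>, and if it is 3, then the corner
  is a tight cut of \<open>M\<close>, so that it contains no edge.
\<close>

lemma corner_ge:
  assumes "star t a b c" "s \<notin> A" "t \<in> A" "a \<notin> A" "b \<notin> A" "c \<notin> A" "A \<inter> K \<noteq> {}"
  shows "3 \<le> cut_size M0 A" "cut_size M A = cut_size M0 A + 1" "separates K A"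
proof -
  show "separates K A" using assms sK by (auto simp: separates_def)
  then have "4 \<le> cut_size M A" by (rule cut4)
  moreover show "cut_size M A = cut_size M0 A + 1" using assms by (auto simp: is_star_def)
  ultimately show "3 \<le> cut_size M0 A" by simp
qed

lemma corner_full:
  assumes st: "star t a b c" and A: "s \<notin> A" "t \<in> A" "a \<notin> A" "b \<notin> A" "c \<notin> A" "A \<inter> K \<noteq> {}" and le: "cut_size M0 A \<le> 3"
  shows "full A t"
proof -
  note ge = corner_ge[OF st A]
  have 4: "cut_size M A = 4" using ge le by simp
  \<comment> \<open>The edge from \<open>s\<close> to \<open>a\<close> lies outside
    \<open>A\<close>, so by \<open>tight\<close> no edge lies inside the tight set
    \<open>A\<close>.\<close>
  obtain e' where e': "e' \<in># M" "{fst e', snd e'} = {s, a}" using st unfolding is_star_def by blast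
  have out: "fst e' \<notin> A" "snd e' \<notin> A" using e'(2) A by (metis doubleton_eq_iff)+
  have ni: "\<not> (fst e \<in> A \<and> snd e \<in> A)" if "e \<in># M" for e
    using tight[OF ge(3) 4 that _ _ e'(1) out] by blast
  obtain k where k: "k \<in> A" "k \<in> K" using A by blast
  have "separates K {k}" using k sK A by (auto simp: separates_def)
  then have "4 \<le> cut_size M {k}" by (rule cut4)
  \<comment> \<open>With no edge inside \<open>A\<close>, all edges at \<open>k\<close> cross
    \<open>A\<close>. There are at least 4 of them and only 4 edges cross \<open>A\<close>, so every
    edge crossing \<open>A\<close> ends in \<open>k\<close>, among them the one from
    \<open>s\<close> to \<open>t\<close>.\<close>
  have sub: "filter_mset (crosses {k}) M \<subseteq># filter_mset (crosses A) M"
  proof -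
    have "filter_mset (crosses {k}) M = filter_mset (crosses {k}) (filter_mset (crosses A) M)"
      unfolding filter_filter_mset by (rule filter_mset_cong[OF refl]) (use ni k in \<open>auto simp: crosses_def\<close>)
    then show ?thesis by (metis multiset_filter_subset)
  qed
  have eq: "filter_mset (crosses {k}) M = filter_mset (crosses A) M"
  proof (rule ccontr)
    assume "\<not> ?thesis"
    then have "filter_mset (crosses {k}) M \<subset># filter_mset (crosses A) M" using sub by (simp add: subset_mset.less_le)
    then have "cut_size M {k} < cut_size M A" unfolding cut_size_def by (rule mset_subset_size)
    then show False using 4 \<open>4 \<le> cut_size M {k}\<close> by simp
  qed
  have cr: "crosses {k} e" if "e \<in># M" "crosses A e" for e
    using that eq by (metis (mono_tags, lifting) filter_mset_eq_conv mem_Collect_eq set_mset_filter)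
  obtain et where et: "et \<in># M" "{fst et, snd et} = {s, t}" using st unfolding is_star_def by blast
  have "crosses A et" using et(2) A by (auto simp: crosses_def doubleton_eq_iff)
  then have "crosses {k} et" using cr et(1) by blast
  then have "t = k" using et(2) k A by (auto simp: crosses_def doubleton_eq_iff)
  moreover have "(fst e \<in> A \<longrightarrow> fst e = k) \<and> (snd e \<in> A \<longrightarrow> snd e = k)" if "e \<in># M" for e
    using ni[OF that] cr[OF that] k by (auto simp: crosses_def)
  ultimately show ?thesis using k by (auto simp: only_end_def)
qed

text \<open>If the inner and the outer corner both meet \<open>K\<close>, submodularity applies.
  Otherwise both differences meet \<open>K\<close>, because \<open>Sa\<close> and \<open>Sb\<close>
  separate \<open>K - {s}\<close>, and posimodularity applies. Either way two numbers that are at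
  least 3 add up to at most 6, so both equal 3 and no edge can join the other two corners.\<close>

lemma bad_pair:
  assumes st: "star t a b c" and Sa: "bad t a b c Sa" and Sb: "bad t b a c Sb"
  shows "full (Sa \<inter> Sb) t \<and> full (- (Sa \<union> Sb) - {s}) c \<and> between M0 (Sa - Sb) (Sb - Sa) = 0 \<or>
    full (Sa - Sb) a \<and> full (Sb - Sa) b \<and> between M0 (Sa \<inter> Sb) (- (Sa \<union> Sb)) = 0"
proof -
  let ?R = "- (Sa \<union> Sb) - {s}"
  note st' = star12[OF star23[OF star34[OF st]]] star12[OF st] star12[OF star23[OF st]]
  have ne: "t \<noteq> s" "a \<noteq> s" "b \<noteq> s" "c \<noteq> s" using st by (auto simp: is_star_def)
  have R: "cut_size M0 ?R = cut_size M0 (Sa \<union> Sb)" by (rule cut_size_M0_s)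
  show ?thesis
  proof (cases "(Sa \<inter> Sb) \<inter> K \<noteq> {} \<and> ?R \<inter> K \<noteq> {}")
    case True
    have g1: "3 \<le> cut_size M0 (Sa \<inter> Sb)" by (rule corner_ge(1)[OF st]) (use Sa Sb True in \<open>auto simp: bad_cut_def\<close>)
    have g2: "3 \<le> cut_size M0 ?R" by (rule corner_ge(1)[OF st'(1)]) (use Sa Sb True ne in \<open>auto simp: bad_cut_def\<close>)
    have eq: "cut_size M0 (Sa \<inter> Sb) + cut_size M0 ?R + 2 * between M0 (Sa - Sb) (Sb - Sa) \<le> 6"
      using cut_size_submod_eq[of M0 Sa Sb] Sa Sb R by (simp add: bad_cut_def)
    have "full (Sa \<inter> Sb) t" by (rule corner_full[OF st]) (use Sa Sb True eq g1 g2 in \<open>auto simp: bad_cut_def\<close>)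
    moreover have "full ?R c" by (rule corner_full[OF st'(1)]) (use Sa Sb True eq g1 g2 ne in \<open>auto simp: bad_cut_def\<close>)
    ultimately show ?thesis using eq g1 g2 by simp
  next
    case False
    have K1: "(Sa - Sb) \<inter> K \<noteq> {}" "(Sb - Sa) \<inter> K \<noteq> {}"
    proof -
      have "(K - {s}) \<inter> Sa \<noteq> {}" "(K - {s}) - Sa \<noteq> {}" "(K - {s}) \<inter> Sb \<noteq> {}" "(K - {s}) - Sb \<noteq> {}"
        using Sa Sb by (auto simp: bad_cut_def separates_def)
      moreover have "(Sa \<inter> Sb) \<inter> K = {} \<or> ?R \<inter> K = {}" using False by blast
      ultimately show "(Sa - Sb) \<inter> K \<noteq> {}" "(Sb - Sa) \<inter> K \<noteq> {}" by blast+
    qed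
    have g1: "3 \<le> cut_size M0 (Sa - Sb)" by (rule corner_ge(1)[OF st'(2)]) (use Sa Sb K1 in \<open>auto simp: bad_cut_def\<close>)
    have g2: "3 \<le> cut_size M0 (Sb - Sa)" by (rule corner_ge(1)[OF st'(3)]) (use Sa Sb K1 ne in \<open>auto simp: bad_cut_def\<close>)
    have eq: "cut_size M0 (Sa - Sb) + cut_size M0 (Sb - Sa) + 2 * between M0 (Sa \<inter> Sb) (- (Sa \<union> Sb)) \<le> 6"
      using cut_size_posimod_eq[of M0 Sa Sb] Sa Sb by (simp add: bad_cut_def)
    have "full (Sa - Sb) a" by (rule corner_full[OF st'(2)]) (use Sa Sb K1 eq g1 g2 in \<open>auto simp: bad_cut_def\<close>)
    moreover have "full (Sb - Sa) b" by (rule corner_full[OF st'(3)]) (use Sa Sb K1 eq g1 g2 ne in \<open>auto simp: bad_cut_def\<close>)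
    ultimately show ?thesis using eq g1 g2 by simp
  qed
qed

text \<open>If \<open>t\<close> is not in \<open>K\<close>, only the second alternative of
  \<open>bad_pair\<close> remains, for each two of the sets. Then no edge of \<open>M0\<close>
  leaves \<open>Sa \<inter> Sb \<inter> Sc\<close>. With \<open>s\<close> added, this set is left
  only by the edges from \<open>s\<close> to \<open>a\<close>, \<open>b\<close> and
  \<open>c\<close>: a cut of size 3 that separates \<open>K\<close>.\<close>

lemma bad_triple:
  assumes st: "star t a b c" and Sa: "bad t a b c Sa" and Sb: "bad t b a c Sb" and Sc: "bad t c a b Sc"
  shows "t \<in> K"
proof (rule ccontr)
  assume tK: "t \<notin> K"
  note st1 = star34[OF st] star34[OF star23[OF st]]
  have Sa': "bad t a c b Sa" and Sb': "bad t b c a Sb" and Sc': "bad t c b a Sc" using Sa Sb Sc by (auto simp: bad_cut_def)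
  have ab: "full (Sa - Sb) a" "full (Sb - Sa) b" "between M0 (Sa \<inter> Sb) (- (Sa \<union> Sb)) = 0"
    using bad_pair[OF st Sa Sb] tK by (auto simp: only_end_def)
  have ac: "full (Sa - Sc) a" "full (Sc - Sa) c" "between M0 (Sa \<inter> Sc) (- (Sa \<union> Sc)) = 0"
    using bad_pair[OF st1(1) Sa' Sc] tK by (auto simp: only_end_def)
  have bc: "full (Sb - Sc) b" "full (Sc - Sb) c" "between M0 (Sb \<inter> Sc) (- (Sb \<union> Sc)) = 0"
    using bad_pair[OF st1(2) Sb' Sc'] tK by (auto simp: only_end_def)
  let ?T = "Sa \<inter> Sb \<inter> Sc"
  have abc: "a \<notin> Sb" "a \<notin> Sc" "b \<notin> Sa" "b \<notin> Sc" "c \<notin> Sa" "c \<notin> Sb" "t \<in> ?T" "s \<notin> Sa"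
    using Sa Sb Sc by (auto simp: bad_cut_def)
  have no: False if e: "e \<in># M0" and xy: "(x, y) = e \<or> (y, x) = e" and x: "x \<in> ?T" and y: "y \<notin> ?T" for e x y
  proof -
    have eM: "e \<in># M" using e M0M by (metis mset_subset_eqD)
    have full: "y = z" if "full A z" "y \<in> A" for A z using that eM xy by (auto simp: only_end_def)
    have b0: "\<not> (x \<in> A \<and> y \<in> B)" if "between M0 A B = 0" for A B
      using that e xy unfolding between_0_iff by fastforce
    \<comment> \<open>In the first three cases no edge joins the intersection of two of the sets to
      the outside of their union. In the others \<open>y\<close> would have to be \<open>a\<close>
      or \<open>b\<close>, which lies in only one of the three sets.\<close>
    consider "y \<notin> Sa \<union> Sb" | "y \<notin> Sa \<union> Sc" | "y \<notin> Sb \<union> Sc" | "y \<in> Sb - Sa" "y \<in> Sc" | "y \<in> Sa - Sb" "y \<in> Sc" | "y \<in> Sa - Sc" "y \<in> Sb"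
      using y by blast
    then show False
    proof cases
      case 1 then show ?thesis using b0[OF ab(3)] x by blast
    next
      case 2 then show ?thesis using b0[OF ac(3)] x by blast
    next
      case 3 then show ?thesis using b0[OF bc(3)] x by blast
    next
      case 4 then show ?thesis using full[OF ab(2)] abc by blast
    next
      case 5 then show ?thesis using full[OF ab(1)] abc by blast
    next
      case 6 then show ?thesis using full[OF ac(1)] abc by blast
    qed
  qed
  have "cut_size M0 ({s} \<union> ?T) = 0"
    unfolding cut_size_0_iff
  proof
    fix e assume e: "e \<in># M0"
    show "\<not> crosses ({s} \<union> ?T) e"
      using no[OF e, of "fst e" "snd e"] no[OF e, of "snd e" "fst e"] M0s[OF e] by (auto simp: crosses_def)
  qed
  moreover have "cut_size M ({s} \<union> ?T) = cut_size M0 ({s} \<union> ?T) + 3"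
    using st abc by (auto simp: is_star_def)
  moreover have "separates K ({s} \<union> ?T)" using sK ab(1) abc st by (auto simp: separates_def only_end_def is_star_def)
  ultimately show False using cut4[of "{s} \<union> ?T"] by simp
qed

text \<open>All four corners meet \<open>K\<close>, so both uncrossing inequalities are tight and
  \<open>Sa\<close> and its two parts all have cut size 3. But the cut sizes of two disjoint sets
  and of their union always have an even sum.\<close>

lemma bad_four:
  assumes st: "star t a b c" and Sa: "bad t a b c Sa" and Sb: "bad t b a c Sb"
    and K4: "t \<in> K" "a \<in> K" "b \<in> K" "c \<in> K"
  shows False
proof -
  let ?R = "- (Sa \<union> Sb) - {s}"
  note st' = star12[OF star23[OF star34[OF st]]] star12[OF st] star12[OF star23[OF st]]
  have ne: "t \<noteq> s" "a \<noteq> s" "b \<noteq> s" "c \<noteq> s" using st by (auto simp: is_star_def)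
  have R: "cut_size M0 ?R = cut_size M0 (Sa \<union> Sb)" by (rule cut_size_M0_s)
  have g: "3 \<le> cut_size M0 (Sa \<inter> Sb)" "3 \<le> cut_size M0 ?R" "3 \<le> cut_size M0 (Sa - Sb)" "3 \<le> cut_size M0 (Sb - Sa)"
    by (rule corner_ge(1)[OF st] corner_ge(1)[OF st'(1)] corner_ge(1)[OF st'(2)] corner_ge(1)[OF st'(3)];
        use Sa Sb K4 ne in \<open>auto simp: bad_cut_def\<close>)+
  have le: "cut_size M0 Sa \<le> 3" "cut_size M0 Sb \<le> 3" using Sa Sb by (auto simp: bad_cut_def)
  have "cut_size M0 (Sa \<inter> Sb) + cut_size M0 (Sa - Sb) = cut_size M0 Sa + 2 * between M0 (Sa \<inter> Sb) (Sa - Sb)"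
    using cut_size_disjoint[of "Sa \<inter> Sb" "Sa - Sb" M0] by (metis Diff_disjoint Int_Diff_Un Int_Diff_disjoint)
  moreover have "cut_size M0 (Sa \<inter> Sb) = 3" "cut_size M0 (Sa - Sb) = 3" "cut_size M0 Sa = 3"
    using cut_size_submod_eq[of M0 Sa Sb] cut_size_posimod_eq[of M0 Sa Sb] g le R by linarith+
  ultimately show False by presburger
qed

text \<open>With \<open>s\<close> put on either side of \<open>X\<close>, the cut has at least 4
  edges in \<open>M\<close>. These two bounds leave only one way to have fewer than 4 edges after
  splitting: \<open>a\<close> and \<open>b\<close> on one side, \<open>c\<close> and
  \<open>d\<close> on the other.\<close>

lemma bad_exists:
  assumes st: "star a b c d" and X: "separates (K - {s}) X" and lt: "cut_size (M0 + {#(a, b), (c, d)#}) X < 4"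
  shows "\<exists>S. bad a b c d S"
proof -
  let ?Y = "X - {s}"
  have eqX: "cut_size M0 ?Y = cut_size M0 X" by (rule cut_size_cong) (auto simp: crosses_def dest: M0s)
  have eqX': "cut_size M0 (insert s X) = cut_size M0 X" by (rule cut_size_cong) (auto simp: crosses_def dest: M0s)
  have sp: "separates K ?Y" "separates K (insert s X)" using X by (auto simp: separates_def)
  have ne: "a \<noteq> s" "b \<noteq> s" "c \<noteq> s" "d \<noteq> s" using st by (auto simp: is_star_def)
  let ?i = "of_bool (a \<in> X) + of_bool (b \<in> X) + of_bool (c \<in> X) + of_bool (d \<in> X) :: nat"
  have 1: "4 \<le> cut_size M0 X + ?i" using cut4[OF sp(1)] st ne eqX by (simp add: is_star_def)
  have 2: "4 \<le> cut_size M0 X + of_bool (a \<notin> X) + of_bool (b \<notin> X) + of_bool (c \<notin> X) + of_bool (d \<notin> X)"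
    using cut4[OF sp(2)] st ne eqX' by (simp add: is_star_def)
  have 3: "cut_size M0 X + of_bool ((a \<in> X) \<noteq> (b \<in> X)) + of_bool ((c \<in> X) \<noteq> (d \<in> X)) < 4"
    using lt by (simp add: cut_size_add cut_size_union crosses_def)
  have "(a \<in> X \<and> b \<in> X \<and> c \<notin> X \<and> d \<notin> X) \<or> (a \<notin> X \<and> b \<notin> X \<and> c \<in> X \<and> d \<in> X)"
    using 1 2 3 by (cases "a \<in> X"; cases "b \<in> X"; cases "c \<in> X"; cases "d \<in> X"; simp)
  then show ?thesis
  proof
    assume "a \<in> X \<and> b \<in> X \<and> c \<notin> X \<and> d \<notin> X"
    then have "bad a b c d ?Y" using X 3 eqX ne by (auto simp: bad_cut_def separates_def)
    then show ?thesis by blast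
  next
    assume "a \<notin> X \<and> b \<notin> X \<and> c \<in> X \<and> d \<in> X"
    then have "bad c d a b ?Y" using X 3 eqX ne by (auto simp: bad_cut_def separates_def)
    then have "bad a b c d (- ?Y - {s})" using bad_compl[OF star23[OF star34[OF star12[OF star23[OF st]]]]] by blast
    then show ?thesis by blast
  qed
qed

text \<open>If all three pairings of the neighbours fail, there is a bad set for each of them. Up to
  complements, these three sets form a bad triple for every one of the four neighbours, so
  \<open>bad_triple\<close> puts all four into \<open>K\<close>, and \<open>bad_four\<close>
  excludes that.\<close>

lemma good_split:
  assumes st: "star x1 x2 x3 x4"
  shows "\<exists>a b c d. star a b c d \<and> (\<forall>X. separates (K - {s}) X \<longrightarrow> 4 \<le> cut_size (M0 + {#(a, b), (c, d)#}) X)"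
proof (rule ccontr)
  assume no: "\<not> ?thesis"
  have "\<exists>S. bad a b c d S" if "star a b c d" for a b c d
    using no bad_exists that by (meson not_le)
  note ex = this
  note st' = star23[OF st] star23[OF star34[OF st]]
  obtain X Y Z where X: "bad x1 x2 x3 x4 X" and Y: "bad x1 x3 x2 x4 Y" and Z: "bad x1 x4 x2 x3 Z"
    using ex[OF st] ex[OF st'(1)] ex[OF st'(2)] by blast
  note X' = bad_compl[OF st X] and Y' = bad_compl[OF st'(1) Y] and Z' = bad_compl[OF st'(2) Z]
  note st2 = star12[OF st] star12[OF st'(1)] star12[OF st'(2)]
  have "bad x2 x1 x3 x4 X" "bad x2 x3 x1 x4 (- Z - {s})" "bad x2 x4 x1 x3 (- Y - {s})"
    "bad x3 x1 x2 x4 Y" "bad x3 x2 x1 x4 (- Z - {s})" "bad x3 x4 x1 x2 (- X - {s})"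
    "bad x4 x1 x2 x3 Z" "bad x4 x2 x1 x3 (- Y - {s})" "bad x4 x3 x1 x2 (- X - {s})"
    using X Y Z X' Y' Z' by (auto simp: bad_cut_def)
  then have "x1 \<in> K" "x2 \<in> K" "x3 \<in> K" "x4 \<in> K"
    using bad_triple[OF st X Y Z] bad_triple[OF st2(1)] bad_triple[OF st2(2)] bad_triple[OF st2(3)] by blast+
  then show False using bad_four[OF st X Y] by blast
qed

end

subsection \<open>Pairings for cuts separating a set of vertices\<close>

text \<open>
  The pairing theorem of Nash-Williams for \<open>k = 2\<close>, restricted to cuts that separate \<open>K\<close>. A vertex outside
  \<open>K\<close> must be met by at most one edge of the pairing.
\<close>

definition admissible :: "'a set \<Rightarrow> ('a \<times> 'a) multiset \<Rightarrow> bool" where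
  "admissible K M \<longleftrightarrow> (\<forall>X. separates K X \<longrightarrow> 4 \<le> cut_size M X) \<and> (\<forall>v. v \<notin> K \<longrightarrow> cut_size M {v} \<le> 3)"

definition pairing :: "'a set \<Rightarrow> ('a \<times> 'a) multiset \<Rightarrow> ('a \<times> 'a) multiset \<Rightarrow> bool" where
  "pairing K M P \<longleftrightarrow> (\<forall>X. separates K X \<longrightarrow> cut_size P X + 4 \<le> cut_size M X) \<and>
     (\<forall>v. even (cut_size P {v}) \<longleftrightarrow> even (cut_size M {v})) \<and> (\<forall>v. v \<notin> K \<longrightarrow> cut_size P {v} \<le> 1)"

text \<open>An edge that can be removed while the relevant cuts keep 4 edges may serve as a pairing
  edge, as it adds one to both sides of the inequality. An end of it outside \<open>K\<close> has
  odd degree in \<open>M\<close>, since degree 2 is excluded; hence it has even degree in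
  \<open>M'\<close> and no edge of \<open>P\<close>.\<close>

lemma pairing_add:
  assumes adm: "admissible K M" and no2: "\<And>v. v \<notin> K \<Longrightarrow> cut_size M {v} \<noteq> 2" and M: "M = add_mset e M'"
    and cut: "\<And>X. separates K X \<Longrightarrow> 4 \<le> cut_size M' X"
  shows "admissible K M'" "pairing K M' P \<Longrightarrow> pairing K M (add_mset e P)"
proof -
  show "admissible K M'" using adm cut by (auto simp: admissible_def M cut_size_add)
next
  assume P: "pairing K M' P"
  have "cut_size (add_mset e P) {v} \<le> 1" if v: "v \<notin> K" for v
  proof (cases "crosses {v} e")
    case True
    have "cut_size M {v} \<le> 3" "cut_size M {v} \<noteq> 2" using adm no2 v by (auto simp: admissible_def)
    then have "cut_size M' {v} = 0 \<or> cut_size M' {v} = 2" using True by (auto simp: M cut_size_add)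
    then have "even (cut_size P {v})" "cut_size P {v} \<le> 1" using P v by (auto simp: pairing_def)
    then have "cut_size P {v} = 0" by presburger
    then show ?thesis by (simp add: cut_size_add)
  next
    case False then show ?thesis using P v by (auto simp: pairing_def cut_size_add)
  qed
  then show "pairing K M (add_mset e P)" using P by (auto simp: pairing_def M cut_size_add)
qed

lemma other_end:
  assumes "crosses {v} e" obtains x where "x \<noteq> v" "{fst e, snd e} = {v, x}"
    "\<And>Z. crosses Z e = ((v \<in> Z) \<noteq> (x \<in> Z))"
proof
  let ?x = "if fst e = v then snd e else fst e"
  show "?x \<noteq> v" "{fst e, snd e} = {v, ?x}" "\<And>Z. crosses Z e = ((v \<in> Z) \<noteq> (?x \<in> Z))"
    using assms by (auto simp: crosses_def)
qed

text \<open>The vertex is bypassed: its two edges become one edge between \<open>x1\<close> and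
  \<open>x2\<close>, a loop if these agree. In a cut of \<open>M'\<close> the vertex may be counted
  on the side of \<open>x1\<close>, which is free since it is outside \<open>K\<close>; so no
  relevant cut falls below 4.\<close>

lemma pairing_suppress:
  assumes adm: "admissible K M" and v: "v \<notin> K" "cut_size M {v} = 2"
  obtains M' where "size M' < size M" "admissible K M'" "\<And>P. pairing K M' P \<Longrightarrow> pairing K M P"
proof -
  have "size (filter_mset (crosses {v}) M) = 2" using v(2) by (simp add: cut_size_def)
  then obtain e1 e2 where e: "filter_mset (crosses {v}) M = {#e1, e2#}"
    by (metis One_nat_def Suc_1 size_1_singleton_mset size_eq_Suc_imp_eq_union size_single add_mset_add_single union_mset_add_mset_right nat.inject size_add_mset)
  define M0 where "M0 = filter_mset (\<lambda>e. \<not> crosses {v} e) M"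
  have M: "M = M0 + {#e1, e2#}" using e multiset_partition[of M "crosses {v}"] by (simp add: M0_def)
  have "e1 \<in># filter_mset (crosses {v}) M" "e2 \<in># filter_mset (crosses {v}) M" unfolding e by auto
  then have c: "crosses {v} e1" "crosses {v} e2" by auto
  obtain x1 where x1: "x1 \<noteq> v" "\<And>Z. crosses Z e1 = ((v \<in> Z) \<noteq> (x1 \<in> Z))" using other_end[OF c(1)] by metis
  obtain x2 where x2: "x2 \<noteq> v" "\<And>Z. crosses Z e2 = ((v \<in> Z) \<noteq> (x2 \<in> Z))" using other_end[OF c(2)] by metis
  define M' where "M' = add_mset (x1, x2) M0"
  have ddM: "cut_size M Z = cut_size M0 Z + of_bool ((v \<in> Z) \<noteq> (x1 \<in> Z)) + of_bool ((v \<in> Z) \<noteq> (x2 \<in> Z))" for Z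
    by (simp add: M cut_size_add cut_size_union x1(2) x2(2))
  have ddM': "cut_size M' Z = cut_size M0 Z + of_bool ((x1 \<in> Z) \<noteq> (x2 \<in> Z))" for Z
    by (simp add: M'_def cut_size_add crosses_def)
  have M0v: "cut_size M0 (insert v Z) = cut_size M0 (Z - {v})" for Z
    by (rule cut_size_cong) (auto simp: M0_def crosses_def)
  have M0v': "cut_size M0 Z = cut_size M0 (Z - {v})" for Z
    by (rule cut_size_cong) (auto simp: M0_def crosses_def)
  have le: "cut_size M' Z \<le> cut_size M Z" for Z by (simp add: ddM ddM' of_bool_def)
  have par: "even (cut_size M' {u}) \<longleftrightarrow> even (cut_size M {u})" for u
    by (simp add: ddM ddM' of_bool_def)
  have cut: "4 \<le> cut_size M' X" if "separates K X" for X
  proof -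
    have "separates K (if x1 \<in> X then insert v X else X - {v})" using that v by (auto simp: separates_def)
    then have "4 \<le> cut_size M (if x1 \<in> X then insert v X else X - {v})" using adm by (auto simp: admissible_def)
    also have "\<dots> \<le> cut_size M' X" using x1 x2 M0v[of X] M0v'[of X] by (auto simp: ddM ddM')
    finally show ?thesis .
  qed
  have 1: "admissible K M'" using cut adm by (auto simp: admissible_def intro: order_trans[OF le])
  have 2: "pairing K M P" if "pairing K M' P" for P
    using that par by (auto simp: pairing_def intro: order_trans[OF _ le])
  have "size M' < size M" by (simp add: M M'_def)
  then show thesis using 1 2 that by blast
qed

text \<open>
  Both sides of a tight cut are contracted. A set that crosses the cut is handled by submodularity,
  applied to the pairings of the two contracted graphs separately.
\<close>

lemma pairing_contract:
  fixes K :: "'a set"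
  assumes adm: "admissible K M" and X: "separates K X" "cut_size M X = 4"
    and e: "e \<in># M" "fst e \<in> X" "snd e \<in> X" and e': "e' \<in># M" "fst e' \<notin> X" "snd e' \<notin> X"
    and IH: "\<And>M' (K' :: 'a set). size M' < size M \<Longrightarrow> admissible K' M' \<Longrightarrow> \<exists>P. pairing K' M' P"
  shows "\<exists>P. pairing K M P"
proof -
  define contr where "contr X a = (\<lambda>v::'a. if v \<in> X then a else v)" for X :: "'a set" and a
  define cm where "cm X a = image_mset (map_prod (contr X a) (contr X a)) (filter_mset (\<lambda>e. \<not> (fst e \<in> X \<and> snd e \<in> X)) M)" for X a
  have dcm: "cut_size (cm X a) Z = cut_size M Z" if "X \<subseteq> Z \<or> X \<inter> Z = {}" "a \<in> X" for X Z :: "'a set" and a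
    unfolding cm_def by (rule image_filter_dd) (use that in \<open>auto simp: contr_def\<close>)
  have half: "\<exists>Q. (\<forall>e\<in>#Q. fst e \<notin> X \<and> snd e \<notin> X) \<and>
      (\<forall>Z. X \<subseteq> Z \<and> K - Z \<noteq> {} \<or> X \<inter> Z = {} \<and> K \<inter> Z \<noteq> {} \<longrightarrow> cut_size Q Z + 4 \<le> cut_size M Z) \<and>
      (\<forall>v. v \<notin> X \<longrightarrow> (even (cut_size Q {v}) \<longleftrightarrow> even (cut_size M {v})) \<and> (v \<notin> K \<longrightarrow> cut_size Q {v} \<le> 1))"
    if X: "separates K X" "cut_size M X = 4" and e: "e \<in># M" "fst e \<in> X" "snd e \<in> X" for X and e
  proof -
    \<comment> \<open>\<open>X\<close> is contracted onto a vertex of \<open>K\<close>, which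
      represents \<open>X\<close> in the new \<open>K\<close>. The other vertices of
      \<open>X\<close> become isolated.\<close>
    obtain a where a: "a \<in> K" "a \<in> X" using X(1) by (auto simp: separates_def)
    let ?M = "cm X a" and ?K = "insert a (K - X)"
    have "size ?M < size M"
    proof -
      have "filter_mset (\<lambda>e. \<not> (fst e \<in> X \<and> snd e \<in> X)) M \<noteq> M" using e by (metis (mono_tags, lifting) filter_mset_eq_conv)
      then have "filter_mset (\<lambda>e. \<not> (fst e \<in> X \<and> snd e \<in> X)) M \<subset># M" by (simp add: subset_mset.less_le)
      then show ?thesis unfolding cm_def by (simp add: mset_subset_size)
    qed
    moreover have "admissible ?K ?M"
      unfolding admissible_def
    proof (intro conjI allI impI)
      fix Z assume Z: "separates ?K Z"
      let ?Z = "contr X a -` Z"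
      have "separates K ?Z" using Z a by (auto simp: separates_def contr_def)
      moreover have "cut_size ?M Z = cut_size M ?Z"
      proof -
        have "cut_size ?M Z = cut_size (filter_mset (\<lambda>e. \<not> (fst e \<in> X \<and> snd e \<in> X)) M) ?Z" unfolding cm_def by (rule cut_size_image)
        also have "\<dots> = cut_size M ?Z" by (rule cut_size_filter_irrelevant) (auto simp: crosses_def contr_def)
        finally show ?thesis .
      qed
      ultimately show "4 \<le> cut_size ?M Z" using adm by (auto simp: admissible_def)
    next
      fix v assume v: "v \<notin> ?K"
      show "cut_size ?M {v} \<le> 3"
      proof (cases "v \<in> X")
        case True
        then have "contr X a -` {v} = {}" using v by (auto simp: contr_def split: if_splits)
        then have "cut_size ?M {v} = 0" unfolding cm_def cut_size_image by (simp add: cut_size_0_iff crosses_def)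
        then show ?thesis by simp
      next
        case False
        then show ?thesis using dcm[of X "{v}" a] a v adm by (auto simp: admissible_def)
      qed
    qed
    ultimately have "\<exists>P. pairing ?K ?M P" by (rule IH)
    then obtain P where P: "pairing ?K ?M P" by blast
    define Q where "Q = filter_mset (\<lambda>e. fst e \<notin> X \<and> snd e \<notin> X) P"
    have "separates ?K X" using X(1) a by (auto simp: separates_def)
    then have "cut_size P X + 4 \<le> 4" using P dcm[of X X a] X(2) a by (auto simp: pairing_def)
    \<comment> \<open>Tightness leaves no room for a pairing edge across \<open>X\<close>, so the
      part of \<open>P\<close> outside \<open>X\<close> already accounts for all pairing edges at
      the vertices outside \<open>X\<close>.\<close>
    then have PX: "cut_size P X = 0" by simp
    have QP: "cut_size Q Z \<le> cut_size P Z" for Z unfolding Q_def by (rule cut_size_mono) simp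
    have Qv: "cut_size Q {v} = cut_size P {v}" if "v \<notin> X" for v
      unfolding Q_def
    proof (rule cut_size_filter_irrelevant)
      fix e assume "e \<in># P" "crosses {v} e"
      then show "fst e \<notin> X \<and> snd e \<notin> X" using PX that unfolding cut_size_0_iff by (auto simp: crosses_def)
    qed
    have "cut_size Q Z + 4 \<le> cut_size M Z" if "X \<subseteq> Z \<and> K - Z \<noteq> {} \<or> X \<inter> Z = {} \<and> K \<inter> Z \<noteq> {}" for Z
    proof -
      have "separates ?K Z" using that a by (auto simp: separates_def)
      then have "cut_size P Z + 4 \<le> cut_size ?M Z" using P by (auto simp: pairing_def)
      moreover have "cut_size ?M Z = cut_size M Z" by (rule dcm) (use that a in auto)
      ultimately show ?thesis using QP[of Z] by simp
    qed
    moreover have "(even (cut_size Q {v}) \<longleftrightarrow> even (cut_size M {v})) \<and> (v \<notin> K \<longrightarrow> cut_size Q {v} \<le> 1)" if "v \<notin> X" for v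
    proof -
      have "cut_size ?M {v} = cut_size M {v}" by (rule dcm) (use that a in auto)
      then show ?thesis using P Qv[OF that] that a unfolding pairing_def by (metis DiffD1 insertE)
    qed
    ultimately show ?thesis unfolding Q_def by (intro exI[of _ "filter_mset (\<lambda>e. fst e \<notin> X \<and> snd e \<notin> X) P"]) auto
  qed
  obtain Q where Q': "(\<forall>e\<in>#Q. fst e \<notin> X \<and> snd e \<notin> X) \<and>
      (\<forall>Z. X \<subseteq> Z \<and> K - Z \<noteq> {} \<or> X \<inter> Z = {} \<and> K \<inter> Z \<noteq> {} \<longrightarrow> cut_size Q Z + 4 \<le> cut_size M Z) \<and>
      (\<forall>v. v \<notin> X \<longrightarrow> (even (cut_size Q {v}) \<longleftrightarrow> even (cut_size M {v})) \<and> (v \<notin> K \<longrightarrow> cut_size Q {v} \<le> 1))"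
    using half[OF X e] by (rule exE)
  note Q = Q'[THEN conjunct1] Q'[THEN conjunct2, THEN conjunct1, rule_format] Q'[THEN conjunct2, THEN conjunct2, rule_format]
  have X': "separates K (- X)" "cut_size M (- X) = 4" "fst e' \<in> - X" "snd e' \<in> - X" using X e' by auto
  obtain R where R': "(\<forall>e\<in>#R. fst e \<notin> - X \<and> snd e \<notin> - X) \<and>
      (\<forall>Z. - X \<subseteq> Z \<and> K - Z \<noteq> {} \<or> - X \<inter> Z = {} \<and> K \<inter> Z \<noteq> {} \<longrightarrow> cut_size R Z + 4 \<le> cut_size M Z) \<and>
      (\<forall>v. v \<notin> - X \<longrightarrow> (even (cut_size R {v}) \<longleftrightarrow> even (cut_size M {v})) \<and> (v \<notin> K \<longrightarrow> cut_size R {v} \<le> 1))"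
    using half[OF X'(1,2) e'(1) X'(3,4)] by (rule exE)
  note R = R'[THEN conjunct1] R'[THEN conjunct2, THEN conjunct1, rule_format] R'[THEN conjunct2, THEN conjunct2, rule_format]
  have "pairing K M (Q + R)"
    unfolding pairing_def
  proof (intro conjI allI impI)
    fix Y assume Y: "separates K Y"
    have "crosses Y e = crosses (Y \<union> X) e \<and> crosses Y e = crosses (Y - X) e" if "e \<in># Q" for e
      using Q(1)[rule_format, OF that] by (auto simp: crosses_def)
    moreover have "crosses Y e = crosses (X \<inter> Y) e \<and> crosses Y e = crosses (X - Y) e" if "e \<in># R" for e
      using R(1)[rule_format, OF that] by (auto simp: crosses_def)
    ultimately have d: "cut_size Q Y = cut_size Q (Y \<union> X)" "cut_size Q Y = cut_size Q (Y - X)" "cut_size R Y = cut_size R (X \<inter> Y)" "cut_size R Y = cut_size R (X - Y)"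
      by (intro cut_size_cong; blast)+
    have "K \<inter> X \<noteq> {}" "K - X \<noteq> {}" "K \<inter> Y \<noteq> {}" "K - Y \<noteq> {}" using X(1) Y by (auto simp: separates_def)
    \<comment> \<open>Both \<open>X\<close> and \<open>Y\<close> separate \<open>K\<close>, so the
      two corners of some diagonal both meet \<open>K\<close>.\<close>
    then consider "K \<inter> (X \<inter> Y) \<noteq> {}" "K - (Y \<union> X) \<noteq> {}" | "K \<inter> (X - Y) \<noteq> {}" "K \<inter> (Y - X) \<noteq> {}"
      by blast
    then show "cut_size (Q + R) Y + 4 \<le> cut_size M Y"
    proof cases
      case 1
      have "cut_size Q (Y \<union> X) + 4 \<le> cut_size M (Y \<union> X)" by (rule Q(2)) (use 1 in auto)
      moreover have "cut_size R (X \<inter> Y) + 4 \<le> cut_size M (X \<inter> Y)" by (rule R(2)) (use 1 in auto)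
      ultimately show ?thesis using d(1,3) X(2) cut_size_submod[of M X Y] by (simp add: cut_size_union Un_commute)
    next
      case 2
      have "cut_size Q (Y - X) + 4 \<le> cut_size M (Y - X)" by (rule Q(2)) (use 2 in auto)
      moreover have "cut_size R (X - Y) + 4 \<le> cut_size M (X - Y)" by (rule R(2)) (use 2 in auto)
      ultimately show ?thesis using d(2,4) X(2) cut_size_posimod[of M X Y] by (simp add: cut_size_union)
    qed
  next
    fix v
    have *: "v \<in> X \<Longrightarrow> cut_size Q {v} = 0" "v \<notin> X \<Longrightarrow> cut_size R {v} = 0"
      unfolding cut_size_0_iff using Q(1) R(1) by (auto simp: crosses_def)
    show "even (cut_size (Q + R) {v}) \<longleftrightarrow> even (cut_size M {v})"
      using * Q(3)[of v] R(3)[of v] by (cases "v \<in> X") (auto simp: cut_size_union)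
    assume "v \<notin> K"
    then show "cut_size (Q + R) {v} \<le> 1"
      using * Q(3)[of v] R(3)[of v] by (cases "v \<in> X") (auto simp: cut_size_union)
  qed
  then show ?thesis by blast
qed

section \<open>Instances in which all tight cuts are trivial\<close>

lemma size_4_mset:
  assumes "size N = 4" shows "\<exists>a b c d. N = {#a, b, c, d#}"
proof -
  obtain a A where A: "N = add_mset a A" using size_eq_Suc_imp_eq_union[of N 3] assms by auto
  obtain b B where B: "A = add_mset b B" using size_eq_Suc_imp_eq_union[of A 2] assms A by auto
  obtain c C where C: "B = add_mset c C" using size_eq_Suc_imp_eq_union[of B 1] assms A B by auto
  obtain d D where D: "C = add_mset d D" using size_eq_Suc_imp_eq_union[of C 0] assms A B C by auto
  show ?thesis using assms A B C D by auto
qed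

text \<open>\<open>W\<close> contains all vertices of \<open>F\<close> that meet an edge, and it is
  finite even if \<open>F\<close>, a set over the whole type, is not. No edge has both ends in
  \<open>F\<close>, so an edge with an end in \<open>F\<close> is counted at exactly one vertex of
  \<open>W\<close>.\<close>

lemma cut_size_independent:
  assumes "finite W" "W \<subseteq> F" "\<forall>e\<in>#M. (fst e \<in> F \<longrightarrow> fst e \<in> W \<and> snd e \<notin> F) \<and> (snd e \<in> F \<longrightarrow> snd e \<in> W \<and> fst e \<notin> F)"
  shows "cut_size M F = (\<Sum>v\<in>W. cut_size M {v})" "s \<notin> F \<Longrightarrow> between M {s} F = (\<Sum>v\<in>W. between M {s} {v})"
proof -
  have *: "of_bool (crosses F e) = (\<Sum>v\<in>W. of_bool (crosses {v} e) :: nat) \<and>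
     (s \<notin> F \<longrightarrow> of_bool (fst e \<in> {s} \<and> snd e \<in> F \<or> fst e \<in> F \<and> snd e \<in> {s}) =
      (\<Sum>v\<in>W. of_bool (fst e \<in> {s} \<and> snd e \<in> {v} \<or> fst e \<in> {v} \<and> snd e \<in> {s}) :: nat))"
    if "e \<in># M" for e
  proof -
    have sum1: "(\<Sum>v\<in>W. of_bool (v = x \<and> Q) :: nat) = of_bool (x \<in> W \<and> Q)" for x Q
      using assms(1) by (cases Q) (simp_all add: of_bool_def)
    note e = assms(3)[rule_format, OF that]
    consider "fst e \<in> F" | "snd e \<in> F" "fst e \<notin> F" | "fst e \<notin> F" "snd e \<notin> F" by blast
    then show ?thesis
    proof cases
      case 1
      then have f: "fst e \<in> W" "snd e \<notin> F" using e by auto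
      have "crosses {v} e \<longleftrightarrow> v = fst e \<and> True"
        "s \<notin> F \<Longrightarrow> (fst e \<in> {s} \<and> snd e \<in> {v} \<or> fst e \<in> {v} \<and> snd e \<in> {s}) \<longleftrightarrow> v = fst e \<and> snd e = s" if "v \<in> W" for v
        using f that assms(2) 1 by (auto simp: crosses_def)
      then show ?thesis using f 1 sum1[of "fst e" True] sum1[of "fst e" "snd e = s"] by (auto simp: crosses_def cong: sum.cong)
    next
      case 2
      then have f: "snd e \<in> W" "fst e \<notin> F" using e by auto
      have "crosses {v} e \<longleftrightarrow> v = snd e \<and> True"
        "s \<notin> F \<Longrightarrow> (fst e \<in> {s} \<and> snd e \<in> {v} \<or> fst e \<in> {v} \<and> snd e \<in> {s}) \<longleftrightarrow> v = snd e \<and> fst e = s" if "v \<in> W" for v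
        using f that assms(2) 2 by (auto simp: crosses_def)
      then show ?thesis using f 2 sum1[of "snd e" True] sum1[of "snd e" "fst e = s"] by (auto simp: crosses_def cong: sum.cong)
    next
      case 3
      have "\<not> crosses {v} e" "\<not> (fst e \<in> {s} \<and> snd e \<in> {v} \<or> fst e \<in> {v} \<and> snd e \<in> {s})" if "v \<in> W" for v
        using that 3 assms(2) by (auto simp: crosses_def)
      then have a: "(\<Sum>v\<in>W. of_bool (crosses {v} e) :: nat) = 0"
        and b: "(\<Sum>v\<in>W. of_bool (fst e \<in> {s} \<and> snd e \<in> {v} \<or> fst e \<in> {v} \<and> snd e \<in> {s}) :: nat) = 0"
        by (intro sum.neutral; simp)+
      show ?thesis unfolding a b using 3 by (auto simp: crosses_def)
    qed
  qed
  have "N \<subseteq># M \<Longrightarrow> cut_size N F = (\<Sum>v\<in>W. cut_size N {v}) \<and> (s \<notin> F \<longrightarrow> between N {s} F = (\<Sum>v\<in>W. between N {s} {v}))" for N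
  proof (induction N)
    case (add e N)
    then have "e \<in># M" "N \<subseteq># M" by (auto simp: subset_mset.less_le dest: mset_subset_eq_insertD)
    then show ?case using *[of e] add.IH by (simp add: cut_size_add between_add sum.distrib)
  qed simp
  from this[of M] show "cut_size M F = (\<Sum>v\<in>W. cut_size M {v})" "s \<notin> F \<Longrightarrow> between M {s} F = (\<Sum>v\<in>W. between M {s} {v})" by auto
qed

lemma cut_size_le_sum:
  assumes "finite W" "\<And>e v. e \<in># P \<Longrightarrow> crosses F e \<Longrightarrow> v \<in> F \<Longrightarrow> crosses {v} e \<Longrightarrow> v \<in> W"
  shows "cut_size P F \<le> (\<Sum>v\<in>W. cut_size P {v})"
  using assms(2)
proof (induction P)
  case (add e P)
  have "of_bool (crosses F e) \<le> (\<Sum>v\<in>W. of_bool (crosses {v} e) :: nat)"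
  proof (cases "crosses F e")
    case True
    obtain v where v: "v \<in> F" "crosses {v} e"
    proof (cases "fst e \<in> F")
      case 1: True
      then show ?thesis using that[of "fst e"] True by (metis crosses_def singletonD singletonI)
    next
      case 2: False
      then show ?thesis using that[of "snd e"] True by (metis crosses_def singletonD singletonI)
    qed
    then have "v \<in> W" using add.prems[of e v] True by simp
    then show ?thesis using True v assms(1) member_le_sum[of v W "\<lambda>v. of_bool (crosses {v} e) :: nat"] by auto
  qed simp
  moreover have "cut_size P F \<le> (\<Sum>v\<in>W. cut_size P {v})"
  proof (rule add.IH)
    fix e' v assume "e' \<in># P" "crosses F e'" "v \<in> F" "crosses {v} e'"
    then show "v \<in> W" using add.prems[of e' v] by simp
  qed
  ultimately show ?case by (simp add: cut_size_add sum.distrib)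
qed simp

text \<open>The edges at a vertex \<open>s\<close> of \<open>K\<close> with degree 4 are split off
  by \<open>good_split\<close>, and \<open>s\<close> leaves \<open>K\<close>. The pairing of the
  smaller graph says nothing about cuts with \<open>s\<close> alone of \<open>K\<close> on one side.
  These are large for another reason: besides \<open>s\<close>, that side has only pairwise
  nonadjacent vertices of degree 3 or 0, each joined to \<open>s\<close> by at most one
  edge.\<close>

lemma pairing_split:
  fixes K :: "'a set"
  assumes adm: "admissible K M" and deg: "\<And>v. v \<notin> K \<Longrightarrow> cut_size M {v} = 0 \<or> cut_size M {v} = 3"
    and tight: "\<And>e. e \<in># M \<Longrightarrow> \<exists>X. separates K X \<and> crosses X e \<and> cut_size M X = 4"
    and nontriv: "\<And>X e e'. separates K X \<Longrightarrow> cut_size M X = 4 \<Longrightarrow> e \<in># M \<Longrightarrow> fst e \<in> X \<Longrightarrow> snd e \<in> X \<Longrightarrow>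
       e' \<in># M \<Longrightarrow> fst e' \<notin> X \<Longrightarrow> snd e' \<notin> X \<Longrightarrow> False"
    and M: "M \<noteq> {#}"
    and IH: "\<And>M' (K' :: 'a set). size M' < size M \<Longrightarrow> admissible K' M' \<Longrightarrow> \<exists>P. pairing K' M' P"
  shows "\<exists>P. pairing K M P"
proof -
  have cut4: "4 \<le> cut_size M X" if "separates K X" for X using adm that by (auto simp: admissible_def)
  have noloop: "fst e \<noteq> snd e" if "e \<in># M" for e using tight[OF that] by (auto simp: crosses_def)
  \<comment> \<open>A tight cut has a side \<open>X\<close> with no edge inside. A vertex of
    \<open>K\<close> in \<open>X\<close> has at least 4 edges, hence all those that cross the cut,
    \<open>e\<close> among them.\<close>
  have K4: "\<exists>s. s \<in> K \<and> cut_size M {s} = 4 \<and> separates K {s} \<and> crosses {s} e" if e: "e \<in># M" for e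
  proof -
    obtain X where X: "separates K X" "crosses X e" "cut_size M X = 4" "\<And>e'. e' \<in># M \<Longrightarrow> \<not> (fst e' \<in> X \<and> snd e' \<in> X)"
    proof -
      obtain X where X: "separates K X" "crosses X e" "cut_size M X = 4" using tight[OF e] by blast
      then have X': "separates K (- X)" "crosses (- X) e" "cut_size M (- X) = 4" by (auto simp: crosses_def)
      show thesis
      proof (cases "\<exists>e'\<in>#M. fst e' \<in> X \<and> snd e' \<in> X")
        case True
        then have "\<And>e'. e' \<in># M \<Longrightarrow> \<not> (fst e' \<in> - X \<and> snd e' \<in> - X)" using nontriv[OF X(1,3)] by blast
        then show ?thesis by (rule that[OF X'])
      next
        case False
        then show ?thesis using that[OF X] by blast
      qed
    qed
    obtain s where s: "s \<in> K" "s \<in> X" using X(1) by (auto simp: separates_def)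
    have ss: "separates K {s}" using s X(1) by (auto simp: separates_def)
    have eq0: "filter_mset (crosses {s}) M = filter_mset (crosses {s}) (filter_mset (crosses X) M)"
      unfolding filter_filter_mset by (rule filter_mset_cong[OF refl]) (use X(4) s in \<open>auto simp: crosses_def\<close>)
    have sub: "filter_mset (crosses {s}) M \<subseteq># filter_mset (crosses X) M"
      by (subst eq0) (rule multiset_filter_subset)
    have "filter_mset (crosses {s}) M = filter_mset (crosses X) M"
    proof (rule ccontr)
      assume "\<not> ?thesis"
      then have "filter_mset (crosses {s}) M \<subset># filter_mset (crosses X) M" using sub by (simp add: subset_mset.less_le)
      then have "cut_size M {s} < cut_size M X" unfolding cut_size_def by (rule mset_subset_size)
      then show False using X(3) cut4[OF ss] by simp
    qed
    moreover from this have "cut_size M {s} = 4" using X(3) by (simp add: cut_size_def)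
    moreover have "e \<in># filter_mset (crosses X) M" using e X(2) by simp
    ultimately have "e \<in># filter_mset (crosses {s}) M" by simp
    then show ?thesis using s ss \<open>cut_size M {s} = 4\<close> by auto
  qed
  obtain s where s: "s \<in> K" "cut_size M {s} = 4" "separates K {s}" using K4 M by (meson multiset_nonemptyE)
  have "size (filter_mset (crosses {s}) M) = 4" using s(2) by (simp add: cut_size_def)
  then obtain e1 e2 e3 e4 where es: "filter_mset (crosses {s}) M = {#e1, e2, e3, e4#}"
    using size_4_mset by blast
  define M0 where "M0 = filter_mset (\<lambda>e. \<not> crosses {s} e) M"
  have MM: "M = M0 + {#e1, e2, e3, e4#}" using es multiset_partition[of M "crosses {s}"] by (simp add: M0_def)
  have M0s: "fst e \<noteq> s \<and> snd e \<noteq> s" if "e \<in># M0" for e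
    using that noloop unfolding M0_def by (auto simp: crosses_def)
  have M0M: "M0 \<subseteq># M" unfolding M0_def by simp
  have mem: "e \<in># {#e1, e2, e3, e4#} \<Longrightarrow> crosses {s} e \<and> e \<in># M" for e unfolding es[symmetric] by simp
  have "\<exists>x. x \<noteq> s \<and> {fst e, snd e} = {s, x} \<and> (\<forall>Z. crosses Z e = ((s \<in> Z) \<noteq> (x \<in> Z)))" if "e \<in># {#e1, e2, e3, e4#}" for e
    using other_end[of s e] mem[OF that] by metis
  note ends = this
  obtain x1 where x1: "x1 \<noteq> s" "{fst e1, snd e1} = {s, x1}" "\<And>Z. crosses Z e1 = ((s \<in> Z) \<noteq> (x1 \<in> Z))" using ends[of e1] by auto
  obtain x2 where x2: "x2 \<noteq> s" "{fst e2, snd e2} = {s, x2}" "\<And>Z. crosses Z e2 = ((s \<in> Z) \<noteq> (x2 \<in> Z))" using ends[of e2] by auto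
  obtain x3 where x3: "x3 \<noteq> s" "{fst e3, snd e3} = {s, x3}" "\<And>Z. crosses Z e3 = ((s \<in> Z) \<noteq> (x3 \<in> Z))" using ends[of e3] by auto
  obtain x4 where x4: "x4 \<noteq> s" "{fst e4, snd e4} = {s, x4}" "\<And>Z. crosses Z e4 = ((s \<in> Z) \<noteq> (x4 \<in> Z))" using ends[of e4] by auto
  note x = x1 x2 x3 x4
  have "is_star M M0 s x1 x2 x3 x4"
    unfolding is_star_def
  proof (intro conjI allI ballI)
    fix Z
    show "cut_size M Z = cut_size M0 Z + of_bool ((s \<in> Z) \<noteq> (x1 \<in> Z)) + of_bool ((s \<in> Z) \<noteq> (x2 \<in> Z))
      + of_bool ((s \<in> Z) \<noteq> (x3 \<in> Z)) + of_bool ((s \<in> Z) \<noteq> (x4 \<in> Z))"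
      unfolding MM cut_size_union cut_size_add cut_size_empty using x by simp
  next
    fix y assume "y \<in> {x1, x2, x3, x4}"
    then show "y \<noteq> s" "\<exists>e\<in>#M. {fst e, snd e} = {s, y}" using x mem[of e1] mem[of e2] mem[of e3] mem[of e4] by auto
  qed
  then have "\<exists>a b c d. is_star M M0 s a b c d \<and> (\<forall>X. separates (K - {s}) X \<longrightarrow> 4 \<le> cut_size (M0 + {#(a, b), (c, d)#}) X)"
    by (rule good_split[OF _ _ s(1) _ M0M, rotated -1]) (use cut4 nontriv M0s in blast)+
  then obtain a b c d where star: "is_star M M0 s a b c d"
    and good: "\<And>X. separates (K - {s}) X \<Longrightarrow> 4 \<le> cut_size (M0 + {#(a, b), (c, d)#}) X"
    by blast
  let ?M = "M0 + {#(a, b), (c, d)#}"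
  have ddM: "cut_size M Z = cut_size M0 Z + of_bool ((s \<in> Z) \<noteq> (a \<in> Z)) + of_bool ((s \<in> Z) \<noteq> (b \<in> Z))
      + of_bool ((s \<in> Z) \<noteq> (c \<in> Z)) + of_bool ((s \<in> Z) \<noteq> (d \<in> Z))" for Z
    using star unfolding is_star_def by blast
  have ne: "a \<noteq> s" "b \<noteq> s" "c \<noteq> s" "d \<noteq> s"
    using star unfolding is_star_def by blast+
  have ddM': "cut_size ?M Z = cut_size M0 Z + of_bool ((a \<in> Z) \<noteq> (b \<in> Z)) + of_bool ((c \<in> Z) \<noteq> (d \<in> Z))" for Z
    by (simp add: cut_size_union cut_size_add crosses_def)
  have le: "cut_size ?M Z \<le> cut_size M Z" for Z unfolding ddM ddM' by (simp add: of_bool_def)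
  have par: "even (cut_size ?M {v}) \<longleftrightarrow> even (cut_size M {v})" for v
    unfolding ddM ddM' by (simp add: of_bool_def)
  have s0: "cut_size ?M {s} = 0" using M0s ne by (auto simp: ddM' cut_size_0_iff crosses_def)
  have "admissible (K - {s}) ?M"
    unfolding admissible_def
  proof (intro conjI allI impI good)
    fix v assume "v \<notin> K - {s}"
    then show "cut_size ?M {v} \<le> 3" using s0 adm order_trans[OF le[of "{v}"]] by (cases "v = s") (auto simp: admissible_def)
  qed
  moreover have "size ?M < size M" unfolding MM by simp
  ultimately obtain P where P: "pairing (K - {s}) ?M P" using IH by blast
  \<comment> \<open>After the splitting \<open>s\<close> is isolated and no longer in the set to be
    separated, so its degree in \<open>P\<close> is even and at most 1.\<close>
  have Ps: "cut_size P {s} = 0"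
  proof -
    have "even (cut_size P {s})" "cut_size P {s} \<le> 1" using P s0 by (auto simp: pairing_def)
    then show ?thesis by presburger
  qed
  have main: "cut_size P Y + 4 \<le> cut_size M Y" if Y: "K \<inter> Y = {s}" for Y
  proof -
    define F where "F = Y - {s}"
    define W where "W = {v \<in> F. cut_size M {v} = 3}"
    have FK: "F \<inter> K = {}" "s \<notin> F" "Y = insert s F" using Y by (auto simp: F_def)
    have inW: "v \<in> W" if v: "v \<in> F" "crosses {v} e" "e \<in># M" for v e
    proof -
      have "cut_size M {v} \<noteq> 0" using v by (auto simp: cut_size_0_iff)
      then show ?thesis using deg[of v] v FK by (auto simp: W_def)
    qed
    have "W \<subseteq> fst ` set_mset M \<union> snd ` set_mset M"
    proof
      fix v assume "v \<in> W"
      then have "cut_size M {v} \<noteq> 0" by (simp add: W_def)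
      then obtain e where "e \<in># M" "crosses {v} e" by (auto simp: cut_size_0_iff)
      then show "v \<in> fst ` set_mset M \<union> snd ` set_mset M" by (auto simp: crosses_def)
    qed
    then have finW: "finite W" by (rule finite_subset) simp
    have ind: "\<forall>e\<in>#M. (fst e \<in> F \<longrightarrow> fst e \<in> W \<and> snd e \<notin> F) \<and> (snd e \<in> F \<longrightarrow> snd e \<in> W \<and> fst e \<notin> F)"
    proof
      fix e assume e: "e \<in># M"
      obtain k where k: "k \<in> K" "crosses {k} e" using K4[OF e] by blast
      then have "fst e = k \<or> snd e = k" by (auto simp: crosses_def)
      moreover have "fst e \<in> F \<Longrightarrow> fst e \<in> W" "snd e \<in> F \<Longrightarrow> snd e \<in> W"
        using inW[OF _ _ e] noloop[OF e] by (auto simp: crosses_def)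
      ultimately show "(fst e \<in> F \<longrightarrow> fst e \<in> W \<and> snd e \<notin> F) \<and> (snd e \<in> F \<longrightarrow> snd e \<in> W \<and> fst e \<notin> F)"
        using k FK by auto
    qed
    have WF: "W \<subseteq> F" by (auto simp: W_def)
    have "cut_size M F = (\<Sum>v\<in>W. cut_size M {v})" by (rule cut_size_independent(1)[OF finW WF ind])
    also have "\<dots> = 3 * card W" by (simp add: W_def)
    finally have dF: "cut_size M F = 3 * card W" .
    have "between M {s} F = (\<Sum>v\<in>W. between M {s} {v})" by (rule cut_size_independent(2)[OF finW WF ind FK(2)])
    also have "\<dots> \<le> (\<Sum>v\<in>W. 1)"
    proof (rule sum_mono)
      fix v assume v: "v \<in> W"
      have "K - {s} \<noteq> {}" using s(3) by (auto simp: separates_def)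
      then have "separates K {s, v}" using s(1) v FK WF by (auto simp: separates_def)
      then have "4 \<le> cut_size M {s, v}" by (rule cut4)
      moreover have "cut_size M {s} + cut_size M {v} = cut_size M {s, v} + 2 * between M {s} {v}"
        using cut_size_disjoint[of "{s}" "{v}" M] v WF FK by (auto simp: insert_commute)
      ultimately show "between M {s} {v} \<le> 1" using s(2) v by (simp add: W_def)
    qed
    finally have bt: "between M {s} F \<le> card W" by simp
    have "cut_size M {s} + cut_size M F = cut_size M Y + 2 * between M {s} F"
      using cut_size_disjoint[of "{s}" F M] FK by simp
    \<comment> \<open>For n vertices in \<open>W\<close>, the cut has 4 + 3n edges less 2 for each
      edge between \<open>s\<close> and \<open>F\<close>, and there are at most n of these. On the
      other side each vertex of \<open>W\<close> contributes at most one edge of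
      \<open>P\<close>.\<close>
    then have big: "card W + 4 \<le> cut_size M Y" using s(2) dF bt by simp
    have "cut_size P Y = cut_size P F" unfolding FK(3) by (rule cut_size_cong) (use Ps in \<open>auto simp: cut_size_0_iff crosses_def\<close>)
    also have "\<dots> \<le> (\<Sum>v\<in>W. cut_size P {v})"
    proof (rule cut_size_le_sum[OF finW])
      fix e v assume e: "e \<in># P" "v \<in> F" "crosses {v} e"
      then have "cut_size P {v} \<noteq> 0" by (auto simp: cut_size_0_iff)
      moreover have "cut_size P {v} \<le> 1" using P FK e(2) by (auto simp: pairing_def)
      ultimately have "cut_size P {v} = 1" by simp
      then have "odd (cut_size M {v})" using P par[of v] unfolding pairing_def by (metis odd_one)
      then have "cut_size M {v} \<noteq> 0" by (metis dvd_0_right)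
      then show "v \<in> W" using deg[of v] e(2) FK by (auto simp: W_def)
    qed
    also have "\<dots> \<le> (\<Sum>v\<in>W. 1)"
    proof (rule sum_mono)
      fix v assume "v \<in> W"
      then have "v \<notin> K - {s}" using WF FK by auto
      then show "cut_size P {v} \<le> 1" using P by (auto simp: pairing_def)
    qed
    finally show ?thesis using big by simp
  qed
  have "pairing K M P"
    unfolding pairing_def
  proof (intro conjI allI impI)
    fix Y assume Y: "separates K Y"
    have ne: "K \<inter> Y \<noteq> {}" "K \<inter> - Y \<noteq> {}" using Y by (auto simp: separates_def)
    consider "separates (K - {s}) Y" | "(K - {s}) \<inter> Y = {}" | "(K - {s}) - Y = {}" unfolding separates_def by blast
    then show "cut_size P Y + 4 \<le> cut_size M Y"
    proof cases
      case 1
      then have "cut_size P Y + 4 \<le> cut_size ?M Y" using P by (auto simp: pairing_def)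
      then show ?thesis using le[of Y] by simp
    next
      case 2
      then have "K \<inter> Y = {s}" using ne(1) by blast
      then show ?thesis by (rule main)
    next
      case 3
      then have "K \<inter> - Y = {s}" using ne(2) by blast
      then show ?thesis using main[of "- Y"] by simp
    qed
  qed (use P par in \<open>auto simp: pairing_def\<close>)
  then show ?thesis by blast
qed

theorem pairing_exists: "admissible K M \<Longrightarrow> \<exists>P. pairing K M P"
proof (induction "size M" arbitrary: K M rule: less_induct)
  case less
  note adm = less.prems and IH = less.hyps
  show ?case
  proof (cases "\<exists>v. v \<notin> K \<and> cut_size M {v} = 2")
    case True
    then obtain v where "v \<notin> K" "cut_size M {v} = 2" by blast
    then obtain M' where "size M' < size M" "admissible K M'" "\<And>P. pairing K M' P \<Longrightarrow> pairing K M P"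
      using pairing_suppress[OF adm] by blast
    then show ?thesis using IH by blast
  next
    case False
    then have no2: "\<And>v. v \<notin> K \<Longrightarrow> cut_size M {v} \<noteq> 2" by blast
    show ?thesis
    proof (cases "\<exists>e M'. M = add_mset e M' \<and> (\<forall>X. separates K X \<longrightarrow> 4 \<le> cut_size M' X)")
      case True
      then obtain e M' where M: "M = add_mset e M'" and cut: "\<And>X. separates K X \<Longrightarrow> 4 \<le> cut_size M' X" by blast
      have "\<exists>P. pairing K M' P" by (rule IH) (use pairing_add(1)[OF adm no2 M cut] in \<open>auto simp: M\<close>)
      then show ?thesis using pairing_add(2)[OF adm no2 M cut] by blast
    next
      case nonrem: False
      have tight: "\<exists>X. separates K X \<and> crosses X e \<and> cut_size M X = 4" if "e \<in># M" for e
      proof -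
        obtain M' where M: "M = add_mset e M'" using \<open>e \<in># M\<close> by (metis insert_DiffM)
        then have "\<not> (\<forall>X. separates K X \<longrightarrow> 4 \<le> cut_size M' X)" using nonrem by blast
        then obtain X where X: "separates K X" "cut_size M' X < 4" by (meson not_le)
        then have "4 \<le> cut_size M X" using adm by (auto simp: admissible_def)
        then show ?thesis using X by (intro exI[of _ X]) (auto simp: M cut_size_add of_bool_def split: if_splits)
      qed
      have deg: "cut_size M {v} = 0 \<or> cut_size M {v} = 3" if v: "v \<notin> K" for v
      proof (rule ccontr)
        assume "\<not> ?thesis"
        then have 1: "cut_size M {v} = 1" using no2[OF v] adm v by (fastforce simp: admissible_def le_Suc_eq numeral_3_eq_3 numeral_2_eq_2)
        then have "size (filter_mset (crosses {v}) M) = 1" by (simp add: cut_size_def)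
        then obtain e where e: "filter_mset (crosses {v}) M = {#e#}" by (metis size_1_singleton_mset)
        then have "e \<in># filter_mset (crosses {v}) M" by simp
        then have eM: "e \<in># M" "crosses {v} e" by auto
        obtain X where X: "separates K X" "crosses X e" "cut_size M X = 4" using tight[OF eM(1)] by blast
        obtain x where x: "x \<noteq> v" "\<And>Z. crosses Z e = ((v \<in> Z) \<noteq> (x \<in> Z))" using other_end[OF eM(2)] by metis
        \<comment> \<open>Moving \<open>v\<close> to the side where the other end of its only edge
          lies turns the tight cut into one of size 3, which still separates
          \<open>K\<close>.\<close>
        let ?X = "if v \<in> X then X - {v} else insert v X"
        have "separates K ?X" using X(1) v by (auto simp: separates_def)
        then have "4 \<le> cut_size M ?X" using adm unfolding admissible_def by blast
        moreover have "cut_size M X = cut_size M ?X + 1"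
        proof -
          obtain M' where M': "M = add_mset e M'" using eM(1) by (metis insert_DiffM)
          have "cut_size M' {v} = 0" using 1 eM(2) by (simp add: M' cut_size_add)
          then have "\<And>e'. e' \<in># M' \<Longrightarrow> \<not> crosses {v} e'" unfolding cut_size_0_iff by blast
          moreover have "\<not> crosses {v} e' \<Longrightarrow> crosses X e' = crosses ?X e'" for e' by (auto simp: crosses_def)
          ultimately have "cut_size M' X = cut_size M' ?X" by (intro cut_size_cong) blast
          then show ?thesis using X(2) x by (auto simp: M' cut_size_add)
        qed
        ultimately show False using X(3) by simp
      qed
      show ?thesis
      proof (cases "\<exists>X e e'. separates K X \<and> cut_size M X = 4 \<and> e \<in># M \<and> fst e \<in> X \<and> snd e \<in> X \<and> e' \<in># M \<and> fst e' \<notin> X \<and> snd e' \<notin> X")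
        case True
        then show ?thesis using pairing_contract[OF adm] IH by blast
      next
        case nontriv: False
        show ?thesis
        proof (cases "M = {#}")
          case True
          \<comment> \<open>Without edges no cut can have size 4, so admissibility means that no set
            separates \<open>K\<close>.\<close>
          then have "pairing K M {#}" using adm by (auto simp: pairing_def admissible_def)
          then show ?thesis by blast
        next
          case False
          show ?thesis
            by (rule pairing_split[OF adm deg tight _ False]) (use nontriv IH in blast)+
        qed
      qed
    qed
  qed
qed

subsection \<open>Orientations with many deletable arcs\<close>

lemma cut_ends: "e \<in> edges G \<Longrightarrow> ends G e = {u, v} \<Longrightarrow> e \<in> cut G X \<longleftrightarrow> (u \<in> X) \<noteq> (v \<in> X)"
  by (auto simp: cut_def doubleton_eq_iff)

lemma cut_subset: "cut G X \<subseteq> edges G"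
  by (auto simp: cut_def)

definition cubic :: "('v, 'e) mgraph \<Rightarrow> 'v \<Rightarrow> bool" where
  "cubic G v \<longleftrightarrow> v \<in> nodes G \<and> card (cut G {v}) = 3"

definition sparse_at_cubic :: "('v, 'e) mgraph \<Rightarrow> 'e set \<Rightarrow> bool" where
  "sparse_at_cubic G A \<longleftrightarrow> A \<subseteq> edges G \<and> (\<forall>v. cubic G v \<longrightarrow> card (A \<inter> cut G {v}) \<le> 1)"

text \<open>Removal of a set of arcs, so that the removal of nothing and of a single arc can be
  treated alike.\<close>

definition strong_without :: "('v, 'e) pre_digraph \<Rightarrow> 'e set \<Rightarrow> bool" where
  "strong_without D F \<longleftrightarrow>
     (\<forall>X. X \<noteq> {} \<and> X \<subset> verts D \<longrightarrow> (\<exists>a\<in>arcs D - F. tail D a \<in> X \<and> head D a \<in> verts D - X))"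

lemma strong_del_arc: "strong (pre_digraph.del_arc D e) \<longleftrightarrow> strong_without D {e}"
  by (simp add: strong_def strong_without_def pre_digraph.del_arc_def)

text \<open>The case \<open>F = {}\<close> makes \<open>D\<close> itself strong also when
  \<open>A\<close> is empty.\<close>

definition deletable :: "('v, 'e) mgraph \<Rightarrow> ('v, 'e) pre_digraph \<Rightarrow> 'e set \<Rightarrow> bool" where
  "deletable G D A \<longleftrightarrow> orientation G D \<and> (\<forall>F. F = {} \<or> (\<exists>a\<in>A. F = {a}) \<longrightarrow> strong_without D F)"

text \<open>The functions \<open>t\<close> and \<open>h\<close> orient all edges of
  \<open>G\<close>, but only the arcs of \<open>B\<close> inside \<open>Y\<close> matter. Having two
  vertices in \<open>Y\<close> makes its contraction a smaller graph.\<close>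

definition strong_part :: "('v, 'e) mgraph \<Rightarrow> 'e set \<Rightarrow> 'v set \<Rightarrow> ('e \<Rightarrow> 'v) \<Rightarrow> ('e \<Rightarrow> 'v) \<Rightarrow> bool" where
  "strong_part G B Y t h \<longleftrightarrow> Y \<subseteq> nodes G \<and> 2 \<le> card Y \<and> (\<forall>e\<in>edges G. {t e, h e} = ends G e) \<and>
     (\<forall>Z. Z \<noteq> {} \<and> Z \<subset> Y \<longrightarrow> (\<exists>b\<in>B. t b \<in> Z \<and> h b \<in> Y - Z))"

text \<open>If no arc of \<open>B\<close> left \<open>X\<close>, then a minimal nonempty subset of
  \<open>X\<close> closed under the arcs of \<open>B\<close> would be a strong part. It has at least
  two vertices because every vertex of \<open>X\<close> has an arc of \<open>B\<close> to another
  vertex.\<close>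

lemma leaving_arc_exists:
  assumes fin: "finite (nodes G)" and B: "B \<subseteq> edges G" and or: "\<forall>e\<in>edges G. {t e, h e} = ends G e"
    and no: "\<And>Y. \<not> strong_part G B Y t h"
    and X: "X \<noteq> {}" "X \<subseteq> nodes G" and out: "\<And>v. v \<in> X \<Longrightarrow> \<exists>b\<in>B. t b = v \<and> h b \<noteq> v"
  shows "\<exists>b\<in>B. t b \<in> X \<and> h b \<notin> X"
proof (rule ccontr)
  assume c: "\<not> ?thesis"
  define \<Z> where "\<Z> = {Z. Z \<noteq> {} \<and> Z \<subseteq> X \<and> (\<forall>b\<in>B. t b \<in> Z \<longrightarrow> h b \<in> Z)}"
  have "X \<in> \<Z>" using X c by (auto simp: \<Z>_def)
  moreover have "finite \<Z>" using finite_subset[OF X(2) fin] by (auto simp: \<Z>_def)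
  ultimately obtain Z where Z: "Z \<in> \<Z>" "\<And>Z'. Z' \<in> \<Z> \<Longrightarrow> Z' \<subseteq> Z \<Longrightarrow> Z' = Z"
    using finite_has_minimal[of \<Z>] by (metis empty_iff)
  have finZ: "finite Z" using Z(1) finite_subset[OF X(2) fin] by (auto simp: \<Z>_def intro: finite_subset)
  obtain v where v: "v \<in> Z" using Z(1) by (auto simp: \<Z>_def)
  then obtain b where b: "b \<in> B" "t b = v" "h b \<noteq> v" using out Z(1) by (auto simp: \<Z>_def)
  then have "{v, h b} \<subseteq> Z" using Z(1) v by (auto simp: \<Z>_def)
  then have "card {v, h b} \<le> card Z" using finZ by (intro card_mono)
  then have "2 \<le> card Z" using b(3) by simp
  moreover have "\<exists>b\<in>B. t b \<in> W \<and> h b \<in> Z - W" if W: "W \<noteq> {}" "W \<subset> Z" for W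
  proof (rule ccontr)
    assume "\<not> ?thesis"
    then have "W \<in> \<Z>" using W Z(1) by (auto simp: \<Z>_def)
    then show False using Z(2)[of W] W by blast
  qed
  moreover have "Z \<subseteq> nodes G" using Z(1) X(2) by (auto simp: \<Z>_def)
  ultimately have "strong_part G B Z t h" using or by (auto simp: strong_part_def)
  then show False using no by blast
qed

lemma card_ends_parity:
  assumes "finite I"
  shows "even (card {i \<in> I. p i = v} + card {i \<in> I. q i = v}) \<longleftrightarrow> even (card {i \<in> I. crosses {v} (p i, q i)})"
proof -
  let ?A = "{i \<in> I. p i = v}" and ?B = "{i \<in> I. q i = v}"
  have "card ?A + card ?B = card (?A \<union> ?B) + card (?A \<inter> ?B)" using assms by (intro card_Un_Int) auto
  also have "?A \<union> ?B = {i \<in> I. crosses {v} (p i, q i)} \<union> (?A \<inter> ?B)" by (auto simp: crosses_def)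
  also have "card \<dots> = card {i \<in> I. crosses {v} (p i, q i)} + card (?A \<inter> ?B)"
    by (rule card_Un_disjoint) (use assms in \<open>auto simp: crosses_def\<close>)
  finally show ?thesis by presburger
qed

lemma balanced_sets:
  fixes t h :: "'i \<Rightarrow> 'n"
  assumes fin: "finite I" and bal: "\<And>n. card {i \<in> I. t i = n} = card {i \<in> I. h i = n}"
  shows "card {i \<in> I. t i \<in> S \<and> h i \<notin> S} = card {i \<in> I. h i \<in> S \<and> t i \<notin> S}"
proof -
  have cnt: "card {i \<in> I. f i \<in> S} = (\<Sum>n\<in>S \<inter> (t ` I \<union> h ` I). card {i \<in> I. f i = n})"
    if "f ` I \<subseteq> t ` I \<union> h ` I" for f
  proof -
    let ?N = "S \<inter> (t ` I \<union> h ` I)"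
    have "card {i \<in> I. f i \<in> S} = (\<Sum>i\<in>{i \<in> I. f i \<in> S}. 1)" by simp
    also have "\<dots> = (\<Sum>n\<in>?N. \<Sum>i\<in>{i \<in> {i \<in> I. f i \<in> S}. f i = n}. 1)"
      by (rule sum.group[symmetric]) (use fin that in auto)
    also have "\<dots> = (\<Sum>n\<in>?N. card {i \<in> I. f i = n})"
      by (rule sum.cong[OF refl]) (auto intro!: arg_cong[where f=card])
    finally show ?thesis .
  qed
  have "card {i \<in> I. t i \<in> S} = card {i \<in> I. h i \<in> S}" using cnt[of t] cnt[of h] bal by auto
  moreover have "card {i \<in> I. t i \<in> S} = card {i \<in> I. t i \<in> S \<and> h i \<notin> S} + card {i \<in> I. t i \<in> S \<and> h i \<in> S}"
    by (subst card_Un_disjoint[symmetric]) (use fin in \<open>auto intro!: arg_cong[where f=card]\<close>)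
  moreover have "card {i \<in> I. h i \<in> S} = card {i \<in> I. h i \<in> S \<and> t i \<notin> S} + card {i \<in> I. t i \<in> S \<and> h i \<in> S}"
    by (subst card_Un_disjoint[symmetric]) (use fin in \<open>auto intro!: arg_cong[where f=card]\<close>)
  ultimately show ?thesis by simp
qed

section \<open>Cuts and degrees in the graph\<close>

lemma (in fin_mgraph) ends_functions:
  obtains p q where "\<And>e. e \<in> edges G \<Longrightarrow> ends G e = {p e, q e}" "\<And>e. e \<in> edges G \<Longrightarrow> p e \<in> nodes G \<and> q e \<in> nodes G"
proof -
  have "\<forall>e\<in>edges G. \<exists>x. ends G e = {fst x, snd x} \<and> fst x \<in> nodes G \<and> snd x \<in> nodes G"
    using ends_in_nodes by fastforce
  then obtain f where "\<forall>e\<in>edges G. ends G e = {fst (f e), snd (f e)} \<and> fst (f e) \<in> nodes G \<and> snd (f e) \<in> nodes G" by metis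
  then show thesis using that[of "fst \<circ> f" "snd \<circ> f"] by auto
qed

lemma cut_eqI: "(\<And>e. e \<in> edges G \<Longrightarrow> e \<in> cut G X \<longleftrightarrow> e \<in> cut G Y) \<Longrightarrow> cut G X = cut G Y"
  by (rule set_eqI) (meson cut_subset subsetD)

lemma (in fin_mgraph) cut_Int: "cut G (X \<inter> nodes G) = cut G X"
proof -
  obtain p q where pq: "\<And>e. e \<in> edges G \<Longrightarrow> ends G e = {p e, q e}" "\<And>e. e \<in> edges G \<Longrightarrow> p e \<in> nodes G \<and> q e \<in> nodes G"
    using ends_functions by blast
  have "e \<in> cut G (X \<inter> nodes G) \<longleftrightarrow> e \<in> cut G X" if "e \<in> edges G" for e
    using cut_ends[OF that pq(1)[OF that]] pq(2)[OF that] by auto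
  then show ?thesis by (rule cut_eqI)
qed

lemma (in fin_mgraph) cut_compl: "cut G (nodes G - X) = cut G X"
proof -
  obtain p q where pq: "\<And>e. e \<in> edges G \<Longrightarrow> ends G e = {p e, q e}" "\<And>e. e \<in> edges G \<Longrightarrow> p e \<in> nodes G \<and> q e \<in> nodes G"
    using ends_functions by blast
  have "e \<in> cut G (nodes G - X) \<longleftrightarrow> e \<in> cut G X" if "e \<in> edges G" for e
    using cut_ends[OF that pq(1)[OF that]] pq(2)[OF that] by auto
  then show ?thesis by (rule cut_eqI)
qed

lemma (in fin_mgraph) finite_cut: "finite (cut G X)"
  using finite_edges by (auto simp: cut_def)

lemma (in fin_mgraph) deg_ge_3:
  assumes "essentially_4_edge_connected G" "v \<in> nodes G" "nodes G \<noteq> {v}"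
  shows "3 \<le> card (cut G {v})"
  using assms by (auto simp: essentially_4_edge_connected_def k_edge_connected_def)

text \<open>A cut of size 3 has a single vertex on one side. This vertex would have degree 3, yet
  each side contains a vertex of degree at least 4.\<close>

lemma (in fin_mgraph) cut_ge_4:
  assumes ess: "essentially_4_edge_connected G" and X: "separates {v \<in> nodes G. 4 \<le> card (cut G {v})} X"
  shows "4 \<le> card (cut G X)"
proof -
  let ?X = "X \<inter> nodes G"
  obtain x y where x: "x \<in> nodes G" "4 \<le> card (cut G {x})" "x \<in> X" and y: "y \<in> nodes G" "4 \<le> card (cut G {y})" "y \<notin> X"
    using X by (auto simp: separates_def)
  have "?X \<noteq> {}" "?X \<subset> nodes G" using x y by auto
  then have "3 \<le> card (cut G ?X)" using ess by (simp add: essentially_4_edge_connected_def k_edge_connected_def)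
  moreover have "card (cut G ?X) \<noteq> 3"
  proof
    assume c: "card (cut G ?X) = 3"
    then have "card ?X = 1 \<or> card (nodes G - ?X) = 1" using ess by (auto simp: essentially_4_edge_connected_def)
    then show False
    proof
      assume "card ?X = 1"
      then obtain z where z: "?X = {z}" by (rule card_1_singletonE)
      have "x \<in> ?X" using x by simp
      then have "?X = {x}" unfolding z by simp
      then show False using c x(2) by simp
    next
      assume "card (nodes G - ?X) = 1"
      then obtain z where z: "nodes G - ?X = {z}" by (rule card_1_singletonE)
      have "y \<in> nodes G - ?X" using y by simp
      then have "nodes G - ?X = {y}" unfolding z by simp
      then show False using c y(2) cut_compl[of ?X] by simp
    qed
  qed
  ultimately show ?thesis by (simp add: cut_Int)
qed

lemma (in fin_mgraph) deletable_base:
  assumes ess: "essentially_4_edge_connected G" and A: "sparse_at_cubic G A"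
    and noY: "\<And>Y t h. \<not> strong_part G (edges G - A) Y t h"
  shows "\<exists>D. deletable G D A"
proof -
  obtain p q where pq: "\<And>e. e \<in> edges G \<Longrightarrow> ends G e = {p e, q e}" "\<And>e. e \<in> edges G \<Longrightarrow> p e \<in> nodes G \<and> q e \<in> nodes G"
    using ends_functions by blast
  have cutX: "cut G X = {e \<in> edges G. crosses X (p e, q e)}" for X
    using cut_ends[OF _ pq(1)] cut_subset[of G X] by (auto simp: crosses_def)
  show ?thesis
  \<comment> \<open>With at most one node there is no set to check. The lower bound 3 on degrees
    needs a second node.\<close>
  proof (cases "card (nodes G) \<le> 1")
    case True
    let ?D = "\<lparr>verts = nodes G, arcs = edges G, tail = p, head = q\<rparr>"
    have "\<not> (X \<noteq> {} \<and> X \<subset> nodes G)" for X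
    proof
      assume X: "X \<noteq> {} \<and> X \<subset> nodes G"
      then have "card X < card (nodes G)" by (intro psubset_card_mono[OF finite_nodes]) simp
      moreover have "card X \<noteq> 0" using X finite_subset[OF _ finite_nodes, of X] by auto
      ultimately show False using True by simp
    qed
    then have "strong_without ?D F" for F unfolding strong_without_def by (metis pre_digraph.select_convs(1))
    moreover have "orientation G ?D" using pq by (simp add: orientation_def)
    ultimately show ?thesis unfolding deletable_def by blast
  next
    case False
    have not1: "nodes G \<noteq> {v}" for v using False by auto
    define K where "K = {v \<in> nodes G. 4 \<le> card (cut G {v})}"
    define M where "M = image_mset (\<lambda>e. (p e, q e)) (mset_set (edges G))"
    have ddM: "cut_size M X = card (cut G X)" for X
      unfolding cut_size_def M_def filter_mset_image_mset size_image_mset cutX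
      using finite_edges by (simp add: filter_mset_mset_set)
    have cubicI: "cubic G v" if "v \<in> nodes G" "v \<notin> K" for v
      using deg_ge_3[OF ess that(1) not1] that by (auto simp: K_def cubic_def)
    have "admissible K M"
      unfolding admissible_def ddM
    proof (intro conjI allI impI)
      show "4 \<le> card (cut G X)" if "separates K X" for X using cut_ge_4[OF ess] that unfolding K_def .
      show "card (cut G {v}) \<le> 3" if "v \<notin> K" for v
      proof (cases "v \<in> nodes G")
        case True then show ?thesis using cubicI[OF True that] by (simp add: cubic_def)
      next
        case False
        then have "cut G {v} = {}" unfolding cutX using pq(2) by (auto simp: crosses_def)
        then show ?thesis by simp
      qed
    qed
    then obtain P where P: "pairing K M P" using pairing_exists by blast
    obtain ps where ps: "mset ps = P" using ex_mset by blast
    have ddP: "cut_size P X = card {j \<in> {..<length ps}. crosses X (ps ! j)}" for X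
      unfolding cut_size_def ps[symmetric] mset_filter[symmetric] size_mset length_filter_conv_card
      by (simp add: lessThan_def)
    have "\<exists>S. S \<subseteq> cut G {v} - A \<and> card S = 2" if "cubic G v" for v
    proof -
      have "card (cut G {v}) = 3" "card (A \<inter> cut G {v}) \<le> 1" using that A by (auto simp: cubic_def sparse_at_cubic_def)
      moreover have "card (cut G {v}) = card (A \<inter> cut G {v}) + card (cut G {v} - A)"
        by (subst card_Un_disjoint[symmetric]) (use finite_cut in \<open>auto intro!: arg_cong[where f=card]\<close>)
      ultimately have "2 \<le> card (cut G {v} - A)" by simp
      then show ?thesis by (meson obtain_subset_with_card_n)
    qed
    then obtain S where S: "\<And>v. cubic G v \<Longrightarrow> S v \<subseteq> cut G {v} - A \<and> card (S v) = 2" by metis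
    \<comment> \<open>At a cubic vertex \<open>v\<close> the two edges in \<open>S v\<close> are moved to a separate node \<open>(v, True)\<close>,
      so that an Eulerian orientation has one of them leave and the other enter \<open>v\<close>.\<close>
    define I where "I = Inl ` edges G \<union> Inr ` {..<length ps}"
    have finI: "finite I" using finite_edges by (simp add: I_def)
    define pp where "pp = case_sum p (\<lambda>j. fst (ps ! j))"
    define qq where "qq = case_sum q (\<lambda>j. snd (ps ! j))"
    define sp where "sp v i \<longleftrightarrow> cubic G v \<and> (\<exists>e\<in>S v. i = Inl e)" for v and i :: "'e + nat"
    define p' where "p' i = (pp i, sp (pp i) i)" for i
    define q' where "q' i = (qq i, sp (qq i) i)" for i
    have cardI: "card {i \<in> I. Q i} = card {e \<in> edges G. Q (Inl e)} + card {j \<in> {..<length ps}. Q (Inr j)}" for Q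
    proof -
      let ?L = "Inl ` {e \<in> edges G. Q (Inl e)} :: ('e + nat) set"
      let ?R = "Inr ` {j \<in> {..<length ps}. Q (Inr j)} :: ('e + nat) set"
      have "{i \<in> I. Q i} = ?L \<union> ?R" by (auto simp: I_def)
      moreover have "card (?L \<union> ?R) = card ?L + card ?R"
        by (rule card_Un_disjoint) (use finite_edges in auto)
      ultimately show ?thesis by (simp add: card_image)
    qed
    have crossI: "card {i \<in> I. crosses X (pp i, qq i)} = cut_size M X + cut_size P X" for X
      unfolding cardI ddM ddP cutX by (simp add: pp_def qq_def)
    have True2: "card {i \<in> I. p' i = (v, True)} + card {i \<in> I. q' i = (v, True)} = (if cubic G v then 2 else 0)" for v
    proof (cases "cubic G v")
      case True
      have SE: "S v \<subseteq> edges G" "finite (S v)" using S[OF True] cut_subset[of G "{v}"] finite_subset[OF _ finite_cut[of "{v}"], of "S v"] by auto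
      have SC: "crosses {v} (p e, q e)" if "e \<in> S v" for e using S[OF True] that unfolding cutX by auto
      have "card {i \<in> I. p' i = (v, True)} = card {e \<in> S v. p e = v}"
        unfolding cardI using SE(1) True by (auto simp: p'_def pp_def sp_def intro!: arg_cong[where f=card])
      moreover have "card {i \<in> I. q' i = (v, True)} = card {e \<in> S v. q e = v}"
        unfolding cardI using SE(1) True by (auto simp: q'_def qq_def sp_def intro!: arg_cong[where f=card])
      moreover have "card {e \<in> S v. p e = v} + card {e \<in> S v. q e = v} = card (S v)"
        by (subst card_Un_disjoint[symmetric]) (use SE SC in \<open>auto simp: crosses_def intro!: arg_cong[where f=card]\<close>)
      ultimately show ?thesis using S[OF True] True by simp
    next
      case False
      then have "{i \<in> I. p' i = (v, True)} = {}" "{i \<in> I. q' i = (v, True)} = {}" by (auto simp: p'_def q'_def sp_def)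
      then show ?thesis using False by (metis add_0 card.empty)
    qed
    have split: "card {i \<in> I. f i = v} = card {i \<in> I. (f i, g i) = (v, True)} + card {i \<in> I. (f i, g i) = (v, False)}"
      for f :: "'e + nat \<Rightarrow> 'v" and g v
      by (subst card_Un_disjoint[symmetric]) (use finI in \<open>auto intro!: arg_cong[where f=card]\<close>)
    \<comment> \<open>\<open>v\<close> has even degree in the graph together with the pairing, and
      \<open>(v, True)\<close> takes 0 or 2 of these ends, so \<open>(v, False)\<close> has even
      degree as well.\<close>
    have ev: "even (card {i \<in> I. p' i = n} + card {i \<in> I. q' i = n})" for n
    proof -
      obtain v b where n: "n = (v, b)" by fastforce
      have e1: "even (card {i \<in> I. p' i = (v, True)} + card {i \<in> I. q' i = (v, True)})" unfolding True2 by simp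
      have "even (cut_size M {v} + cut_size P {v})" using P by (auto simp: pairing_def)
      then have "even (card {i \<in> I. pp i = v} + card {i \<in> I. qq i = v})"
        unfolding card_ends_parity[OF finI] crossI .
      then have "even (card {i \<in> I. p' i = (v, False)} + card {i \<in> I. q' i = (v, False)})"
        using e1 split[of pp v "\<lambda>i. sp (pp i) i"] split[of qq v "\<lambda>i. sp (qq i) i"]
        unfolding p'_def q'_def by presburger
      with e1 show ?thesis unfolding n by (cases b) simp_all
    qed
    obtain t h where th: "\<forall>i\<in>I. t i = p' i \<and> h i = q' i \<or> t i = q' i \<and> h i = p' i"
      and bal: "\<And>n. card {i \<in> I. t i = n} = card {i \<in> I. h i = n}"
      using eulerian_orientation[OF finI ev] by blast
    let ?t = "\<lambda>i. fst (t i)" and ?h = "\<lambda>i. fst (h i)"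
    define D where "D = \<lparr>verts = nodes G, arcs = edges G, tail = (\<lambda>e. ?t (Inl e)), head = (\<lambda>e. ?h (Inl e))\<rparr>"
    have thE: "{?t (Inl e), ?h (Inl e)} = ends G e" if "e \<in> edges G" for e
    proof -
      have "Inl e \<in> I" using that by (simp add: I_def)
      then show ?thesis using th pq(1)[OF that] by (auto simp: p'_def q'_def pp_def qq_def)
    qed
    then have orD: "orientation G D" by (simp add: D_def orientation_def)
    have cr: "crosses X (pp i, qq i) \<longleftrightarrow> crosses X (?t i, ?h i)" if "i \<in> I" for X i
      using th that by (auto simp: p'_def q'_def crosses_def)
    \<comment> \<open>Graph and pairing together are balanced, so leaving minus entering edges of
      the graph is at least \<open>- cut_size P X\<close>. Hence twice the number of leaving edges
      is at least \<open>cut_size M X - cut_size P X\<close>, which is at least 4.\<close>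
    have big: "2 \<le> card {e \<in> edges G. ?t (Inl e) \<in> X \<and> ?h (Inl e) \<notin> X}" if X: "separates K X" for X
    proof -
      have "cut_size P X + 4 \<le> cut_size M X" using P X by (auto simp: pairing_def)
      moreover have "cut_size M X = card {e \<in> edges G. ?t (Inl e) \<in> X \<and> ?h (Inl e) \<notin> X} + card {e \<in> edges G. ?h (Inl e) \<in> X \<and> ?t (Inl e) \<notin> X}"
      proof -
        have "cut G X = {e \<in> edges G. ?t (Inl e) \<in> X \<and> ?h (Inl e) \<notin> X} \<union> {e \<in> edges G. ?h (Inl e) \<in> X \<and> ?t (Inl e) \<notin> X}"
          using cut_ends[OF _ thE[symmetric]] cut_subset[of G X] by auto
        then show ?thesis unfolding ddM by (simp, subst card_Un_disjoint) (use finite_edges in auto)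
      qed
      moreover have "card {j \<in> {..<length ps}. ?h (Inr j) \<in> X \<and> ?t (Inr j) \<notin> X} + card {j \<in> {..<length ps}. ?t (Inr j) \<in> X \<and> ?h (Inr j) \<notin> X} = cut_size P X"
      proof -
        have "crosses X (ps ! j) \<longleftrightarrow> crosses X (?t (Inr j), ?h (Inr j))" if "j < length ps" for j
          using cr[of "Inr j" X] that by (simp add: I_def pp_def qq_def)
        then have "{j \<in> {..<length ps}. crosses X (ps ! j)} = {j \<in> {..<length ps}. ?h (Inr j) \<in> X \<and> ?t (Inr j) \<notin> X} \<union> {j \<in> {..<length ps}. ?t (Inr j) \<in> X \<and> ?h (Inr j) \<notin> X}"
          by (auto simp: crosses_def)
        then show ?thesis unfolding ddP by (simp, subst card_Un_disjoint) auto
      qed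
      moreover have "card {i \<in> I. ?t i \<in> X \<and> ?h i \<notin> X} = card {i \<in> I. ?h i \<in> X \<and> ?t i \<notin> X}"
        using balanced_sets[OF finI bal, of "X \<times> UNIV"] by (simp add: mem_Times_iff)
      ultimately show ?thesis unfolding cardI by linarith
    qed
    let ?B = "edges G - A"
    have small: "(\<exists>b\<in>?B. ?t (Inl b) = v \<and> ?h (Inl b) \<noteq> v) \<and> (\<exists>b\<in>?B. ?h (Inl b) = v \<and> ?t (Inl b) \<noteq> v)"
      if v: "v \<in> nodes G" "v \<notin> K" for v
    proof -
      have cv: "cubic G v" by (rule cubicI[OF v])
      have "card {i \<in> I. t i = (v, True)} + card {i \<in> I. h i = (v, True)} = 2"
      proof -
        have "card {i \<in> I. t i = (v, True)} + card {i \<in> I. h i = (v, True)} = card ({i \<in> I. t i = (v, True)} \<union> {i \<in> I. h i = (v, True)}) + card ({i \<in> I. t i = (v, True)} \<inter> {i \<in> I. h i = (v, True)})"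
          by (rule card_Un_Int) (use finI in auto)
        also have "{i \<in> I. t i = (v, True)} \<union> {i \<in> I. h i = (v, True)} = {i \<in> I. p' i = (v, True)} \<union> {i \<in> I. q' i = (v, True)}"
          using th by auto
        also have "{i \<in> I. t i = (v, True)} \<inter> {i \<in> I. h i = (v, True)} = {i \<in> I. p' i = (v, True)} \<inter> {i \<in> I. q' i = (v, True)}"
          using th by auto
        also have "card ({i \<in> I. p' i = (v, True)} \<union> {i \<in> I. q' i = (v, True)}) + card ({i \<in> I. p' i = (v, True)} \<inter> {i \<in> I. q' i = (v, True)})
          = card {i \<in> I. p' i = (v, True)} + card {i \<in> I. q' i = (v, True)}"
          by (rule card_Un_Int[symmetric]) (use finI in auto)
        finally show ?thesis unfolding True2 using cv by simp
      qed
      then have "card {i \<in> I. t i = (v, True)} = 1" "card {i \<in> I. h i = (v, True)} = 1" using bal[of "(v, True)"] by linarith+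
      then obtain i j where ij: "i \<in> I" "t i = (v, True)" "j \<in> I" "h j = (v, True)" by (auto simp: card_1_singleton_iff)
      have *: "\<exists>b\<in>?B. k = Inl b \<and> b \<in> cut G {v}" if "k \<in> I" "t k = (v, True) \<or> h k = (v, True)" for k
      proof -
        have "sp v k" using th that by (auto simp: p'_def q'_def)
        then show ?thesis using S[OF cv] cut_subset by (fastforce simp: sp_def)
      qed
      obtain b where b: "b \<in> ?B" "i = Inl b" "b \<in> cut G {v}" using * ij by blast
      obtain c where c: "c \<in> ?B" "j = Inl c" "c \<in> cut G {v}" using * ij by blast
      have "?h (Inl b) \<noteq> v" "?t (Inl c) \<noteq> v"
        using cut_ends[OF _ thE[symmetric], of b "{v}"] cut_ends[OF _ thE[symmetric], of c "{v}"] b c ij by auto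
      then show ?thesis using b c ij by force
    qed
    have "strong_without D F" if F: "F = {} \<or> (\<exists>a\<in>A. F = {a})" for F
      unfolding strong_without_def
    proof (intro allI impI)
      fix X assume "X \<noteq> {} \<and> X \<subset> verts D"
      then have X: "X \<noteq> {}" "X \<subset> nodes G" by (auto simp: D_def)
      have hd: "?h (Inl e) \<in> nodes G \<and> ?t (Inl e) \<in> nodes G" if "e \<in> edges G" for e
        using thE[OF that] pq(1)[OF that] pq(2)[OF that] by (metis doubleton_eq_iff)
      consider "separates K X" | "X \<inter> K = {}" | "K \<subseteq> X" by (auto simp: separates_def)
      then have "\<exists>e\<in>edges G - F. ?t (Inl e) \<in> X \<and> ?h (Inl e) \<notin> X"
      proof cases
        case 1
        have "card F \<le> 1" using F by auto
        then have "\<not> {e \<in> edges G. ?t (Inl e) \<in> X \<and> ?h (Inl e) \<notin> X} \<subseteq> F"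
          using big[OF 1] F card_mono[of F] by (metis (no_types, lifting) One_nat_def Suc_1 Suc_n_not_le_n finite.emptyI finite.insertI le_trans)
        then show ?thesis by blast
      next
        case 2
        have or: "\<forall>e\<in>edges G. {?t (Inl e), ?h (Inl e)} = ends G e" using thE by blast
        have "\<exists>b\<in>?B. ?t (Inl b) = v \<and> ?h (Inl b) \<noteq> v" if "v \<in> X" for v
        proof -
          have "v \<in> nodes G" "v \<notin> K" using that X 2 by auto
          from small[OF this] show ?thesis by (rule conjunct1)
        qed
        from leaving_arc_exists[OF finite_nodes Diff_subset or noY X(1) psubset_imp_subset[OF X(2)] this]
        have "\<exists>b\<in>?B. ?t (Inl b) \<in> X \<and> ?h (Inl b) \<notin> X" .
        then show ?thesis using F by blast
      next
        \<comment> \<open>All nodes outside \<open>X\<close> are cubic: the previous case, for the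
          complement and with all arcs reversed.\<close>
        case 3
        have or: "\<forall>e\<in>edges G. {?h (Inl e), ?t (Inl e)} = ends G e" using thE by (simp add: insert_commute)
        have "\<exists>b\<in>?B. ?h (Inl b) = v \<and> ?t (Inl b) \<noteq> v" if "v \<in> nodes G - X" for v
        proof -
          have "v \<in> nodes G" "v \<notin> K" using that 3 by auto
          from small[OF this] show ?thesis by (rule conjunct2)
        qed
        moreover have "nodes G - X \<noteq> {}" using X by blast
        ultimately have "\<exists>b\<in>?B. ?h (Inl b) \<in> nodes G - X \<and> ?t (Inl b) \<notin> nodes G - X"
          by (intro leaving_arc_exists[OF finite_nodes Diff_subset or noY]) auto
        then show ?thesis using F hd by blast
      qed
      then show "\<exists>a\<in>arcs D - F. tail D a \<in> X \<and> head D a \<in> verts D - X"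
        using hd by (auto simp: D_def)
    qed
    then show ?thesis using orD unfolding deletable_def by blast
  qed
qed

text \<open>Edges inside \<open>Y\<close> stay as loops, which lie in no cut. So the edge set is
  unchanged and \<open>A\<close> keeps its meaning.\<close>

definition collapse :: "'v set \<Rightarrow> 'v \<Rightarrow> ('v, 'e) mgraph \<Rightarrow> ('v, 'e) mgraph" where
  "collapse Y y G = (let f = (\<lambda>v. if v \<in> Y then y else v)
     in \<lparr>nodes = f ` nodes G, edges = edges G, ends = (\<lambda>e. f ` ends G e)\<rparr>)"

lemma (in fin_mgraph) collapse:
  assumes ess: "essentially_4_edge_connected G" and A: "sparse_at_cubic G A"
    and Y: "Y \<subseteq> nodes G" "2 \<le> card Y" "y \<in> Y"
  shows "fin_mgraph (collapse Y y G)" "essentially_4_edge_connected (collapse Y y G)"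
    "sparse_at_cubic (collapse Y y G) A" "card (nodes (collapse Y y G)) < card (nodes G)"
proof -
  define f where "f = (\<lambda>v. if v \<in> Y then y else v)"
  define H where "H = collapse Y y G"
  have H: "nodes H = f ` nodes G" "edges H = edges G" "ends H e = f ` ends G e" for e
    by (auto simp: H_def collapse_def f_def Let_def)
  obtain p q where pq: "\<And>e. e \<in> edges G \<Longrightarrow> ends G e = {p e, q e}" "\<And>e. e \<in> edges G \<Longrightarrow> p e \<in> nodes G \<and> q e \<in> nodes G"
    using ends_functions by blast
  have endsH: "ends H e = {f (p e), f (q e)}" if "e \<in> edges G" for e using pq(1)[OF that] by (simp add: H)
  show fin: "fin_mgraph (collapse Y y G)"
    unfolding H_def[symmetric]
  proof
    show "finite (nodes H)" "finite (edges H)" using finite_nodes finite_edges by (auto simp: H)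
    show "\<exists>u\<in>nodes H. \<exists>v\<in>nodes H. ends H e = {u, v}" if "e \<in> edges H" for e
    proof -
      have "e \<in> edges G" using that by (simp add: H)
      then have "ends H e = {f (p e), f (q e)}" "f (p e) \<in> nodes H" "f (q e) \<in> nodes H"
        using endsH pq(2) by (auto simp: H)
      then show ?thesis by blast
    qed
  qed
  have cutH: "cut H X = cut G (f -` X)" for X
  proof -
    have "e \<in> cut H X \<longleftrightarrow> e \<in> cut G (f -` X)" if "e \<in> edges G" for e
      using cut_ends[OF _ endsH[OF that], of X] cut_ends[OF that pq(1)[OF that], of "f -` X"] that by (simp add: H)
    moreover have "cut H X \<subseteq> edges G" using cut_subset[of H X] by (simp add: H)
    ultimately show ?thesis using cut_subset[of G "f -` X"] by blast
  qed
  have pre: "f ` (f -` X \<inter> nodes G) = X" if "X \<subseteq> nodes H" for X using that by (auto simp: H)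
  have compl: "f -` (nodes H - X) \<inter> nodes G = nodes G - f -` X \<inter> nodes G" for X by (auto simp: H)
  have small: "card X = 1" if X: "X \<subseteq> nodes H" "card (f -` X \<inter> nodes G) = 1" for X
  proof -
    obtain z where "f -` X \<inter> nodes G = {z}" using X(2) by (rule card_1_singletonE)
    then have "X = {f z}" using pre[OF X(1)] by (metis image_empty image_insert)
    then show ?thesis by simp
  qed
  show "essentially_4_edge_connected (collapse Y y G)"
    unfolding H_def[symmetric] essentially_4_edge_connected_def k_edge_connected_def
  proof (intro conjI allI impI)
    fix X assume "X \<noteq> {} \<and> X \<subset> nodes H"
    then have "f -` X \<inter> nodes G \<noteq> {}" "f -` X \<inter> nodes G \<subset> nodes G" by (auto simp: H)
    then have "3 \<le> card (cut G (f -` X \<inter> nodes G))"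
      using ess by (simp add: essentially_4_edge_connected_def k_edge_connected_def)
    then show "3 \<le> card (cut H X)" by (simp add: cut_Int cutH)
  next
    fix X assume X: "X \<subseteq> nodes H" "card (cut H X) = 3"
    then have "card (cut G (f -` X \<inter> nodes G)) = 3" by (simp add: cut_Int cutH)
    then have "card (f -` X \<inter> nodes G) = 1 \<or> card (nodes G - f -` X \<inter> nodes G) = 1"
      using ess by (simp add: essentially_4_edge_connected_def)
    then show "card X = 1 \<or> card (nodes H - X) = 1"
      using small[OF X(1)] small[of "nodes H - X"] compl[of X] by auto
  qed
  show "sparse_at_cubic (collapse Y y G) A"
    unfolding H_def[symmetric] sparse_at_cubic_def
  proof (intro conjI allI impI)
    show "A \<subseteq> edges H" using A by (simp add: sparse_at_cubic_def H)
    fix v assume v: "cubic H v"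
    have "\<exists>z. cubic G z \<and> cut H {v} = cut G {z}"
    proof (cases "v = y")
      case False
      then have "f -` {v} = (if v \<in> Y then {} else {v})" using Y(3) by (auto simp: f_def split: if_splits)
      moreover have "v \<notin> Y" using v False by (auto simp: cubic_def H f_def split: if_splits)
      ultimately show ?thesis using v by (auto simp: cubic_def cutH H f_def split: if_splits)
    next
      \<comment> \<open>If the contracted vertex is cubic, then \<open>cut G Y\<close> has size 3.
        As \<open>Y\<close> has two vertices, its complement is a single node \<open>z\<close>,
        which is cubic in \<open>G\<close> and has the same cut; sparsity at \<open>z\<close>
        carries over.\<close>
      case True
      have Yf: "f -` {v} = Y" using True Y(3) by (auto simp: f_def split: if_splits)
      then have c: "card (cut G Y) = 3" using v by (simp add: cubic_def cutH)
      then have "card Y = 1 \<or> card (nodes G - Y) = 1" using ess Y(1) by (simp add: essentially_4_edge_connected_def)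
      then have "card (nodes G - Y) = 1" using Y(2) by simp
      then obtain z where z: "nodes G - Y = {z}" by (rule card_1_singletonE)
      then have "cut G {z} = cut G Y" using cut_compl[of Y] by simp
      then show ?thesis using c z Yf by (auto simp: cubic_def cutH)
    qed
    then show "card (A \<inter> cut H {v}) \<le> 1" using A by (auto simp: sparse_at_cubic_def)
  qed
  have finY: "finite Y" using Y(1) finite_nodes by (rule finite_subset)
  have "nodes H \<subseteq> insert y (nodes G - Y)" by (auto simp: H f_def)
  then have "card (nodes H) \<le> card (insert y (nodes G - Y))" using finite_nodes by (intro card_mono) auto
  also have "\<dots> \<le> Suc (card (nodes G - Y))" by (rule card_insert_le_m1) auto
  also have "card (nodes G - Y) = card (nodes G) - card Y" using finY Y(1) by (rule card_Diff_subset)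
  also have "Suc (card (nodes G) - card Y) < card (nodes G)"
    using Y(2) card_mono[OF finite_nodes Y(1)] by linarith
  finally show "card (nodes (collapse Y y G)) < card (nodes G)" unfolding H_def .
qed

text \<open>Arcs outside \<open>A\<close> that make a part \<open>Y\<close> strong survive every
  deletion under consideration, so a set that splits \<open>Y\<close> is left by one of them. Any
  other set corresponds to a set of the contracted graph, where induction applies. Without a strong
  part, \<open>deletable_base\<close> gives the orientation.\<close>

theorem deletable_set:
  assumes "fin_mgraph G" "essentially_4_edge_connected G" "sparse_at_cubic G A"
  shows "\<exists>D. deletable G D A"
  using assms unfolding deletable_def
proof (induction "card (nodes G)" arbitrary: G rule: less_induct)
  case less
  interpret fin_mgraph G by (rule less.prems)
  show ?case
  proof (cases "\<exists>Y t h. strong_part G (edges G - A) Y t h")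
    case False
    then show ?thesis using deletable_base less.prems(2,3) unfolding deletable_def by blast
  next
    case True
    then obtain Y t h where sp: "strong_part G (edges G - A) Y t h" by blast
    have Y: "Y \<subseteq> nodes G" "2 \<le> card Y" and or: "\<And>e. e \<in> edges G \<Longrightarrow> {t e, h e} = ends G e"
      using sp by (simp_all add: strong_part_def)
    have strY: "\<exists>b\<in>edges G - A. t b \<in> Z \<and> h b \<in> Y - Z" if "Z \<noteq> {}" "Z \<subset> Y" for Z
      using sp that unfolding strong_part_def by metis
    obtain y where y: "y \<in> Y" using Y(2) by fastforce
    define f where "f = (\<lambda>v. if v \<in> Y then y else v)"
    define H where "H = collapse Y y G"
    have H: "nodes H = f ` nodes G" "edges H = edges G" "ends H e = f ` ends G e" for e
      by (auto simp: H_def collapse_def f_def Let_def)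
    obtain D' where D': "orientation H D'" "\<And>F. F = {} \<or> (\<exists>a\<in>A. F = {a}) \<Longrightarrow> strong_without D' F"
      using less.hyps[of H] collapse[OF less.prems(2,3) Y y] unfolding H_def by blast
    have "\<exists>u v. {u, v} = ends G e \<and> (t e \<in> Y \<and> h e \<in> Y \<longrightarrow> u = t e \<and> v = h e) \<and>
        (\<not> (t e \<in> Y \<and> h e \<in> Y) \<longrightarrow> f u = tail D' e \<and> f v = head D' e)" if e: "e \<in> edges G" for e
    proof (cases "t e \<in> Y \<and> h e \<in> Y")
      case True then show ?thesis using or[OF e] by auto
    next
      case False
      have "{tail D' e, head D' e} = {f (t e), f (h e)}"
        using D'(1) e or[OF e, symmetric] by (simp add: orientation_def H)
      then have "(f (t e) = tail D' e \<and> f (h e) = head D' e) \<or> (f (h e) = tail D' e \<and> f (t e) = head D' e)"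
        by (auto simp: doubleton_eq_iff)
      moreover have "{h e, t e} = ends G e" using or[OF e] by (simp add: insert_commute)
      ultimately show ?thesis using False or[OF e] by blast
    qed
    then obtain t' h' where th: "\<And>e. e \<in> edges G \<Longrightarrow> {t' e, h' e} = ends G e"
      "\<And>e. e \<in> edges G \<Longrightarrow> t e \<in> Y \<Longrightarrow> h e \<in> Y \<Longrightarrow> t' e = t e \<and> h' e = h e"
      "\<And>e. e \<in> edges G \<Longrightarrow> \<not> (t e \<in> Y \<and> h e \<in> Y) \<Longrightarrow> f (t' e) = tail D' e \<and> f (h' e) = head D' e"
      by metis
    define D where "D = \<lparr>verts = nodes G, arcs = edges G, tail = t', head = h'\<rparr>"
    have orD: "orientation G D" using th(1) by (simp add: D_def orientation_def)
    have nodesE: "t' e \<in> nodes G \<and> h' e \<in> nodes G" if "e \<in> edges G" for e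
      using th(1)[OF that] ends_in_nodes[OF that] by (metis doubleton_eq_iff)
    have "strong_without D F" if F: "F = {} \<or> (\<exists>a\<in>A. F = {a})" for F
      unfolding strong_without_def
    proof (intro allI impI)
      fix X assume "X \<noteq> {} \<and> X \<subset> verts D"
      then have X: "X \<noteq> {}" "X \<subset> nodes G" by (auto simp: D_def)
      have "\<exists>e\<in>edges G - F. t' e \<in> X \<and> h' e \<notin> X"
      proof (cases "Y \<inter> X \<noteq> {} \<and> Y - X \<noteq> {}")
        case True
        then obtain b where b: "b \<in> edges G - A" "t b \<in> Y \<inter> X" "h b \<in> Y - Y \<inter> X"
          using strY[of "Y \<inter> X"] by blast
        then have "t' b = t b" "h' b = h b" using th(2)[of b] by simp_all
        then have "t' b \<in> X" "h' b \<notin> X" "b \<in> edges G - F" using b F by auto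
        then show ?thesis by blast
      next
        case False
        have fX: "f v \<in> f ` X \<longleftrightarrow> v \<in> X" if "v \<in> nodes G" for v
          using False y by (auto simp: f_def image_iff)
        have "f ` X \<noteq> {} \<and> f ` X \<subset> verts D'"
        proof -
          have "verts D' = f ` nodes G" using D'(1) by (simp add: orientation_def H)
          moreover obtain w where w: "w \<in> nodes G" "w \<notin> X" using X by blast
          then have "f w \<notin> f ` X" using fX by blast
          ultimately show ?thesis using X w by blast
        qed
        then have "\<exists>a\<in>arcs D' - F. tail D' a \<in> f ` X \<and> head D' a \<in> verts D' - f ` X"
          using D'(2)[OF F, unfolded strong_without_def, rule_format, of "f ` X"] by simp
        then obtain a where a: "a \<in> arcs D' - F" "tail D' a \<in> f ` X" "head D' a \<in> verts D' - f ` X" by (elim bexE conjE)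
        then have aE: "a \<in> edges G" using D'(1) by (simp add: orientation_def H)
        \<comment> \<open>An edge with both ends in \<open>Y\<close> is a loop of \<open>H\<close>
          and leaves no set, so \<open>a\<close> has the direction inherited from
          \<open>D'\<close>.\<close>
        have "\<not> (t a \<in> Y \<and> h a \<in> Y)"
        proof
          assume "t a \<in> Y \<and> h a \<in> Y"
          then have "ends H a = {y}" using or[OF aE, symmetric] by (simp add: H f_def)
          then have "tail D' a = y" "head D' a = y" using D'(1) aE by (auto simp: orientation_def H)
          then show False using a by simp
        qed
        then have "f (t' a) = tail D' a" "f (h' a) = head D' a" using th(3)[OF aE] by auto
        then have "t' a \<in> X" "h' a \<notin> X"
          using a(2,3) fX[of "t' a"] fX[of "h' a"] nodesE[OF aE] by simp_all
        then show ?thesis using a aE by blast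
      qed
      then show "\<exists>a\<in>arcs D - F. tail D a \<in> X \<and> head D a \<in> verts D - X"
        using nodesE by (auto simp: D_def)
    qed
    then show ?thesis using orD by blast
  qed
qed

subsection \<open>Perfect matchings\<close>

text \<open>A matching is represented by a fixed-point-free involution, so that matchings of
  disjoint sets combine by a case distinction on the vertex.\<close>

definition perfect_matching :: "('a \<times> 'a) set \<Rightarrow> 'a set \<Rightarrow> ('a \<Rightarrow> 'a) \<Rightarrow> bool" where
  "perfect_matching R V m \<longleftrightarrow> (\<forall>v\<in>V. m v \<in> V \<and> m v \<noteq> v \<and> (v, m v) \<in> R \<and> m (m v) = v)"

lemma perfect_matching_Un:
  assumes "perfect_matching R V m" "perfect_matching R W n" "V \<inter> W = {}"
  shows "perfect_matching R (V \<union> W) (\<lambda>v. if v \<in> V then m v else n v)"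
  using assms by (auto simp: perfect_matching_def)

lemma perfect_matching_Union:
  assumes "finite \<F>" "pairwise disjnt \<F>" "\<And>V. V \<in> \<F> \<Longrightarrow> \<exists>m. perfect_matching R V m"
  shows "\<exists>m. perfect_matching R (\<Union>\<F>) m"
  using assms
proof (induction \<F>)
  case empty then show ?case by (auto simp: perfect_matching_def)
next
  case (insert V \<F>)
  then have "\<exists>m. perfect_matching R V m" "\<exists>n. perfect_matching R (\<Union>\<F>) n"
    by (simp_all add: pairwise_insert)
  then obtain m n where "perfect_matching R V m" "perfect_matching R (\<Union>\<F>) n" by blast
  moreover have "V \<inter> F = {}" if "F \<in> \<F>" for F
  proof -
    have "F \<noteq> V" using that insert.hyps(2) by blast
    then show ?thesis using insert.prems(1) that by (simp add: pairwise_insert disjnt_def)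
  qed
  then have "V \<inter> \<Union>\<F> = {}" by blast
  ultimately have "perfect_matching R (V \<union> \<Union>\<F>) (\<lambda>v. if v \<in> V then m v else n v)"
    by (rule perfect_matching_Un)
  then show ?case by auto
qed

lemma perfect_matching_clique:
  assumes "finite V" "even (card V)" "\<And>x y. x \<in> V \<Longrightarrow> y \<in> V \<Longrightarrow> x \<noteq> y \<Longrightarrow> (x, y) \<in> R"
  shows "\<exists>m. perfect_matching R V m"
  using assms
proof (induction "card V" arbitrary: V rule: less_induct)
  case less
  show ?case
  proof (cases "V = {}")
    case True then show ?thesis by (auto simp: perfect_matching_def)
  next
    case False
    then obtain x where x: "x \<in> V" by blast
    have "card V \<noteq> 1" using less.prems(2) by auto
    then obtain y where y: "y \<in> V" "y \<noteq> x" using x by (metis is_singletonI' is_singleton_altdef empty_iff)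
    let ?W = "V - {x, y}"
    have sub: "{x, y} \<subseteq> V" using x y by blast
    have c: "card V = card ?W + 2" using card_Diff_subset[OF _ sub] card_mono[OF less.prems(1) sub] y(2) by simp
    then obtain m where "perfect_matching R ?W m" using less.hyps[of ?W] less.prems by auto
    moreover have "perfect_matching R {x, y} (\<lambda>v. if v = x then y else x)"
      using less.prems(3) x y by (auto simp: perfect_matching_def)
    ultimately have "\<exists>m. perfect_matching R ({x, y} \<union> ?W) m" using perfect_matching_Un by fastforce
    moreover have "{x, y} \<union> ?W = V" using x y by blast
    ultimately show ?thesis by simp
  qed
qed

text \<open>On the path \<open>w\<close>, \<open>m1 w\<close>, \<open>m2 (m1 w)\<close>, ... no even
  position coincides with an odd one at or after it: a coincidence of \<open>a i\<close> and
  \<open>m1 (a (i + k))\<close> can be pulled inwards by one step at each end until \<open>k\<close>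
  is 0 or 1, where it is a fixed point of \<open>m1\<close> or \<open>m2\<close>. In a finite
  \<open>V\<close> the sequence repeats, by injectivity it returns to \<open>w\<close>, and the
  vertex before that return is \<open>m2 w\<close>.\<close>

lemma alternating_distinct:
  fixes m1 m2 :: "'a \<Rightarrow> 'a" and w :: 'a
  defines "a \<equiv> \<lambda>n. ((m2 \<circ> m1) ^^ n) w"
  assumes w: "w \<in> V"
    and m1: "\<And>v. v \<in> V \<Longrightarrow> m1 v \<in> V \<and> m1 v \<noteq> v \<and> m1 (m1 v) = v"
    and m2: "\<And>v. v \<in> V \<Longrightarrow> m2 v \<in> V \<and> m2 v \<noteq> v \<and> m2 (m2 v) = v"
  shows "a i \<in> V" "a i \<noteq> m1 (a (i + k))" "finite V \<Longrightarrow> \<exists>n. m1 (a n) = m2 w"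
proof -
  have Suc: "a (Suc n) = m2 (m1 (a n))" for n by (simp add: a_def)
  have aV: "a n \<in> V" for n
  proof (induction n)
    case 0 then show ?case using w by (simp add: a_def)
  next
    case (Suc n) then show ?case using m1 m2 Suc by (simp add: a_def)
  qed
  then show "a i \<in> V" .
  show "a i \<noteq> m1 (a (i + k))"
  proof (induction k arbitrary: i rule: less_induct)
    case (less k)
    show ?case
    proof
      assume eq: "a i = m1 (a (i + k))"
      then have eq': "m1 (a i) = a (i + k)" using m1 aV by metis
      consider "k = 0" | "k = 1" | l where "k = l + 2" by (metis add_2_eq_Suc' not0_implies_Suc One_nat_def)
      then show False
      proof cases
        case 1 then show False using eq m1[OF aV[of i]] by auto
      next
        case 2
        then have "m1 (a i) = m2 (m1 (a i))" using eq' Suc[of i] by simp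
        then show False using m2 m1 aV by metis
      next
        case 3
        have "a (i + k) = m2 (m1 (a (i + l + 1)))" using Suc[of "i + l + 1"] 3 by (simp add: add.assoc)
        then have "m2 (a (i + k)) = m1 (a (i + l + 1))" using m1 m2 aV by metis
        then have "a (Suc i) = m1 (a (Suc i + l))" using eq' Suc[of i] by simp
        then show False using less.IH[of l "Suc i"] 3 by simp
      qed
    qed
  qed
  assume fin: "finite V"
  have "range a \<subseteq> V" using aV by blast
  then have "finite (range a)" using fin by (rule finite_subset)
  then have "\<not> inj a" using finite_imageD by blast
  then obtain i j where ij: "i < j" "a i = a j" by (metis inj_on_def linorder_neqE_nat)
  have "a 0 = a (j - i)" using ij
  proof (induction i arbitrary: j)
    case (Suc i)
    then obtain j' where j: "j = Suc j'" by (metis Suc_lessE)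
    have "m1 (a i) = m1 (a j')" using Suc.prems(2) \<open>\<And>n. a (Suc n) = m2 (m1 (a n))\<close> m1 m2 aV unfolding j by metis
    then have "a i = a j'" using m1 aV by metis
    then show ?case using Suc.IH[of j'] Suc.prems(1) j by simp
  qed simp
  moreover obtain n where "j - i = Suc n" using ij(1) by (metis Suc_diff_Suc)
  ultimately have "w = m2 (m1 (a n))" using Suc[of n] by (simp add: a_def)
  then have "m1 (a n) = m2 w" using m1 m2 aV by metis
  then show "\<exists>n. m1 (a n) = m2 w" by blast
qed

text \<open>
  The exchange step of Lovasz' proof: the path that alternates between \<open>m1\<close> and \<open>m2\<close> from \<open>w\<close> reaches \<open>y\<close>;
  its first visit to \<open>{x, y, z}\<close> yields a perfect matching that avoids both added edges.
\<close>

lemma maximal_nonmatching_trans: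
  assumes fin: "finite V" and sym: "sym R" and no: "\<And>m. \<not> perfect_matching R V m"
    and max: "\<And>a b. a \<in> V \<Longrightarrow> b \<in> V \<Longrightarrow> (a, b) \<notin> R \<Longrightarrow> \<exists>m. perfect_matching (insert (a, b) (insert (b, a) R)) V m"
    and V: "x \<in> V" "y \<in> V" "z \<in> V" and xyz: "(x, y) \<in> R" "(y, z) \<in> R" "x \<noteq> y" "y \<noteq> z" "x \<noteq> z"
    and w: "w \<in> V" "w \<noteq> y" "(y, w) \<notin> R"
  shows "(x, z) \<in> R"
proof (rule ccontr)
  assume xz: "(x, z) \<notin> R"
  obtain m1 where pm1: "perfect_matching (insert (x, z) (insert (z, x) R)) V m1" using max[OF V(1,3) xz] by blast
  obtain m2 where pm2: "perfect_matching (insert (y, w) (insert (w, y) R)) V m2" using max[OF V(2) w(1,3)] by blast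
  have m1: "m1 v \<in> V \<and> m1 v \<noteq> v \<and> m1 (m1 v) = v" if "v \<in> V" for v using pm1 that by (simp add: perfect_matching_def)
  have m2: "m2 v \<in> V \<and> m2 v \<noteq> v \<and> m2 (m2 v) = v" if "v \<in> V" for v using pm2 that by (simp add: perfect_matching_def)
  have m1R: "(v, m1 v) \<in> R" if "v \<in> V" "v \<noteq> x" "v \<noteq> z" for v using pm1 that by (auto simp: perfect_matching_def)
  have m2R: "(v, m2 v) \<in> R" if "v \<in> V" "v \<noteq> y" "v \<noteq> w" for v using pm2 that by (auto simp: perfect_matching_def)
  have yx: "(y, x) \<in> R" "(z, y) \<in> R" using sym xyz by (auto simp: sym_def)
  have m1x: "m1 x = z"
  proof (rule ccontr)
    assume "m1 x \<noteq> z"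
    then have "m1 z \<noteq> x" using m1[OF V(3)] by auto
    then have "perfect_matching R V m1" using pm1 \<open>m1 x \<noteq> z\<close> by (auto simp: perfect_matching_def)
    then show False using no by blast
  qed
  have m2y: "m2 y = w"
  proof (rule ccontr)
    assume "m2 y \<noteq> w"
    then have "m2 w \<noteq> y" using m2[OF w(1)] by auto
    then have "perfect_matching R V m2" using pm2 \<open>m2 y \<noteq> w\<close> by (auto simp: perfect_matching_def)
    then show False using no by blast
  qed
  have wxz: "w \<noteq> x" "w \<noteq> z" using w xyz yx by auto
  define a where "a n = ((m2 \<circ> m1) ^^ n) w" for n
  define b where "b n = m1 (a n)" for n
  have a0: "a 0 = w" by (simp add: a_def)
  have aS: "a (Suc n) = m2 (b n)" for n by (simp add: a_def b_def)
  note alt = alternating_distinct[where ?m1.0=m1 and ?m2.0=m2, OF w(1) m1 m2, folded a_def, folded b_def]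
  have aV: "a n \<in> V" and bV: "b n \<in> V" for n using alt(1) m1 by (auto simp: b_def)
  have bw: "b n \<noteq> w" for n using alt(2)[of 0 n] a0 by auto
  have m2w: "m2 w = y" using m2y m2[OF V(2)] by simp
  have "\<exists>n. b n = y" using alt(3) fin m2w by simp
  then have ex: "\<exists>n. a n \<in> {x, z} \<or> b n \<in> {x, y, z}" by blast
  define n where "n = (LEAST n. a n \<in> {x, z} \<or> b n \<in> {x, y, z})"
  have n: "a n \<in> {x, z} \<or> b n \<in> {x, y, z}" unfolding n_def using ex by (rule LeastI_ex)
  have before: "a i \<notin> {x, z} \<and> b i \<notin> {x, y, z}" if "i < n" for i
    using not_less_Least[of i] that unfolding n_def by blast
  have ay: "a i \<noteq> y" for i
  proof (cases i)
    case 0 then show ?thesis using a0 w by simp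
  next
    case (Suc j)
    show ?thesis
    proof
      assume "a i = y"
      then have "m2 (b j) = y" using aS Suc by simp
      then have "b j = w" using m2 bV m2y by metis
      then show False using bw by blast
    qed
  qed
  have m1a: "m1 (a i) = b i" "m1 (b i) = a i" for i using m1 aV by (auto simp: b_def)
  have m2b: "m2 (b i) = a (Suc i)" "m2 (a (Suc i)) = b i" for i using m2 bV by (auto simp: aS)
  define W where "W = a ` {..<n} \<union> b ` {..<n}"
  have WV: "W \<subseteq> V" using aV bV by (auto simp: W_def)
  have W1: "m1 v \<in> W" if "v \<in> W" for v using that m1a by (auto simp: W_def)
  have Wn: "x \<notin> W" "y \<notin> W" "z \<notin> W" using before ay by (auto simp: W_def)
  show False
  proof (cases "a n \<in> {x, z}")
    case True
    define p where "p = a n"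
    have p: "p \<in> {x, z}" "p \<in> V" "p \<noteq> y" "(p, y) \<in> R" "(y, p) \<in> R" "p \<notin> W" "y \<notin> W"
      using True xyz yx aV Wn by (auto simp: p_def)
    \<comment> \<open>The new matching joins \<open>p\<close> to \<open>y\<close> and uses
      \<open>m1\<close> on the path before \<open>p\<close> and \<open>m2\<close> elsewhere. This
      fits together because \<open>m2\<close> pairs up \<open>?Z\<close> within itself:
      \<open>y\<close> with \<open>w\<close>, and each \<open>b i\<close> before \<open>p\<close>
      with the next \<open>a\<close>.\<close>
    let ?Z = "insert y (insert p W)"
    have inZ: "a i \<in> ?Z" if "i \<le> n" for i using that by (cases "i = n") (auto simp: W_def p_def)
    have bZ: "b i \<in> ?Z" if "i < n" for i using that by (auto simp: W_def)
    have Z2: "m2 v \<in> ?Z" if v: "v \<in> ?Z" for v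
    proof -
      have am: "m2 (a i) \<in> ?Z" if "i \<le> n" for i
      proof (cases i)
        case 0 then show ?thesis using a0 m2w by simp
      next
        case (Suc j) then show ?thesis using m2b(2)[of j] bZ[of j] that by simp
      qed
      have bm: "m2 (b i) \<in> ?Z" if "i < n" for i using m2b(1)[of i] inZ[of "Suc i"] that by simp
      have "m2 y \<in> ?Z" using m2y inZ[of 0] a0 by simp
      from v consider "v = y" | i where "v = a i" "i \<le> n" | i where "v = b i" "i < n"
        by (auto simp: W_def p_def)
      then show ?thesis using \<open>m2 y \<in> ?Z\<close> am bm by cases blast+
    qed
    have wZ: "w \<in> ?Z" using inZ[of 0] a0 by simp
    let ?m = "\<lambda>v. if v \<in> W then m1 v else if v = p then y else if v = y then p else m2 v"
    have "perfect_matching R V ?m"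
      unfolding perfect_matching_def
    proof
      fix v assume v: "v \<in> V"
      consider "v \<in> W" | "v = p" | "v = y" | "v \<notin> ?Z" by blast
      then show "?m v \<in> V \<and> ?m v \<noteq> v \<and> (v, ?m v) \<in> R \<and> ?m (?m v) = v"
      proof cases
        case 1 then show ?thesis using W1 m1[OF v] m1R[OF v] Wn by auto
      next
        case 2 then show ?thesis using p V by auto
      next
        case 3 then show ?thesis using p V by auto
      next
        case 4
        have "m2 v \<notin> ?Z" using Z2[of "m2 v"] m2[OF v] 4 by auto
        then show ?thesis using 4 m2[OF v] m2R[OF v] wZ by auto
      qed
    qed
    then show False using no by blast
  next
    case False
    have "b n = y"
    proof (rule ccontr)
      assume "b n \<noteq> y"
      then have "b n \<in> {x, z}" using n False by blast
      moreover have "m1 z = x" using m1x m1[OF V(1)] by simp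
      ultimately have "m1 (b n) \<in> {x, z}" using m1x by auto
      then show False using False m1a by simp
    qed
    \<comment> \<open>The path from \<open>w\<close> to \<open>y\<close> closes up by the
      \<open>m2\<close>-edge \<open>yw\<close> to a cycle that both matchings pair up within itself
      and that misses \<open>x\<close> and \<open>z\<close>. With \<open>m1\<close> on it and
      \<open>m2\<close> elsewhere, both added edges are avoided.\<close>
    let ?Z = "a ` {..n} \<union> b ` {..n}"
    have Z1: "m1 v \<in> ?Z" if "v \<in> ?Z" for v using that m1a by auto
    have Z2: "m2 v \<in> ?Z" if v: "v \<in> ?Z" for v
    proof -
      have am: "m2 (a i) \<in> ?Z" if "i \<le> n" for i
      proof (cases i)
        case 0
          have "b n \<in> ?Z" by simp
          then show ?thesis using 0 a0 m2w \<open>b n = y\<close> by simp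
      next
        case (Suc j) then show ?thesis using m2b(2)[of j] that by auto
      qed
      have bm: "m2 (b i) \<in> ?Z" if "i \<le> n" for i
      proof (cases "i = n")
        case True then show ?thesis using m2y \<open>b n = y\<close> a0 by force
      next
        case False then show ?thesis using m2b(1)[of i] that by auto
      qed
      show ?thesis using v am bm by auto
    qed
    have "a i \<notin> {x, z} \<and> b i \<notin> {x, z}" if "i \<le> n" for i
      using before[of i] False \<open>b n = y\<close> xyz that by (cases "i = n") auto
    then have xz: "x \<notin> ?Z" "z \<notin> ?Z" by blast+
    have wy: "w \<in> ?Z" "y \<in> ?Z" using a0 \<open>b n = y\<close> by force+
    let ?m = "\<lambda>v. if v \<in> ?Z then m1 v else m2 v"
    have "perfect_matching R V ?m"
      unfolding perfect_matching_def
    proof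
      fix v assume v: "v \<in> V"
      show "?m v \<in> V \<and> ?m v \<noteq> v \<and> (v, ?m v) \<in> R \<and> ?m (?m v) = v"
      proof (cases "v \<in> ?Z")
        case True
        then have "v \<noteq> x" "v \<noteq> z" using xz by auto
        then show ?thesis using True Z1[OF True] m1[OF v] m1R[OF v] by auto
      next
        case False
        then have ne: "v \<noteq> y" "v \<noteq> w" using wy by auto
        have "m2 v \<notin> ?Z" using Z2[of "m2 v"] m2[OF v] False by metis
        then show ?thesis using False m2[OF v] m2R[OF v ne] by simp
      qed
    qed
    then show False using no by blast
  qed
qed

text \<open>In a maximal relation \<open>Q\<close> without a perfect matching, let \<open>S\<close>
  be the vertices adjacent to all others. By \<open>maximal_nonmatching_trans\<close> the rest falls
  into cliques, and the odd ones form \<open>\<K>\<close>. With respect to \<open>R\<close> they are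
  merely closed within \<open>V - S\<close>, which suffices for counting. The parity clause turns
  \<open>card S < card \<K>\<close> into a difference of at least 2.\<close>

theorem tutte:
  assumes fin: "finite V" and ev: "even (card V)" and sym: "sym R" and no: "\<And>m. \<not> perfect_matching R V m"
  obtains S \<K> where "S \<subseteq> V" "finite \<K>" "pairwise disjnt \<K>" "card S < card \<K>" "even (card S + card \<K>)"
    "\<And>K. K \<in> \<K> \<Longrightarrow> K \<subseteq> V - S \<and> odd (card K)"
    "\<And>K x y. K \<in> \<K> \<Longrightarrow> x \<in> K \<Longrightarrow> y \<in> V \<Longrightarrow> (x, y) \<in> R \<Longrightarrow> y \<in> K \<union> S"
proof -
  define \<R> where "\<R> = {Q. R \<inter> V \<times> V \<subseteq> Q \<and> Q \<subseteq> V \<times> V \<and> sym Q \<and> (\<forall>m. \<not> perfect_matching Q V m)}"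
  have "finite \<R>" using fin by (auto simp: \<R>_def)
  moreover have "R \<inter> V \<times> V \<in> \<R>"
  proof -
    have "\<not> perfect_matching (R \<inter> V \<times> V) V m" for m using no[of m] by (auto simp: perfect_matching_def)
    then show ?thesis using sym by (auto simp: \<R>_def sym_def)
  qed
  ultimately obtain Q where Q: "Q \<in> \<R>" and Qmax: "\<And>Q'. Q' \<in> \<R> \<Longrightarrow> Q \<subseteq> Q' \<Longrightarrow> Q = Q'"
    using finite_has_maximal[of \<R>] by (metis empty_iff)
  have symQ: "sym Q" and noQ: "\<And>m. \<not> perfect_matching Q V m" and RQ: "R \<inter> V \<times> V \<subseteq> Q"
    using Q by (auto simp: \<R>_def)
  have max: "\<exists>m. perfect_matching (insert (a, b) (insert (b, a) Q)) V m" if ab: "a \<in> V" "b \<in> V" "(a, b) \<notin> Q" for a b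
  proof (rule ccontr)
    assume "\<not> ?thesis"
    moreover have "sym (insert (a, b) (insert (b, a) Q))" using symQ by (auto simp: sym_def)
    ultimately have "insert (a, b) (insert (b, a) Q) \<in> \<R>" using Q ab by (auto simp: \<R>_def)
    then show False using Qmax[of "insert (a, b) (insert (b, a) Q)"] ab by blast
  qed
  define S where "S = {v \<in> V. \<forall>w\<in>V. w \<noteq> v \<longrightarrow> (v, w) \<in> Q}"
  have SV: "S \<subseteq> V" by (auto simp: S_def)
  define E where "E = {(x, y). x \<in> V - S \<and> y \<in> V - S \<and> (x = y \<or> (x, y) \<in> Q)}"
  have "trans E"
  proof (rule transI)
    fix x y z assume xy: "(x, y) \<in> E" and yz: "(y, z) \<in> E"
    have V: "x \<in> V - S" "y \<in> V - S" "z \<in> V - S" using xy yz by (auto simp: E_def)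
    then obtain w where w: "w \<in> V" "w \<noteq> y" "(y, w) \<notin> Q" by (auto simp: S_def)
    show "(x, z) \<in> E"
    proof (cases "x = y \<or> y = z \<or> x = z")
      case True then show ?thesis using xy yz by (auto simp: E_def)
    next
      case False
      then have "(x, z) \<in> Q"
        using maximal_nonmatching_trans[OF fin symQ noQ max, of x y z w] V w xy yz by (auto simp: E_def)
      then show ?thesis using V by (simp add: E_def)
    qed
  qed
  moreover have "sym E" using symQ by (auto simp: E_def sym_def)
  moreover have "refl_on (V - S) E" "E \<subseteq> (V - S) \<times> (V - S)" by (auto simp: E_def refl_on_def)
  ultimately have equiv: "equiv (V - S) E" by (simp add: equiv_def)
  define \<C> where "\<C> = (V - S) // E"
  have C_Un: "\<Union>\<C> = V - S" using Union_quotient[OF equiv] by (simp add: \<C>_def)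
  have C_disj: "K \<inter> L = {}" if "K \<in> \<C>" "L \<in> \<C>" "K \<noteq> L" for K L
    using quotient_disj[OF equiv] that by (auto simp: \<C>_def)
  have C_fin: "finite \<C>" unfolding \<C>_def using fin equiv by (intro finite_quotient) (auto simp: E_def)
  have C_sub: "K \<subseteq> V - S" if "K \<in> \<C>" for K using that C_Un by blast
  have C_clique: "(x, y) \<in> Q" if "K \<in> \<C>" "x \<in> K" "y \<in> K" "x \<noteq> y" for K x y
    using quotient_eq_iff[OF equiv, of K K x y] that by (auto simp: \<C>_def E_def)
  have C_closed: "y \<in> K \<union> S" if "K \<in> \<C>" "x \<in> K" "y \<in> V" "(x, y) \<in> R" for K x y
  proof (rule ccontr)
    assume y: "y \<notin> K \<union> S"
    have "x \<in> V - S" using C_sub[OF that(1)] that(2) by blast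
    then have "(x, y) \<in> E" using that y RQ by (auto simp: E_def)
    then have "y \<in> K" using that equiv by (auto simp: \<C>_def intro: in_quotient_imp_closed)
    then show False using y by simp
  qed
  define \<K> where "\<K> = {K \<in> \<C>. odd (card K)}"
  have finK: "finite \<K>" using C_fin by (simp add: \<K>_def)
  have "card S < card \<K>"
  proof (rule ccontr)
    assume "\<not> ?thesis"
    then have "card \<K> \<le> card S" by simp
    then obtain f where f: "f ` \<K> \<subseteq> S" "inj_on f \<K>"
      using card_le_inj[OF finK finite_subset[OF SV fin]] by blast
    \<comment> \<open>Each odd clique is completed to an even one by a vertex of \<open>S\<close> of
      its own. The vertices then left over all lie in \<open>S\<close> and form an even clique,
      too.\<close>
    define g where "g K = (if odd (card K) then insert (f K) K else K)" for K
    have finK: "finite K" if "K \<in> \<C>" for K using C_sub[OF that] fin by (meson finite_Diff finite_subset)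
    have gK: "K \<subseteq> g K" "g K \<subseteq> V" "even (card (g K))" if "K \<in> \<C>" for K
    proof -
      have "f K \<in> S" if "odd (card K)" using that \<open>K \<in> \<C>\<close> f by (auto simp: \<K>_def)
      then show "K \<subseteq> g K" "g K \<subseteq> V" "even (card (g K))"
        using C_sub[OF that] SV finK[OF that] by (auto simp: g_def card_insert_if)
    qed
    have S_clique: "(x, y) \<in> Q" "(y, x) \<in> Q" if "x \<in> S" "y \<in> V" "x \<noteq> y" for x y
    proof -
      show "(x, y) \<in> Q" using that by (auto simp: S_def)
      then show "(y, x) \<in> Q" using symQ by (auto simp: sym_def)
    qed
    have gdisj: "disjnt (g K) (g L)" if KL: "K \<in> \<C>" "L \<in> \<C>" "K \<noteq> L" for K L
    proof -
      have "f K \<noteq> f L" if "odd (card K)" "odd (card L)" using that KL f by (auto simp: \<K>_def inj_on_def)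
      moreover have "f K \<in> S" if "odd (card K)" using that KL f by (auto simp: \<K>_def)
      moreover have "f L \<in> S" if "odd (card L)" using that KL f by (auto simp: \<K>_def)
      ultimately show ?thesis using C_disj[OF KL] C_sub[OF KL(1)] C_sub[OF KL(2)]
        unfolding g_def disjnt_def by auto
    qed
    have pw: "pairwise disjnt (g ` \<C>)" using gdisj by (auto simp: pairwise_def)
    have "\<exists>m. perfect_matching Q F m" if "F \<in> g ` \<C>" for F
    proof -
      from that obtain K where K: "K \<in> \<C>" "F = g K" by blast
      have "f K \<in> S" if "odd (card K)" using that K f by (auto simp: \<K>_def)
      then have "(x, y) \<in> Q" if "x \<in> g K" "y \<in> g K" "x \<noteq> y" for x y
        using that C_clique[OF K(1), of x y] S_clique[of "f K"] gK(2)[OF K(1)] unfolding g_def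
        by (auto split: if_splits)
      then show ?thesis unfolding K(2) using gK(2,3)[OF K(1)] fin by (intro perfect_matching_clique) (auto intro: finite_subset)
    qed
    then obtain m where m: "perfect_matching Q (\<Union>(g ` \<C>)) m"
      using perfect_matching_Union[OF _ pw] C_fin by blast
    have "card (\<Union>(g ` \<C>)) = sum card (g ` \<C>)"
      using pw gK(2) fin by (intro card_Union_disjoint) (auto intro: finite_subset)
    moreover have "even (sum card (g ` \<C>))" using gK(3) by (intro dvd_sum) auto
    ultimately have even1: "even (card (\<Union>(g ` \<C>)))" by simp
    have sub: "\<Union>(g ` \<C>) \<subseteq> V" using gK(2) by blast
    let ?W = "V - \<Union>(g ` \<C>)"
    have "card V = card (\<Union>(g ` \<C>)) + card ?W"
      using card_Diff_subset[OF finite_subset[OF sub fin] sub] card_mono[OF fin sub] by linarith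
    then have "even (card ?W)" using ev even1 by simp
    moreover have "?W \<subseteq> S" using C_Un gK(1) by blast
    ultimately obtain n where "perfect_matching Q ?W n"
      using perfect_matching_clique[of ?W Q] fin S_clique by (metis DiffD1 finite_Diff subsetD)
    from perfect_matching_Un[OF m this] have "\<exists>m. perfect_matching Q (\<Union>(g ` \<C>) \<union> ?W) m" by blast
    moreover have "\<Union>(g ` \<C>) \<union> ?W = V" using sub by blast
    ultimately show False using noQ by simp
  qed
  moreover have "pairwise disjnt \<K>" using C_disj by (auto simp: pairwise_def disjnt_def \<K>_def)
  moreover have "K \<subseteq> V - S \<and> odd (card K)" if "K \<in> \<K>" for K using that C_sub by (auto simp: \<K>_def)
  moreover have "y \<in> K \<union> S" if "K \<in> \<K>" "x \<in> K" "y \<in> V" "(x, y) \<in> R" for K x y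
    using C_closed[of K x y] that by (simp add: \<K>_def)
  moreover have "even (card S + card \<K>)"
  proof -
    have "card (\<Union>\<C>) = sum card \<C>"
      using C_disj finite_subset[OF C_sub finite_Diff[OF fin]] by (intro card_Union_disjoint) (auto simp: pairwise_def disjnt_def)
    then have "even (card (V - S)) \<longleftrightarrow> even (card \<K>)"
      using even_sum_iff[OF C_fin, of card] C_Un by (simp add: \<K>_def)
    moreover have "card V = card S + card (V - S)"
      using card_Diff_subset[OF finite_subset[OF SV fin] SV] card_mono[OF fin SV] by linarith
    ultimately show ?thesis using ev by simp
  qed
  ultimately show thesis using that[OF SV finK] by blast
qed

section \<open>Matching the cubic vertices\<close>

lemma even_card_Un_Diff:
  assumes "finite A" "finite B"
  shows "even (card ((A - B) \<union> (B - A))) \<longleftrightarrow> even (card A + card B)"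
proof -
  have "card ((A - B) \<union> (B - A)) = card (A - B) + card (B - A)"
    using assms by (intro card_Un_disjoint) auto
  moreover have "card A = card (A - B) + card (A \<inter> B)" "card B = card (B - A) + card (A \<inter> B)"
    using assms by (subst card_Un_disjoint[symmetric]; auto intro!: arg_cong[where f=card])+
  ultimately show ?thesis by presburger
qed

lemma (in fin_mgraph) even_sum_degrees:
  assumes "finite X"
  shows "even ((\<Sum>v\<in>X. card (cut G {v})) + card (cut G X))"
  using assms
proof (induction X)
  case empty
  have "cut G {} = {}" by (auto simp: cut_def)
  then show ?case by simp
next
  case (insert v X)
  obtain p q where pq: "\<And>e. e \<in> edges G \<Longrightarrow> ends G e = {p e, q e}" using ends_functions by metis
  have "cut G (insert v X) = (cut G X - cut G {v}) \<union> (cut G {v} - cut G X)"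
  proof (rule set_eqI)
    fix e
    show "e \<in> cut G (insert v X) \<longleftrightarrow> e \<in> (cut G X - cut G {v}) \<union> (cut G {v} - cut G X)"
    proof (cases "e \<in> edges G")
      case True
      show ?thesis unfolding Un_iff Diff_iff cut_ends[OF True pq[OF True]] using insert.hyps(2) by auto
    next
      case False
      then show ?thesis using cut_subset[of G] by blast
    qed
  qed
  then have "even (card (cut G (insert v X))) \<longleftrightarrow> even (card (cut G X) + card (cut G {v}))"
    using even_card_Un_Diff[OF finite_cut finite_cut] by simp
  then show ?case using insert by auto
qed

text \<open>If Tutte's condition fails, the odd sets exceed \<open>card S\<close> by at least 2, and
  at most one of them contains new vertices. Each of the others is an odd set of cubic vertices; its
  cut is odd, so nonempty, and has at least 3 edges by 3-edge-connectivity. These cuts are disjoint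
  and consist of edges at the cubic vertices of \<open>S\<close>, 3 for each, and of edges that are
  themselves in \<open>S\<close>: too few.\<close>

theorem (in fin_mgraph) cubic_matching:
  assumes con: "k_edge_connected 3 G"
  shows "\<exists>M \<subseteq> edges G. \<forall>v. cubic G v \<longrightarrow> card (M \<inter> cut G {v}) = 1"
proof -
  obtain p q where pq: "\<And>e. e \<in> edges G \<Longrightarrow> ends G e = {p e, q e}" "\<And>e. e \<in> edges G \<Longrightarrow> p e \<in> nodes G \<and> q e \<in> nodes G"
    using ends_functions by blast
  define T where "T = {v. cubic G v}"
  have finT: "finite T" using finite_nodes by (auto simp: T_def cubic_def)
  have cutE: "e \<in> cut G X \<longleftrightarrow> e \<in> edges G \<and> (p e \<in> X) \<noteq> (q e \<in> X)" for e X
    using cut_ends[OF _ pq(1)] cut_subset[of G X] by blast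
  have parity: "even (card X) \<longleftrightarrow> even (card (cut G X))" if "X \<subseteq> T" for X
  proof -
    have "(\<Sum>v\<in>X. card (cut G {v})) = 3 * card X" using that by (simp add: T_def cubic_def subset_iff)
    moreover have "even ((\<Sum>v\<in>X. card (cut G {v})) + card (cut G X))"
      using that finT by (intro even_sum_degrees) (rule finite_subset)
    ultimately show ?thesis by simp
  qed
  \<comment> \<open>Each edge between a cubic and a non-cubic vertex gets a vertex of its own, which stands for the
    non-cubic end. These new vertices are mutually adjacent, so they lie in one odd component at most.\<close>
  define V :: "('v + 'e) set" where "V = Inl ` T \<union> Inr ` cut G T"
  define R :: "(('v + 'e) \<times> ('v + 'e)) set" where "R = {(x, y).
     (\<exists>u v e. x = Inl u \<and> y = Inl v \<and> u \<noteq> v \<and> e \<in> edges G \<and> ends G e = {u, v}) \<or>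
     (\<exists>u e. x = Inl u \<and> y = Inr e \<and> u \<in> ends G e) \<or> (\<exists>u e. x = Inr e \<and> y = Inl u \<and> u \<in> ends G e) \<or>
     (\<exists>e f. x = Inr e \<and> y = Inr f)}"
  have R: "(Inl u, Inl v) \<in> R \<longleftrightarrow> u \<noteq> v \<and> (\<exists>e\<in>edges G. ends G e = {u, v})"
    "(Inl u, Inr e) \<in> R \<longleftrightarrow> u \<in> ends G e" "(Inr e, Inl u) \<in> R \<longleftrightarrow> u \<in> ends G e" "(Inr e, Inr f) \<in> R" for u v e f
    by (auto simp: R_def)
  have V: "Inl u \<in> V \<longleftrightarrow> u \<in> T" "Inr e \<in> V \<longleftrightarrow> e \<in> cut G T" for u e by (auto simp: V_def)
  have finV: "finite V" using finT finite_cut by (simp add: V_def)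
  have symR: "sym R"
  proof (rule symI)
    fix x y assume "(x, y) \<in> R"
    then show "(y, x) \<in> R" by (cases x; cases y) (auto simp: R insert_commute)
  qed
  have "card V = card T + card (cut G T)"
    unfolding V_def by (subst card_Un_disjoint) (use finT finite_cut in \<open>auto simp: card_image\<close>)
  then have evV: "even (card V)" using parity[of T] by simp
  have "\<exists>m. perfect_matching R V m"
  proof (rule ccontr)
    assume "\<nexists>m. perfect_matching R V m"
    then have no: "\<not> perfect_matching R V m" for m by blast
    obtain S \<K> where S: "S \<subseteq> V" and K: "finite \<K>" "pairwise disjnt \<K>" "card S < card \<K>" "even (card S + card \<K>)"
      "\<And>K. K \<in> \<K> \<Longrightarrow> K \<subseteq> V - S \<and> odd (card K)"
      "\<And>K x y. K \<in> \<K> \<Longrightarrow> x \<in> K \<Longrightarrow> y \<in> V \<Longrightarrow> (x, y) \<in> R \<Longrightarrow> y \<in> K \<union> S"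
      using tutte[OF finV evV symR no] by metis
    define S0 where "S0 = {v. Inl v \<in> S}"
    define S1 where "S1 = {e. Inr e \<in> S}"
    have SS: "S = Inl ` S0 \<union> Inr ` S1"
    proof (rule set_eqI)
      fix x show "x \<in> S \<longleftrightarrow> x \<in> Inl ` S0 \<union> Inr ` S1" by (cases x) (auto simp: S0_def S1_def)
    qed
    have S0T: "S0 \<subseteq> T" and "S1 \<subseteq> cut G T" using S V by (auto simp: S0_def S1_def)
    then have finS: "finite S0" "finite S1" using finT finite_cut by (auto intro: finite_subset)
    have cardS: "card S = card S0 + card S1"
      unfolding SS by (subst card_Un_disjoint) (use finS in \<open>auto simp: card_image\<close>)
    define \<L> where "\<L> = {K \<in> \<K>. \<forall>e. Inr e \<notin> K}"
    have "card (\<K> - \<L>) \<le> 1"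
    proof (rule ccontr)
      assume "\<not> ?thesis"
      then obtain K L where KL: "K \<in> \<K> - \<L>" "L \<in> \<K> - \<L>" "K \<noteq> L"
        unfolding One_nat_def card_le_Suc0_iff_eq[OF finite_Diff[OF K(1)]] by blast
      then obtain e f where ef: "Inr e \<in> K" "Inr f \<in> L" by (auto simp: \<L>_def)
      have "Inr f \<in> V - S" "Inr f \<notin> K" using KL ef K(2) K(5)[of L] by (auto simp: pairwise_def disjnt_def)
      moreover have "K \<in> \<K>" using KL(1) by simp
      ultimately show False using K(6)[OF _ ef(1) _ R(4)[of e f]] by simp
    qed
    moreover have "card \<K> = card \<L> + card (\<K> - \<L>)"
      by (subst card_Un_disjoint[symmetric]) (use K(1) in \<open>auto simp: \<L>_def intro!: arg_cong[where f=card]\<close>)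
    moreover have "card \<K> \<noteq> Suc (card S)" using K(4) by auto
    ultimately have big: "card S < card \<L>" using K(3) by linarith
    have finL: "finite \<L>" using K(1) by (simp add: \<L>_def)
    define c where "c K = {v. Inl v \<in> K}" for K :: "('v + 'e) set"
    have cK: "K = Inl ` c K" "c K \<subseteq> T" "c K \<inter> S0 = {}" if "K \<in> \<L>" for K
    proof -
      have KV: "K \<subseteq> V - S" using K(5) that by (auto simp: \<L>_def)
      show "K = Inl ` c K"
      proof (rule set_eqI)
        fix x show "x \<in> K \<longleftrightarrow> x \<in> Inl ` c K" using that by (cases x) (auto simp: c_def \<L>_def)
      qed
      show "c K \<subseteq> T" "c K \<inter> S0 = {}" using KV V by (auto simp: c_def S0_def)
    qed
    have other: "v \<in> S0 \<or> e \<in> S1 \<and> v \<notin> T" if KL: "K \<in> \<L>" and u: "u \<in> c K" "v \<notin> c K" and e: "e \<in> edges G" "ends G e = {u, v}" for K u v e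
    proof -
      have uK: "Inl u \<in> K" "Inl v \<notin> K" "u \<in> T" "K \<in> \<K>" using KL u cK(2)[OF KL] by (auto simp: c_def \<L>_def)
      have "u \<noteq> v" using u by blast
      show ?thesis
      proof (cases "v \<in> T")
        case True
        then have "(Inl u, Inl v) \<in> R" "Inl v \<in> V" using e \<open>u \<noteq> v\<close> by (auto simp: R V)
        then show ?thesis using K(6)[OF uK(4,1)] uK(2) by (auto simp: S0_def)
      next
        case False
        then have "e \<in> cut G T" using cut_ends[OF e, of T] uK by simp
        then have "Inr e \<in> K \<union> S" using K(6)[OF uK(4,1), of "Inr e"] V R e by simp
        then show ?thesis using KL False by (auto simp: S1_def \<L>_def)
      qed
    qed
    have cutK: "\<exists>u v. ends G e = {u, v} \<and> u \<in> c K \<and> v \<notin> c K" if "e \<in> cut G (c K)" for e K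
      using that by (auto simp: cut_def)
    define Q where "Q = (\<Union>s\<in>S0. cut G {s}) \<union> S1"
    have sub: "cut G (c K) \<subseteq> Q" if "K \<in> \<L>" for K
    proof
      fix e assume e: "e \<in> cut G (c K)"
      then obtain u v where uv: "ends G e = {u, v}" "u \<in> c K" "v \<notin> c K" using cutK by blast
      have eE: "e \<in> edges G" using e cut_subset[of G] by blast
      have "u \<noteq> v" using uv by blast
      then have "e \<in> cut G {v}" using cut_ends[OF eE uv(1)] by simp
      then show "e \<in> Q" using other[OF that uv(2,3) eE uv(1)] by (auto simp: Q_def)
    qed
    have disj: "cut G (c K) \<inter> cut G (c L) = {}" if KL: "K \<in> \<L>" "L \<in> \<L>" "K \<noteq> L" for K L
    proof (rule ccontr)
      assume "\<not> ?thesis"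
      then obtain e where e: "e \<in> cut G (c K)" "e \<in> cut G (c L)" by blast
      then obtain u v where uv: "ends G e = {u, v}" "u \<in> c K" "v \<notin> c K" using cutK by blast
      have eE: "e \<in> edges G" using e cut_subset[of G] by blast
      have "disjnt K L" using KL K(2) by (auto simp: pairwise_def \<L>_def)
      then have "u \<notin> c L" using uv by (auto simp: c_def disjnt_def)
      then have "v \<in> c L" using e(2) cut_ends[OF eE uv(1), of "c L"] by simp
      then show False using other[OF KL(1) uv(2,3) eE uv(1)] cK(2,3)[OF KL(2)] by blast
    qed
    have three: "3 \<le> card (cut G (c K))" if "K \<in> \<L>" for K
    proof -
      have "odd (card K)" using K(5) that by (auto simp: \<L>_def)
      then have "odd (card (c K))" using cK(1)[OF that] by (metis card_image inj_Inl inj_on_subset subset_UNIV)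
      then have od: "odd (card (cut G (c K)))" "c K \<noteq> {}" using parity[OF cK(2)[OF that]] by auto
      have "cut G (nodes G) = {}" using pq by (auto simp: cutE)
      then have "c K \<noteq> nodes G" using od by auto
      then have "c K \<subset> nodes G" using cK(2)[OF that] by (auto simp: T_def cubic_def)
      then show ?thesis using con od(2) by (simp add: k_edge_connected_def)
    qed
    have finQ: "finite Q" using finS finite_cut by (simp add: Q_def)
    have "3 * card \<L> = (\<Sum>K\<in>\<L>. 3)" by simp
    also have "\<dots> \<le> (\<Sum>K\<in>\<L>. card (cut G (c K)))" by (rule sum_mono) (rule three)
    also have "\<dots> = card (\<Union>K\<in>\<L>. cut G (c K))"
      by (rule card_UN_disjoint[symmetric]) (use finL finite_cut disj in auto)
    also have "\<dots> \<le> card Q" using sub finQ by (intro card_mono) auto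
    also have "\<dots> \<le> card (\<Union>s\<in>S0. cut G {s}) + card S1" unfolding Q_def by (rule card_Un_le)
    also have "\<dots> \<le> (\<Sum>s\<in>S0. card (cut G {s})) + card S1" using card_UN_le[OF finS(1), of "\<lambda>s. cut G {s}"] by simp
    also have "(\<Sum>s\<in>S0. card (cut G {s})) = 3 * card S0" using S0T by (simp add: T_def cubic_def subset_iff)
    finally show False using big cardS by linarith
  qed
  then obtain m where m: "perfect_matching R V m" by blast
  \<comment> \<open>One of possibly several parallel edges, chosen by the set of its ends, so that
    two cubic vertices matched to each other select the same edge.\<close>
  define ch where "ch Z = (SOME e. e \<in> edges G \<and> ends G e = Z)" for Z
  define w where "w u = (case m (Inl u) of Inl v \<Rightarrow> ch {u, v} | Inr e \<Rightarrow> e)" for u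
  have mT: "m (Inl u) \<in> V" "(Inl u, m (Inl u)) \<in> R" "m (m (Inl u)) = Inl u" if "u \<in> T" for u
    using m that V(1)[of u] by (auto simp: perfect_matching_def)
  have wl: "ch {u, v} \<in> edges G \<and> ends G (ch {u, v}) = {u, v} \<and> v \<noteq> u" if "u \<in> T" "m (Inl u) = Inl v" for u v
  proof -
    have *: "u \<noteq> v \<and> (\<exists>e\<in>edges G. ends G e = {u, v})" using mT(2)[OF that(1)] unfolding that(2) R .
    then have "ch {u, v} \<in> edges G \<and> ends G (ch {u, v}) = {u, v}"
      unfolding ch_def by (intro someI_ex[of "\<lambda>e. e \<in> edges G \<and> ends G e = {u, v}"]) blast
    with * show ?thesis by metis
  qed
  have wr: "e \<in> cut G T \<and> u \<in> ends G e" if "u \<in> T" "m (Inl u) = Inr e" for u e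
    using mT(1,2)[OF that(1)] unfolding that(2) R V by blast
  have w_cut: "w u \<in> cut G {u}" if u: "u \<in> T" for u
  proof (cases "m (Inl u)")
    case (Inl v)
    then show ?thesis using wl[OF u Inl] cut_ends[of "ch {u, v}" G u v "{u}"] by (simp add: w_def)
  next
    case (Inr e)
    then have "e \<in> cut G T" "u \<in> ends G e" using wr[OF u Inr] by auto
    then have "e \<in> cut G {u}" using u pq(1)[of e] unfolding cutE by auto
    then show ?thesis using Inr by (simp add: w_def)
  qed
  have w_unique: "w u' = w u" if u: "u \<in> T" "u' \<in> T" "w u' \<in> cut G {u}" for u u'
  proof (cases "u' = u")
    case False
    show ?thesis
    proof (cases "m (Inl u')")
      case (Inl v)
      then have "ch {u', v} \<in> cut G {u}" using u(3) by (simp add: w_def)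
      then have "u = v" using wl[OF u(2) Inl] cut_ends[of "ch {u', v}" G u' v "{u}"] False by auto
      then have "m (Inl u) = Inl u'" using mT(3)[OF u(2)] Inl by simp
      then show ?thesis using Inl \<open>u = v\<close> by (simp add: w_def insert_commute)
    next
      case (Inr e)
      then have e: "e \<in> cut G {u}" "e \<in> cut G T" "u' \<in> ends G e" using u(3) wr[OF u(2) Inr] by (auto simp: w_def)
      then have "ends G e = {p e, q e}" using pq(1) unfolding cutE by blast
      then have pq': "u' = p e \<or> u' = q e" using e(3) by simp
      have "p e = u \<or> q e = u" using e(1) unfolding cutE by blast
      with pq' have "p e \<in> T \<and> q e \<in> T" using u(1,2) \<open>u' \<noteq> u\<close> by metis
      then have False using e(2) by (simp add: cutE)
      then show ?thesis ..
    qed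
  qed simp
  have "w ` T \<subseteq> edges G" using w_cut cut_subset[of G] by blast
  moreover have "card (w ` T \<inter> cut G {v}) = 1" if "cubic G v" for v
  proof -
    have v: "v \<in> T" using that by (simp add: T_def)
    have "w ` T \<inter> cut G {v} = {w v}"
    proof (intro equalityI subsetI)
      fix e assume "e \<in> w ` T \<inter> cut G {v}"
      then obtain u' where "u' \<in> T" "e = w u'" "w u' \<in> cut G {v}" by blast
      then show "e \<in> {w v}" using w_unique[OF v] by simp
    qed (use v w_cut in blast)
    then show ?thesis by simp
  qed
  ultimately show ?thesis by blast
qed

subsection \<open>Reversing circuits\<close>

definition leaving :: "'e set \<Rightarrow> ('e \<Rightarrow> 'v) \<Rightarrow> ('e \<Rightarrow> 'v) \<Rightarrow> 'v set \<Rightarrow> 'e set" where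
  "leaving B t h X = {b \<in> B. t b \<in> X \<and> h b \<notin> X}"

lemma leaving_submodular:
  assumes "finite B"
  shows "card (leaving B t h (X \<inter> Y)) + card (leaving B t h (X \<union> Y)) \<le> card (leaving B t h X) + card (leaving B t h Y)"
proof -
  have fin: "finite (leaving B t h Z)" for Z using assms by (simp add: leaving_def)
  have "card (leaving B t h (X \<inter> Y) \<union> leaving B t h (X \<union> Y)) \<le> card (leaving B t h X \<union> leaving B t h Y)"
    using fin by (intro card_mono) (auto simp: leaving_def)
  moreover have "card (leaving B t h (X \<inter> Y) \<inter> leaving B t h (X \<union> Y)) \<le> card (leaving B t h X \<inter> leaving B t h Y)"
    using fin by (intro card_mono) (auto simp: leaving_def)
  ultimately show ?thesis
    using card_Un_Int[OF fin fin, of "X \<inter> Y" "X \<union> Y"] card_Un_Int[OF fin fin, of X Y] by linarith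
qed

definition in_chord :: "'e set \<Rightarrow> 'e set \<Rightarrow> ('e \<Rightarrow> 'v) \<Rightarrow> ('e \<Rightarrow> 'v) \<Rightarrow> 'v \<Rightarrow> bool" where
  "in_chord E B t h w \<longleftrightarrow> (\<exists>e\<in>E - B. h e = w \<and> t e \<noteq> w)"

text \<open>
  \<open>B\<close> is a directed circuit with vertex set \<open>R\<close>. At each vertex of \<open>R\<close> the arcs outside \<open>B\<close> either all
  enter or all leave it (\<open>in_chord\<close> with swapped arguments stands for the latter).
\<close>

locale circuit =
  fixes N :: "'v set" and E B :: "'e set" and R :: "'v set" and t h :: "'e \<Rightarrow> 'v"
  assumes finN: "finite N" and finE: "finite E" and BE: "B \<subseteq> E" and EN: "\<And>e. e \<in> E \<Longrightarrow> t e \<in> N \<and> h e \<in> N"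
    and strong: "\<And>X. X \<noteq> {} \<Longrightarrow> X \<subset> N \<Longrightarrow> leaving E t h X \<noteq> {}"
    and RN: "R \<subseteq> N" and R_ne: "R \<noteq> {}" and BR: "\<And>b. b \<in> B \<Longrightarrow> t b \<in> R \<and> h b \<in> R"
    and conn: "\<And>W. W \<inter> R \<noteq> {} \<Longrightarrow> \<not> R \<subseteq> W \<Longrightarrow> leaving B t h W \<noteq> {}"
    and chord: "\<And>w. w \<in> R \<Longrightarrow> in_chord E B t h w \<longleftrightarrow> \<not> in_chord E B h t w"
begin

text \<open>
  \<open>X\<close> shows that \<open>g\<close> cannot be deleted, even if \<open>B\<close> is reversed to make \<open>g\<close> leave \<open>X\<close>.
\<close>

definition stuck :: "'e \<Rightarrow> 'v set \<Rightarrow> bool" where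
  "stuck g X \<longleftrightarrow> X \<subseteq> N \<and> leaving (E - B) t h X = {} \<and> card (leaving B t h X) = 1 \<and> g \<in> B \<and>
     (\<exists>v u. {t g, h g} = {v, u} \<and> v \<in> X \<and> u \<notin> X \<and> in_chord E B h t v \<and> in_chord E B t h u)"

text \<open>Reversing all arcs exchanges sets with their complements and in-chords with out-chords.
  This symmetry allows \<open>stuck_shrinks\<close> to pass to a complement.\<close>

lemma swapped: "circuit N E B R h t"
proof
  fix X assume X: "X \<noteq> {}" "X \<subset> N"
  then have "leaving E t h (N - X) \<noteq> {}" by (intro strong) auto
  then show "leaving E h t X \<noteq> {}" using EN by (auto simp: leaving_def)
next
  fix W assume W: "W \<inter> R \<noteq> {}" "\<not> R \<subseteq> W"
  then have "leaving B t h (- W) \<noteq> {}" by (intro conn) auto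
  then show "leaving B h t W \<noteq> {}" by (auto simp: leaving_def)
qed (use finN finE BE EN RN R_ne BR chord in auto)

lemma stuck_swapped: "circuit.stuck N E B h t g (N - X)" if st: "stuck g X"
proof -
  interpret s: circuit N E B R h t by (rule swapped)
  have BN: "t b \<in> N \<and> h b \<in> N" if "b \<in> B" for b using that BE EN by blast
  have "leaving B h t (N - X) = leaving B t h X" using BN by (auto simp: leaving_def)
  moreover have "leaving (E - B) h t (N - X) = leaving (E - B) t h X" using EN by (auto simp: leaving_def)
  moreover obtain v u where vu: "{t g, h g} = {v, u}" "v \<in> X" "u \<notin> X" "in_chord E B h t v" "in_chord E B t h u"
    using st unfolding stuck_def by blast
  moreover have "u \<in> N" using vu(1) BN[of g] st by (auto simp: stuck_def doubleton_eq_iff)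
  ultimately show ?thesis using st unfolding stuck_def s.stuck_def
    by (intro conjI exI[of _ u] exI[of _ v]) (auto simp: insert_commute)
qed

text \<open>Otherwise arcs starting in \<open>X - R\<close> stay there, so \<open>X - R\<close> is
  empty by strongness. Then a vertex of \<open>X\<close> has an out-chord, whose head lies in
  \<open>X\<close> and hence in \<open>R\<close>, which gives an in-chord after all.\<close>

lemma in_chord_exists:
  assumes X: "X \<subseteq> N" "leaving (E - B) t h X = {}" "X \<inter> R \<noteq> {}"
  shows "\<exists>w\<in>X \<inter> R. in_chord E B t h w"
proof (rule ccontr)
  assume no: "\<not> ?thesis"
  have "leaving E t h (X - R) = {}"
  proof (rule ccontr)
    assume "\<not> ?thesis"
    then obtain e where e: "e \<in> E" "t e \<in> X - R" "h e \<notin> X - R" by (auto simp: leaving_def)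
    then have "e \<in> E - B" using BR by blast
    moreover from this have "h e \<in> X" using X(2) e by (auto simp: leaving_def)
    ultimately show False using no e by (auto simp: in_chord_def)
  qed
  moreover have "X - R \<subset> N" using X by blast
  ultimately have XR: "X \<subseteq> R" using strong[of "X - R"] by blast
  obtain w where w: "w \<in> X" "w \<in> R" using X by blast
  then have "in_chord E B h t w" using no chord by blast
  then obtain e where e: "e \<in> E - B" "t e = w" "h e \<noteq> w" by (auto simp: in_chord_def)
  then have "h e \<in> X" using X(2) w by (auto simp: leaving_def)
  then show False using no e XR by (auto simp: in_chord_def)
qed

text \<open>The circuit leaves both the set of in-chord vertices and the set of out-chord vertices
  in \<open>X\<close>. At most one circuit arc leaves \<open>X\<close>, so one of these two arcs
  leads to the other set.\<close>

lemma sign_change_in: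
  assumes X: "card (leaving B t h X) \<le> 1" and v: "v \<in> X \<inter> R" "in_chord E B h t v" and w: "w \<in> X \<inter> R" "in_chord E B t h w"
  obtains g v' u' where "g \<in> B" "{t g, h g} = {v', u'}" "v' \<in> X" "u' \<in> X" "in_chord E B h t v'" "in_chord E B t h u'"
proof -
  define P where "P = {w \<in> X \<inter> R. in_chord E B t h w}"
  define Q where "Q = {w \<in> X \<inter> R. in_chord E B h t w}"
  have PQ: "P \<inter> Q = {}" "P \<union> Q = X \<inter> R" "v \<in> Q" "w \<in> P" using chord v w by (auto simp: P_def Q_def)
  have "leaving B t h P \<noteq> {}" by (rule conn) (use PQ v w in blast)+
  moreover have "leaving B t h Q \<noteq> {}" by (rule conn) (use PQ v w in blast)+
  ultimately obtain a b where ab: "a \<in> B" "t a \<in> P" "h a \<notin> P" "b \<in> B" "t b \<in> Q" "h b \<notin> Q" by (auto simp: leaving_def)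
  have "h a \<in> X \<or> h b \<in> X"
  proof (rule ccontr)
    assume "\<not> ?thesis"
    then have "{a, b} \<subseteq> leaving B t h X" using ab PQ(2) by (auto simp: leaving_def)
    moreover have "finite (leaving B t h X)" using finite_subset[OF BE finE] by (simp add: leaving_def)
    ultimately have "card {a, b} \<le> 1" using X card_mono by (meson le_trans)
    moreover have "a \<noteq> b" using ab PQ(1) by blast
    ultimately show False by simp
  qed
  then have "h a \<in> Q \<or> h b \<in> P" using ab PQ(2) BR by blast
  then show thesis
  proof
    assume "h a \<in> Q" then show thesis using that[OF ab(1), of "h a" "t a"] ab(2) by (simp add: P_def Q_def insert_commute)
  next
    assume "h b \<in> P" then show thesis using that[OF ab(4), of "t b" "h b"] ab(5) by (simp add: P_def Q_def)
  qed
qed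

text \<open>
  The dichotomy: either the intersection of two stuck sets is stuck, by submodularity, or
  they jointly cover the circuit, and then strongness puts the complement of the second inside the first.
\<close>

lemma stuck_shrinks:
  assumes all: "\<And>g v u. g \<in> B \<Longrightarrow> {t g, h g} = {v, u} \<Longrightarrow> in_chord E B h t v \<Longrightarrow> in_chord E B t h u \<Longrightarrow> \<exists>X. stuck g X"
    and X: "stuck g X"
  shows "\<exists>g' X'. X' \<subset> X \<and> (stuck g' X' \<or> circuit.stuck N E B h t g' X')"
proof -
  have XN: "X \<subseteq> N" "leaving (E - B) t h X = {}" "card (leaving B t h X) = 1" and gB: "g \<in> B" using X by (simp_all add: stuck_def)
  obtain v u where vu: "{t g, h g} = {v, u}" "v \<in> X" "u \<notin> X" "in_chord E B h t v"
    using X unfolding stuck_def by blast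
  have vR: "v \<in> X \<inter> R" using vu BR[OF gB] by (auto simp: doubleton_eq_iff)
  then obtain w where w: "w \<in> X \<inter> R" "in_chord E B t h w" using in_chord_exists[OF XN(1,2)] by blast
  obtain g' v' u' where g': "g' \<in> B" "{t g', h g'} = {v', u'}" "v' \<in> X" "u' \<in> X" "in_chord E B h t v'" "in_chord E B t h u'"
    using sign_change_in[OF _ vR vu(4) w] XN(3) by (metis order_refl)
  obtain X' where X': "stuck g' X'" using all[OF g'(1,2,5,6)] by blast
  have R': "v' \<in> R" "u' \<in> R" using g'(2) BR[OF g'(1)] by (auto simp: doubleton_eq_iff)
  have X'N: "X' \<subseteq> N" "leaving (E - B) t h X' = {}" "card (leaving B t h X') = 1" using X' by (simp_all add: stuck_def)
  have v'u': "v' \<in> X'" "u' \<notin> X'"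
  proof -
    obtain x y where xy: "{t g', h g'} = {x, y}" "x \<in> X'" "y \<notin> X'" "in_chord E B h t x" "in_chord E B t h y"
      using X' unfolding stuck_def by blast
    have "x = v' \<and> y = u' \<or> x = u' \<and> y = v'" using xy(1) g'(2) by (metis doubleton_eq_iff)
    moreover have "x \<noteq> u'" using xy(4) g'(6) chord[OF R'(2)] by blast
    ultimately have "x = v' \<and> y = u'" by blast
    then show "v' \<in> X'" "u' \<notin> X'" using xy by auto
  qed
  show ?thesis
  proof (cases "R \<subseteq> X \<union> X'")
    case False
    have finB: "finite B" using finite_subset[OF BE finE] .
    have "leaving B t h (X \<inter> X') \<noteq> {}" using g' v'u' R' by (intro conn) auto
    moreover have "leaving B t h (X \<union> X') \<noteq> {}" using False R' v'u' by (intro conn) auto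
    ultimately have "card (leaving B t h (X \<inter> X')) \<noteq> 0" "card (leaving B t h (X \<union> X')) \<noteq> 0"
      using finB by (simp_all add: leaving_def)
    then have "card (leaving B t h (X \<inter> X')) = 1"
      using leaving_submodular[OF finB, of t h X X'] XN(3) X'N(3) by linarith
    moreover have "leaving (E - B) t h (X \<inter> X') = {}" using XN(2) X'N(2) by (auto simp: leaving_def)
    ultimately have "stuck g' (X \<inter> X')"
      unfolding stuck_def using XN(1) g' v'u' by (intro conjI exI[of _ v'] exI[of _ u']) auto
    moreover have "X \<inter> X' \<subset> X" using g'(4) v'u' by blast
    ultimately show ?thesis by blast
  next
    case True
    let ?Z = "N - X'"
    have "leaving E t h (N - (?Z - X)) = {}"
    proof (rule ccontr)
      assume "\<not> ?thesis"
      then obtain e where e: "e \<in> E" "t e \<in> X \<union> X'" "h e \<notin> X \<union> X'" using EN by (auto simp: leaving_def)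
      then have "e \<in> E - B" using BR True by blast
      then show False using e XN(2) X'N(2) by (auto simp: leaving_def)
    qed
    moreover have "v' \<in> N - (?Z - X)" using subsetD[OF RN R'(1)] g'(3) by simp
    ultimately have "\<not> N - (?Z - X) \<subset> N" using strong[of "N - (?Z - X)"] by (metis empty_iff)
    then have "?Z \<subseteq> X" by blast
    then have "?Z \<subset> X" using g'(3) v'u' by blast
    then show ?thesis using stuck_swapped[OF X'] by blast
  qed
qed

text \<open>Some circuit arc joins an out-chord vertex and an in-chord vertex. If every such arc
  were stuck, \<open>stuck_shrinks\<close> would contradict the choice of a minimal set. Minimality
  refers to the stuck sets of both directions, since the smaller set may belong to the reversed
  digraph.\<close>

theorem unstuck_edge:
  obtains g v u where "g \<in> B" "{t g, h g} = {v, u}" "in_chord E B h t v" "in_chord E B t h u" "\<And>X. \<not> stuck g X"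
proof (rule ccontr)
  note free = that
  assume no: "\<not> thesis"
  interpret s: circuit N E B R h t by (rule swapped)
  have all: "\<exists>X. stuck g X" if "g \<in> B" "{t g, h g} = {v, u}" "in_chord E B h t v" "in_chord E B t h u" for g v u
    using no free that by metis
  have all': "\<exists>X. s.stuck g X" if "g \<in> B" "{h g, t g} = {v, u}" "in_chord E B t h v" "in_chord E B h t u" for g v u
    using all[OF that(1) _ that(4,3)] that(2) stuck_swapped by (metis insert_commute)
  have NN: "leaving (E - B) t h N = {}" "leaving (E - B) h t N = {}" "leaving B t h N = {}" using EN BE by (auto simp: leaving_def)
  have "N \<inter> R \<noteq> {}" using RN R_ne by blast
  then obtain v w where "v \<in> N \<inter> R" "in_chord E B h t v" "w \<in> N \<inter> R" "in_chord E B t h w"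
    using in_chord_exists[OF subset_refl NN(1)] s.in_chord_exists[OF subset_refl NN(2)] by blast
  then obtain g v' u' where "g \<in> B" "{t g, h g} = {v', u'}" "in_chord E B h t v'" "in_chord E B t h u'"
    using sign_change_in[of N v w] NN(3) by (metis card.empty zero_le)
  then obtain X0 where X0: "stuck g X0" using all by blast
  define \<X> where "\<X> = {X. \<exists>g. stuck g X \<or> s.stuck g X}"
  have "X0 \<in> \<X>" using X0 by (auto simp: \<X>_def)
  moreover have "finite \<X>" by (rule finite_subset[of _ "Pow N"]) (use finN in \<open>auto simp: \<X>_def stuck_def s.stuck_def\<close>)
  ultimately obtain X where X: "X \<in> \<X>" "\<And>X'. X' \<in> \<X> \<Longrightarrow> X' \<subseteq> X \<Longrightarrow> X' = X"
    using finite_has_minimal[of \<X>] by (metis empty_iff)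
  have "\<exists>X'\<in>\<X>. X' \<subset> X"
  proof -
    obtain g where "stuck g X \<or> s.stuck g X" using X(1) by (auto simp: \<X>_def)
    then show ?thesis
    proof
      assume "stuck g X"
      then have "\<exists>g' X'. X' \<subset> X \<and> (stuck g' X' \<or> s.stuck g' X')" using all by (intro stuck_shrinks)
      then show ?thesis unfolding \<X>_def by blast
    next
      assume "s.stuck g X"
      then have "\<exists>g' X'. X' \<subset> X \<and> (s.stuck g' X' \<or> stuck g' X')" using all' by (intro s.stuck_shrinks)
      then show ?thesis unfolding \<X>_def by blast
    qed
  qed
  then show False using X(2) by blast
qed

end

text \<open>
  Given two edges of \<open>C\<close> at each cubic vertex, the minimal circular sets are the edge sets
  of the circuits of \<open>C\<close> all of whose vertices are cubic (two parallel edges count as a circuit).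
\<close>

definition circular :: "('v, 'e) mgraph \<Rightarrow> 'e set \<Rightarrow> 'e set \<Rightarrow> bool" where
  "circular G C B \<longleftrightarrow> B \<noteq> {} \<and> B \<subseteq> C \<and>
     (\<forall>e\<in>B. \<forall>v\<in>ends G e. cubic G v \<and> e \<in> cut G {v} \<and> C \<inter> cut G {v} \<subseteq> B)"

lemma circularD:
  assumes "circular G C B" "e \<in> B" "v \<in> ends G e"
  shows "cubic G v" "e \<in> cut G {v}" "C \<inter> cut G {v} \<subseteq> B"
  using assms by (simp_all add: circular_def)

definition min_circular :: "('v, 'e) mgraph \<Rightarrow> 'e set \<Rightarrow> 'e set \<Rightarrow> bool" where
  "min_circular G C B \<longleftrightarrow> circular G C B \<and> (\<forall>B'. circular G C B' \<longrightarrow> B' \<subseteq> B \<longrightarrow> B' = B)"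

text \<open>A nonempty intersection of two circular sets is circular, so minimality makes both equal
  to it.\<close>

lemma min_circular_disjoint:
  assumes "min_circular G C B" "min_circular G C B'" "B \<noteq> B'"
  shows "B \<inter> B' = {}"
proof (rule ccontr)
  assume "B \<inter> B' \<noteq> {}"
  moreover have BB': "circular G C B" "circular G C B'" using assms(1,2) by (simp_all add: min_circular_def)
  moreover have "B \<inter> B' \<subseteq> C" using BB'(1) unfolding circular_def by blast
  moreover have "cubic G v \<and> e \<in> cut G {v} \<and> C \<inter> cut G {v} \<subseteq> B \<inter> B'" if "e \<in> B \<inter> B'" "v \<in> ends G e" for e v
    using circularD[OF BB'(1), of e v] circularD[OF BB'(2), of e v] that by simp
  ultimately have c: "circular G C (B \<inter> B')" unfolding circular_def[of G C "B \<inter> B'"] by blast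
  have "B \<inter> B' = B" "B \<inter> B' = B'"
    using assms(1,2)[unfolded min_circular_def, THEN conjunct2, rule_format, OF c] by blast+
  then show False using assms(3) by simp
qed

lemma min_circular_exists:
  assumes "finite C" "circular G C B"
  shows "\<exists>B'\<subseteq>B. min_circular G C B'"
proof -
  let ?S = "{B'. circular G C B' \<and> B' \<subseteq> B}"
  have fin: "finite ?S" by (rule finite_subset[of _ "Pow C"]) (use assms(1) in \<open>auto simp: circular_def\<close>)
  have "?S \<noteq> {}" using assms(2) by blast
  from finite_has_minimal[OF fin this] obtain B' where B': "B' \<in> ?S" "\<forall>x\<in>?S. x \<subseteq> B' \<longrightarrow> B' = x"
    by (rule bexE)
  then have "B'' = B'" if "circular G C B''" "B'' \<subseteq> B'" for B'' using that by auto
  then have "min_circular G C B'" using B'(1) unfolding min_circular_def by simp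
  then show ?thesis using B'(1) by auto
qed

text \<open>The third edge at a vertex of \<open>B\<close> is in \<open>M\<close>; since it is
  deletable, one edge of \<open>B\<close> enters and one leaves. Thus \<open>B\<close> is balanced,
  and its reversal does not change how many of its arcs leave a given set. Deletions that avoid
  \<open>B\<close> therefore stay harmless, and \<open>unstuck_edge\<close> supplies the new
  deletable edge.\<close>

lemma (in fin_mgraph) reverse_circuit:
  assumes M: "M \<subseteq> edges G" "\<And>v. cubic G v \<Longrightarrow> card (M \<inter> cut G {v}) = 1"
    and D: "deletable G D M" and B: "min_circular G (edges G - M) B"
  shows "\<exists>D'. orientation G D' \<and> (\<forall>F. F \<inter> B = {} \<longrightarrow> strong_without D F \<longrightarrow> strong_without D' F) \<and>
    (\<exists>g\<in>B. strong_without D' {g})"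
proof -
  define t where "t = tail D"
  define h where "h = head D"
  define R where "R = \<Union>(ends G ` B)"
  let ?E = "edges G" and ?N = "nodes G" and ?C = "edges G - M"
  have D_simps: "verts D = ?N" "arcs D = ?E" and endsE: "\<And>e. e \<in> ?E \<Longrightarrow> ends G e = {t e, h e}"
    using D by (auto simp: deletable_def orientation_def t_def h_def)
  have endsN: "t e \<in> ?N \<and> h e \<in> ?N" if "e \<in> ?E" for e
    using ends_in_nodes[OF that] endsE[OF that] by (metis doubleton_eq_iff)
  have cutE: "e \<in> cut G X \<longleftrightarrow> e \<in> ?E \<and> (t e \<in> X) \<noteq> (h e \<in> X)" for e X
    using cut_ends[OF _ endsE] cut_subset[of G X] by blast
  have without: "strong_without D F \<longleftrightarrow> (\<forall>X. X \<noteq> {} \<and> X \<subset> ?N \<longrightarrow> leaving (?E - F) t h X \<noteq> {})" for F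
  proof -
    have "leaving (?E - F) t h X \<noteq> {} \<longleftrightarrow> (\<exists>a\<in>arcs D - F. tail D a \<in> X \<and> head D a \<in> verts D - X)" for X
      using endsN by (auto simp: leaving_def t_def h_def D_simps)
    then show ?thesis by (simp add: strong_without_def D_simps(1))
  qed
  have circB: "circular G ?C B" and minB: "\<And>B'. circular G ?C B' \<Longrightarrow> B' \<subseteq> B \<Longrightarrow> B' = B"
    using B by (auto simp: min_circular_def)
  have B_ne: "B \<noteq> {}" and BC: "B \<subseteq> ?C" using circB by (auto simp: circular_def)
  have BE: "B \<subseteq> ?E" using BC by blast
  have finB: "finite B" using finite_subset[OF BE finite_edges] .
  have BR: "t b \<in> R \<and> h b \<in> R" if "b \<in> B" for b
    using that endsE[of b] BE unfolding R_def by auto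
  have RN: "R \<subseteq> ?N" using endsE endsN BE unfolding R_def by fastforce
  have Rw: "cubic G w" "?C \<inter> cut G {w} \<subseteq> B" "\<exists>b\<in>B. b \<in> cut G {w}" if "w \<in> R" for w
    using that circB unfolding R_def circular_def by blast+
  have noloop: "t b \<noteq> h b" if "b \<in> B" for b
  proof -
    have "b \<in> cut G {t b}" using that circB endsE[of b] BE unfolding circular_def by blast
    then show ?thesis unfolding cutE by auto
  qed
  have local: "\<exists>m a b. cut G {w} - B = {m} \<and> {i \<in> B. t i = w} = {a} \<and> {i \<in> B. h i = w} = {b}" if w: "w \<in> R" for w
  proof -
    have c3: "card (cut G {w}) = 3" using Rw(1)[OF w] by (simp add: cubic_def)
    obtain m where m: "M \<inter> cut G {w} = {m}" using M(2)[OF Rw(1)[OF w]] by (rule card_1_singletonE)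
    have cutB: "cut G {w} - {m} \<subseteq> B" using Rw(2)[OF w] m cut_subset[of G "{w}"] by blast
    have mB: "m \<notin> B" "m \<in> cut G {w}" "m \<in> M" using m BC by blast+
    then have cm: "cut G {w} - B = {m}" using cutB by blast
    have "B \<inter> cut G {w} = cut G {w} - {m}" using cutB mB by blast
    then have c2: "card (B \<inter> cut G {w}) = 2" using c3 mB(2) finite_cut by simp
    have st: "leaving (?E - {m}) t h X \<noteq> {}" if "X \<noteq> {}" "X \<subset> ?N" for X
    proof -
      have "strong_without D {m}" using D mB(3) unfolding deletable_def by simp
      then show ?thesis using that unfolding without by simp
    qed
    obtain e where e: "e \<in> B" "e \<in> cut G {w}" using Rw(3)[OF w] by blast
    have wN: "w \<in> ?N" using w RN by blast
    have "t e \<in> ?N" "h e \<in> ?N" "(t e = w) \<noteq> (h e = w)" using e endsN BE unfolding cutE by auto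
    then have N1: "{w} \<noteq> ?N" by (metis singletonD)
    have "leaving (?E - {m}) t h {w} \<noteq> {}" by (rule st) (use N1 wN in auto)
    then obtain a where a: "a \<in> ?E" "a \<noteq> m" "t a = w" "h a \<noteq> w" by (auto simp: leaving_def)
    have "leaving (?E - {m}) t h (?N - {w}) \<noteq> {}" by (rule st) (use N1 wN in auto)
    then obtain b where b: "b \<in> ?E" "b \<noteq> m" "t b \<noteq> w" "h b = w" using endsN by (auto simp: leaving_def)
    have "a \<in> B" "b \<in> B" using a b cutB by (auto simp: cutE)
    let ?T = "{i \<in> B. t i = w}" and ?H = "{i \<in> B. h i = w}"
    have "?T \<inter> ?H = {}"
    proof (rule equals0I)
      fix i assume "i \<in> ?T \<inter> ?H"
      then have "i \<in> B" "t i = h i" by simp_all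
      then show False using noloop by blast
    qed
    moreover have "?T \<union> ?H = B \<inter> cut G {w}"
    proof (rule set_eqI)
      show "i \<in> ?T \<union> ?H \<longleftrightarrow> i \<in> B \<inter> cut G {w}" for i
        using noloop[of i] subsetD[OF BE, of i] by (cases "i \<in> B") (auto simp: cutE)
    qed
    ultimately have "card ?T + card ?H = 2" using c2 finB card_Un_disjoint[of ?T ?H] by simp
    moreover have "a \<in> ?T" "b \<in> ?H" using a b \<open>a \<in> B\<close> \<open>b \<in> B\<close> by auto
    then have "card ?T \<noteq> 0" "card ?H \<noteq> 0" using finB by auto
    ultimately have "card ?T = 1" "card ?H = 1" by linarith+
    then show ?thesis using cm by (metis card_1_singletonE)
  qed
  have bal: "card (leaving B t h W) = card (leaving B h t W)" for W
  proof -
    have "card {i \<in> B. t i = n} = card {i \<in> B. h i = n}" for n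
    proof (cases "n \<in> R")
      case True
      then obtain a b where "{i \<in> B. t i = n} = {a}" "{i \<in> B. h i = n} = {b}" using local by meson
      then show ?thesis by simp
    next
      case False
      then have "{i \<in> B. t i = n} = {}" "{i \<in> B. h i = n} = {}" using BR by blast+
      then show ?thesis by (metis card.empty)
    qed
    from balanced_sets[OF finB this] show ?thesis by (simp add: leaving_def)
  qed
  have finL: "finite (leaving B f f' W)" for f f' :: "'e \<Rightarrow> 'v" and W using finB by (simp add: leaving_def)
  have bal0: "leaving B t h W = {} \<longleftrightarrow> leaving B h t W = {}" for W
    using bal[of W] finL by (metis card_eq_0_iff)
  interpret circuit ?N ?E B R t h
  proof
    show "finite ?N" "finite ?E" by (rule finite_nodes, rule finite_edges)
    show "B \<subseteq> ?E" "R \<subseteq> ?N" by (rule BE, rule RN)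
    show "t e \<in> ?N \<and> h e \<in> ?N" if "e \<in> ?E" for e using endsN[OF that] .
    show "leaving ?E t h X \<noteq> {}" if X: "X \<noteq> {}" "X \<subset> ?N" for X
      using D without[of "{}"] X unfolding deletable_def by auto
    show "R \<noteq> {}" using B_ne BR by blast
    show "t b \<in> R \<and> h b \<in> R" if "b \<in> B" for b using BR[OF that] .
    show "in_chord ?E B t h w \<longleftrightarrow> \<not> in_chord ?E B h t w" if w: "w \<in> R" for w
    proof -
      obtain m where m: "cut G {w} - B = {m}" using local[OF w] by blast
      have mem: "e \<in> ?E - B \<and> (t e = w) \<noteq> (h e = w) \<longleftrightarrow> e = m" for e
      proof -
        have "e \<in> cut G {w} - B \<longleftrightarrow> e = m" using m by simp
        then show ?thesis by (simp add: cutE conj_ac)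
      qed
      have "in_chord ?E B t h w \<longleftrightarrow> h m = w" "in_chord ?E B h t w \<longleftrightarrow> t m = w"
        unfolding in_chord_def using mem by metis+
      then show ?thesis using mem[of m] by blast
    qed
    show "leaving B t h W \<noteq> {}" if W: "W \<inter> R \<noteq> {}" "\<not> R \<subseteq> W" for W
    proof
      assume "leaving B t h W = {}"
      \<comment> \<open>By balance no arc of \<open>B\<close> enters \<open>W\<close> either, so the
        edges of \<open>B\<close> inside \<open>W\<close> form a smaller circular set, against
        minimality.\<close>
      then have nocross: "t b \<in> W \<longleftrightarrow> h b \<in> W" if "b \<in> B" for b
        using bal0[of W] that by (auto simp: leaving_def)
      let ?B = "{b \<in> B. t b \<in> W}"
      obtain x y where xy: "x \<in> R" "x \<in> W" "y \<in> R" "y \<notin> W" using W by blast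
      obtain a b where "a \<in> {i \<in> B. t i = x}" "b \<in> {i \<in> B. t i = y}" using local xy by (metis singletonI)
      then have ab: "a \<in> ?B" "b \<in> B - ?B" using xy by auto
      have "circular G ?C ?B"
        unfolding circular_def
      proof (intro conjI ballI)
        show "?B \<noteq> {}" "?B \<subseteq> ?C" using ab BC by blast+
        fix e v assume e: "e \<in> ?B" and v: "v \<in> ends G e"
        have "e \<in> ?E" using e BE by blast
        then have "v \<in> W" using e v nocross[of e] endsE[of e] by auto
        show "cubic G v" "e \<in> cut G {v}" using e v circB unfolding circular_def by blast+
        show "?C \<inter> cut G {v} \<subseteq> ?B"
        proof
          fix f assume f: "f \<in> ?C \<inter> cut G {v}"
          then have "f \<in> B" using e v circB unfolding circular_def by blast
          moreover have "t f = v \<or> h f = v" using f by (auto simp: cutE)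
          ultimately show "f \<in> ?B" using nocross[of f] \<open>v \<in> W\<close> by auto
        qed
      qed
      then show False using minB[of ?B] ab by blast
    qed
  qed
  obtain g v u where g: "g \<in> B" "{t g, h g} = {v, u}" "in_chord ?E B h t v" "in_chord ?E B t h u" "\<And>X. \<not> stuck g X"
    using unstuck_edge by metis
  \<comment> \<open>\<open>B\<close> is reversed only if this is needed to make \<open>g\<close>
    start at its end \<open>v\<close> with the out-chord.\<close>
  define sw where "sw e \<longleftrightarrow> e \<in> B \<and> t g \<noteq> v" for e
  define D' where "D' = \<lparr>verts = ?N, arcs = ?E, tail = (\<lambda>e. if sw e then h e else t e), head = (\<lambda>e. if sw e then t e else h e)\<rparr>"
  let ?t = "\<lambda>e. if sw e then h e else t e" and ?h = "\<lambda>e. if sw e then t e else h e"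
  have or': "orientation G D'" using endsE by (auto simp: orientation_def D'_def insert_commute)
  have without': "strong_without D' F \<longleftrightarrow> (\<forall>X. X \<noteq> {} \<and> X \<subset> ?N \<longrightarrow> leaving (?E - F) ?t ?h X \<noteq> {})" for F
  proof -
    have "leaving (?E - F) ?t ?h X \<noteq> {} \<longleftrightarrow> (\<exists>a\<in>arcs D' - F. tail D' a \<in> X \<and> head D' a \<in> verts D' - X)" for X
      using endsN by (auto simp: leaving_def D'_def)
    then show ?thesis by (simp add: strong_without_def D'_def)
  qed
  have LB: "leaving B ?t ?h X = (if t g = v then leaving B t h X else leaving B h t X)" for X
    by (auto simp: leaving_def sw_def)
  have LB0: "leaving B ?t ?h X = {} \<longleftrightarrow> leaving B t h X = {}" for X
    using bal0[of X] unfolding LB by simp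
  have LE: "leaving (?E - B) ?t ?h X = leaving (?E - B) t h X" for X
    by (auto simp: leaving_def sw_def)
  have split: "leaving (?E - F) f f' X = leaving B f f' X \<union> (leaving (?E - B) f f' X - F)" if "F \<inter> B = {}" for F f f' X
    using that BE unfolding leaving_def by blast
  have keep: "strong_without D' F" if F: "F \<inter> B = {}" "strong_without D F" for F
    using F(2) unfolding without without' split[OF F(1)] LE using LB0 by simp
  have "strong_without D' {g}"
    unfolding without'
  proof (intro allI impI notI)
    fix X assume X: "X \<noteq> {} \<and> X \<subset> ?N" and no: "leaving (?E - {g}) ?t ?h X = {}"
    have "strong_without D {}" using D by (simp add: deletable_def)
    then have "strong_without D' {}" by (intro keep) auto
    then have "leaving (?E - {}) ?t ?h X \<noteq> {}" using X unfolding without' by blast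
    then obtain e where e: "e \<in> leaving ?E ?t ?h X" by auto
    then have "e = g" using no unfolding leaving_def by blast
    then have gX: "?t g \<in> X" "?h g \<notin> X" using e unfolding leaving_def by blast+
    have vuX: "v \<in> X" "u \<notin> X"
    proof -
      have "?t g = v \<and> ?h g = u" using g(1,2) by (auto simp: sw_def doubleton_eq_iff)
      then show "v \<in> X" "u \<notin> X" using gX by metis+
    qed
    \<comment> \<open>\<open>g\<close> is the only arc out of \<open>X\<close>. As reversal
      preserves the number of circuit arcs out of \<open>X\<close>, this set is stuck already in the
      original orientation.\<close>
    have "card (leaving B t h X) = card (leaving B ?t ?h X)" unfolding LB using bal[of X] by simp
    moreover have "leaving B ?t ?h X = {g}" using no gX g(1) BE unfolding leaving_def by blast
    ultimately have "card (leaving B t h X) = 1" by simp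
    moreover have "leaving (?E - B) t h X = {}" using no g(1) unfolding LE[symmetric] unfolding leaving_def by blast
    ultimately have "stuck g X" using g(1-4) vuX X unfolding stuck_def by blast
    then show False using g(5) by blast
  qed
  then show ?thesis using or' keep g(1) by blast
qed

text \<open>Minimal circular sets are disjoint from each other and from \<open>M\<close>, so a
  reversal keeps every deletion gained on the others.\<close>

lemma (in fin_mgraph) reverse_circuits:
  assumes M: "M \<subseteq> edges G" "\<And>v. cubic G v \<Longrightarrow> card (M \<inter> cut G {v}) = 1"
    and D: "deletable G D M" and \<B>: "finite \<B>" "\<And>B. B \<in> \<B> \<Longrightarrow> min_circular G (edges G - M) B"
  shows "\<exists>D'. deletable G D' M \<and> (\<forall>B\<in>\<B>. \<exists>g\<in>B. strong_without D' {g})"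
  using \<B>
proof (induction \<B>)
  case empty
  then show ?case using D by blast
next
  case (insert B \<B>)
  then obtain D1 where D1: "deletable G D1 M" "\<And>B. B \<in> \<B> \<Longrightarrow> \<exists>g\<in>B. strong_without D1 {g}" by auto
  have B: "min_circular G (edges G - M) B" using insert.prems by simp
  obtain D2 g where D2: "orientation G D2" "\<And>F. F \<inter> B = {} \<Longrightarrow> strong_without D1 F \<Longrightarrow> strong_without D2 F"
    "g \<in> B" "strong_without D2 {g}"
    using reverse_circuit[OF M D1(1) B] by blast
  have "B \<inter> M = {}" using B by (auto simp: min_circular_def circular_def)
  then have "deletable G D2 M"
    unfolding deletable_def
  proof (intro conjI allI impI)
    fix F assume F: "F = {} \<or> (\<exists>a\<in>M. F = {a})"
    then have "F \<inter> B = {}" using \<open>B \<inter> M = {}\<close> by blast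
    then show "strong_without D2 F" using D2(2) D1(1) F unfolding deletable_def by blast
  qed (rule D2(1))
  moreover have "\<exists>g\<in>B'. strong_without D2 {g}" if "B' \<in> insert B \<B>" for B'
  proof (cases "B' = B")
    case True
    then show ?thesis using D2(3,4) by blast
  next
    case False
    then have "B' \<in> \<B>" using that by simp
    then obtain f where f: "f \<in> B'" "strong_without D1 {f}" using D1(2) by blast
    have "B' \<inter> B = {}" using min_circular_disjoint[OF _ B False] insert.prems \<open>B' \<in> \<B>\<close> by simp
    then show ?thesis using D2(2)[of "{f}"] f by blast
  qed
  ultimately show ?case by blast
qed

text \<open>As \<open>L\<close> is not circular, some edge \<open>e\<close> of it has an end
  \<open>v\<close> where no other edge of \<open>L\<close> competes: \<open>v\<close> is not cubic,
  or \<open>e\<close> is a loop, or an edge of \<open>C\<close> at \<open>v\<close> is missing from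
  \<open>L\<close>. Once the rest is split, \<open>e\<close> meets at most one other edge at its
  second end, if that is cubic, and joins the set avoiding it.\<close>

lemma (in fin_mgraph) two_sparse_sets:
  assumes C: "C \<subseteq> edges G" "\<And>v. cubic G v \<Longrightarrow> card (C \<inter> cut G {v}) \<le> 2"
    and L: "L \<subseteq> C" "\<And>B. B \<subseteq> L \<Longrightarrow> \<not> circular G C B"
  shows "\<exists>S T. sparse_at_cubic G S \<and> sparse_at_cubic G T \<and> S \<inter> T = {} \<and> S \<union> T = L"
proof -
  have "finite L" using L(1) C(1) finite_edges by (meson finite_subset)
  then show ?thesis using L
  proof (induction "card L" arbitrary: L rule: less_induct)
    case less
    show ?case
    proof (cases "L = {}")
      case True
      then show ?thesis by (auto simp: sparse_at_cubic_def)
    next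
      case False
      have "\<not> circular G C L" using less.prems by blast
      then obtain e v where e: "e \<in> L" "v \<in> ends G e" and v: "\<not> (cubic G v \<and> e \<in> cut G {v} \<and> C \<inter> cut G {v} \<subseteq> L)"
        using False less.prems(2) unfolding circular_def by blast
      have eE: "e \<in> edges G" using e less.prems(2) C(1) by blast
      then obtain w where w: "ends G e = {v, w}" using ends_in_nodes[OF eE] e(2) by (metis insertE insert_commute singletonD)
      let ?L = "L - {e}"
      have "card ?L < card L" using e(1) less.prems(1) by (rule card_Diff1_less[rotated])
      moreover have "\<not> circular G C B" if "B \<subseteq> ?L" for B using less.prems(3) that by blast
      ultimately have "\<exists>S T. sparse_at_cubic G S \<and> sparse_at_cubic G T \<and> S \<inter> T = {} \<and> S \<union> T = ?L"
        using less.hyps[of ?L] less.prems(1,2) by blast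
      then obtain S T where ST: "sparse_at_cubic G S" "sparse_at_cubic G T" "S \<inter> T = {}" "S \<union> T = ?L" by blast
      have fL: "finite L" by (rule less.prems(1))
      have at_v: "?L \<inter> cut G {v} = {}" if "cubic G v" "e \<in> cut G {v}"
      proof -
        have "L \<inter> cut G {v} \<subset> C \<inter> cut G {v}" using v that less.prems(2) by blast
        moreover have "finite (C \<inter> cut G {v})" using finite_cut by simp
        ultimately have "card (L \<inter> cut G {v}) < card (C \<inter> cut G {v})" by (rule psubset_card_mono[rotated])
        then have "card (L \<inter> cut G {v}) \<le> 1" using C(2)[OF that(1)] by linarith
        moreover have "finite (L \<inter> cut G {v})" "e \<in> L \<inter> cut G {v}" using fL e(1) that(2) by auto
        ultimately have "f = e" if "f \<in> L \<inter> cut G {v}" for f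
          using that unfolding One_nat_def card_le_Suc0_iff_eq[OF \<open>finite (L \<inter> cut G {v})\<close>] by blast
        then show ?thesis by blast
      qed
      have at_w: "S \<inter> cut G {w} = {} \<or> T \<inter> cut G {w} = {}" if "cubic G w" "e \<in> cut G {w}"
      proof (rule ccontr)
        assume "\<not> ?thesis"
        then obtain a b where ab: "a \<in> S" "a \<in> cut G {w}" "b \<in> T" "b \<in> cut G {w}" by blast
        then have "{a, b, e} \<subseteq> C \<inter> cut G {w}" using ST(4) that(2) e(1) less.prems(2) by blast
        then have "card {a, b, e} \<le> card (C \<inter> cut G {w})" using finite_cut by (intro card_mono) auto
        moreover have "a \<noteq> b" "a \<noteq> e" "b \<noteq> e" using ab ST(3,4) by blast+
        ultimately show False using C(2)[OF that(1)] by simp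
      qed
      have ext: "sparse_at_cubic G (insert e Q)"
        if Q: "sparse_at_cubic G Q" "Q \<subseteq> ?L" "cubic G w \<Longrightarrow> e \<in> cut G {w} \<Longrightarrow> Q \<inter> cut G {w} = {}" for Q
        unfolding sparse_at_cubic_def
      proof (intro conjI allI impI)
        show "insert e Q \<subseteq> edges G" using Q(1) eE by (simp add: sparse_at_cubic_def)
        fix x assume x: "cubic G x"
        show "card (insert e Q \<inter> cut G {x}) \<le> 1"
        proof (cases "e \<in> cut G {x}")
          case True
          then have "x = v \<or> x = w" using cut_ends[OF eE w, of "{x}"] by auto
          then have "Q \<inter> cut G {x} = {}" using Q(2,3) at_v True x by blast
          then have "insert e Q \<inter> cut G {x} = {e}" using True by blast
          then show ?thesis by simp
        next
          case False
          then have "insert e Q \<inter> cut G {x} = Q \<inter> cut G {x}" by blast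
          then show ?thesis using Q(1) x by (simp add: sparse_at_cubic_def)
        qed
      qed
      have "(cubic G w \<longrightarrow> e \<in> cut G {w} \<longrightarrow> S \<inter> cut G {w} = {}) \<or> (cubic G w \<longrightarrow> e \<in> cut G {w} \<longrightarrow> T \<inter> cut G {w} = {})"
        using at_w by blast
      then show ?thesis
      proof
        assume "cubic G w \<longrightarrow> e \<in> cut G {w} \<longrightarrow> S \<inter> cut G {w} = {}"
        then have "sparse_at_cubic G (insert e S)" using ext[OF ST(1)] ST(4) by blast
        moreover have "insert e S \<inter> T = {}" "insert e S \<union> T = L" using ST(3,4) e(1) by blast+
        ultimately show ?thesis using ST(2) by blast
      next
        assume "cubic G w \<longrightarrow> e \<in> cut G {w} \<longrightarrow> T \<inter> cut G {w} = {}"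
        then have "sparse_at_cubic G (insert e T)" using ext[OF ST(2)] ST(4) by blast
        moreover have "S \<inter> insert e T = {}" "S \<union> insert e T = L" using ST(3,4) e(1) by blast+
        ultimately show ?thesis using ST(1) by blast
      qed
    qed
  qed
qed

section \<open>The three orientations\<close>

theorem theorem5:
  fixes G :: "('v, 'e) mgraph"
  assumes "fin_mgraph G"
    and "essentially_4_edge_connected G"
  shows "frank_number G \<le> 3"
proof -
  interpret fin_mgraph G by (rule assms(1))
  have "k_edge_connected 3 G" using assms(2) by (simp add: essentially_4_edge_connected_def)
  then obtain M where M: "M \<subseteq> edges G" "\<And>v. cubic G v \<Longrightarrow> card (M \<inter> cut G {v}) = 1"
    using cubic_matching by blast
  have del: "\<exists>D. deletable G D A" if "sparse_at_cubic G A" for A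
    using deletable_set[OF assms that] .
  have "sparse_at_cubic G M" using M by (simp add: sparse_at_cubic_def)
  then obtain D where "deletable G D M" using del by blast
  let ?C = "edges G - M"
  have finC: "finite ?C" using finite_edges by simp
  have "finite {B. min_circular G ?C B}"
    by (rule finite_subset[of _ "Pow ?C"]) (use finC in \<open>auto simp: min_circular_def circular_def\<close>)
  then have "\<exists>D0. deletable G D0 M \<and> (\<forall>B\<in>{B. min_circular G ?C B}. \<exists>g\<in>B. strong_without D0 {g})"
    by (intro reverse_circuits[where D = D]) (use M \<open>deletable G D M\<close> in simp_all)
  then obtain D0 where D0: "deletable G D0 M" "\<And>B. min_circular G ?C B \<Longrightarrow> \<exists>g\<in>B. strong_without D0 {g}"
    by (metis mem_Collect_eq)
  let ?L = "{e \<in> ?C. \<not> strong_without D0 {e}}"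
  have nc: "\<not> circular G ?C B" if "B \<subseteq> ?L" for B
  proof
    assume "circular G ?C B"
    then obtain B' where "B' \<subseteq> B" "min_circular G ?C B'" using min_circular_exists[OF finC] by blast
    then show False using D0(2) that by blast
  qed
  have c2: "card (?C \<inter> cut G {v}) \<le> 2" if "cubic G v" for v
  proof -
    have "?C \<inter> cut G {v} = cut G {v} - M \<inter> cut G {v}" using cut_subset[of G] by blast
    then have "card (?C \<inter> cut G {v}) = card (cut G {v}) - card (M \<inter> cut G {v})"
      using finite_cut by (simp add: card_Diff_subset)
    then show ?thesis using M(2)[OF that] that by (simp add: cubic_def)
  qed
  have "?L \<subseteq> ?C" by blast
  from two_sparse_sets[OF Diff_subset c2 this nc] obtain S T where ST: "sparse_at_cubic G S" "sparse_at_cubic G T" "S \<union> T = ?L" by metis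
  obtain D1 D2 where D12: "deletable G D1 S" "deletable G D2 T" using del ST(1,2) by metis
  define D' where "D' i = (if i = 0 then D0 else if i = 1 then D1 else D2)" for i :: nat
  have "orientation G (D' i)" for i using D0(1) D12 by (simp add: D'_def deletable_def)
  moreover have "\<exists>i<3. strong (pre_digraph.del_arc (D' i) e)" if e: "e \<in> edges G" for e
  proof -
    consider "e \<in> M \<or> strong_without D0 {e}" | "e \<in> S" | "e \<in> T" using e ST(3) by blast
    then show ?thesis
    proof cases
      case 1
      then have "strong_without (D' 0) {e}" using D0(1) by (auto simp: D'_def deletable_def)
      then show ?thesis unfolding strong_del_arc by (intro exI[of _ 0]) simp
    next
      case 2
      then have "strong_without (D' 1) {e}" using D12(1) by (auto simp: D'_def deletable_def)
      then show ?thesis unfolding strong_del_arc by (intro exI[of _ 1]) simp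
    next
      case 3
      then have "strong_without (D' 2) {e}" using D12(2) by (auto simp: D'_def deletable_def)
      then show ?thesis unfolding strong_del_arc by (intro exI[of _ 2]) simp
    qed
  qed
  ultimately have "frank_cover G 3" by (auto simp: frank_cover_def)
  then have "frank_number G \<le> enat 3" unfolding frank_number_def by (intro INF_lower) simp
  then show ?thesis by (simp add: numeral_eq_enat)
qed

end
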